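(* Let $K$ be a finite simplicial complex and let $\tau$ be a simplex (possibly empty) whose vertex set is disjoint from $V_K$. Then $K$ is a minimal $NH$-ball if and only if $K^{\tau}$ is a minimal $NH$-ball.
   Context: All simplicial complexes are finite. $\Delta^d$ denotes a $d$-simplex, $\partial\Delta^d$ its boundary; $\{\emptyset\}$ is the complex with only the empty simplex, regarded as the sphere of dimension $-1$. $V_K$ is the vertex set of $K$; $\Delta(V)$ is the simplex spanned by $V$. A simplex is principal in $K$ if it is not a proper face of another simplex; $\mathsf{m}(K)$ is the number of principal simplices. A subcomplex $L\subset K$ is top generated if every principal simplex of $L$ is principal in $K$. $K+L$ denotes union; $lk(v,K)$ is the link. A combinatorial $d$-ball is a complex having a common subdivision with $\Delta^d$; its boundary $\partial L$ is generated by the $(d-1)$-simplices that are faces of exactly one $d$-simplex. A complex is collapsible if some subdivision collapses simplicially to a vertex. $NH$-manifolds/balls/spheres of dimension $0$ are the $0$-dimensional manifolds/balls/spheres; the $NH$-sphere of dimension $-1$ is $\{\emptyset\}$. For $d\ge1$ inductively: an $NH$-manifold of dimension $d$ is a $d$-dimensional complex $M$ such that each vertex link is an $NH$-ball of dimension in $[0,d-1]$ or an $NH$-sphere of dimension in $[-1,d-1]$; an $NH$-ball of dimension $d$ is a collapsible $NH$-manifold of dimension $d$; an $NH$-sphere of dimension $d$ and homotopy dimension $k$ is an $NH$-manifold $S$ of dimension $d$ for which there exist a top generated $NH$-ball $B$ of dimension $d$ and a top generated combinatorial $k$-ball $L$ with $B+L=S$, $B\cap L=\partial L$ (a decomposition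 of $S$); write $\dim_h(S)=k$. A minimal $NH$-sphere is an $NH$-sphere $S$ with $\mathsf{m}(S)=\dim_h(S)+2$. A minimal $NH$-ball is an $NH$-ball $B$ for which there is a minimal $NH$-sphere $S$ admitting a decomposition $S=B+L$. Alexander dual: for $V\supseteq V_K$, $K^{*_V}=\{\sigma\in\Delta(V):\Delta(V-V_\sigma)\notin K\}$. For a simplex $\tau$ with vertices disjoint from $V_K$, $K^\tau:=K^{*_V}$ with $V=V_K\cup V_\tau$; in particular $K^{\emptyset}=K^*:=K^{*_{V_K}}$.
   Formalization: The case where τ is empty and K is a full simplex Δ^d (d ≥ 0) is excluded: there K^* is the void family, not a complex, while Δ^d is a minimal NH-ball, so the equivalence fails. Complexes are taken to contain the empty simplex. *)

theory Defs
  imports "HOL-Analysis.Analysis" "HOL-Analysis.Finite_Function_Topology"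
    "HOL-Library.Infinite_Typeclass"
begin

text \<open>
  A simplex is its vertex set and a complex is its set of simplices. Every complex contains the
  empty simplex, so \<open>{{}}\<close> is the sphere of dimension -1 and the void family \<open>{}\<close> is not a complex.
  The simplex spanned by \<open>V\<close>, as a complex, is \<open>Pow V\<close>.
\<close>

definition fin_complex :: "'a set set \<Rightarrow> bool" where
  "fin_complex K \<longleftrightarrow>
     finite K \<and> {} \<in> K \<and> (\<forall>\<sigma>\<in>K. finite \<sigma>) \<and> (\<forall>\<sigma>\<in>K. \<forall>\<rho>. \<rho> \<subseteq> \<sigma> \<longrightarrow> \<rho> \<in> K)"

abbreviation vertices :: "'a set set \<Rightarrow> 'a set" where
  "vertices K \<equiv> \<Union>K"

definition cdim :: "'a set set \<Rightarrow> int" where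
  "cdim K = int (Max (card ` K)) - 1"

definition principal_simplices :: "'a set set \<Rightarrow> 'a set set" where
  "principal_simplices K = {\<sigma> \<in> K. \<not> (\<exists>\<tau>\<in>K. \<sigma> \<subset> \<tau>)}"

definition num_principal :: "'a set set \<Rightarrow> nat" where
  "num_principal K = card (principal_simplices K)"

definition top_generated :: "'a set set \<Rightarrow> 'a set set \<Rightarrow> bool" where
  "top_generated L K \<longleftrightarrow>
     fin_complex L \<and> L \<subseteq> K \<and> principal_simplices L \<subseteq> principal_simplices K"

definition vlink :: "'a \<Rightarrow> 'a set set \<Rightarrow> 'a set set" where
  "vlink v K = {\<sigma> \<in> K. v \<notin> \<sigma> \<and> insert v \<sigma> \<in> K}"

definition complex_iso :: "'a set set \<Rightarrow> 'b set set \<Rightarrow> bool" where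
  "complex_iso K L \<longleftrightarrow> (\<exists>f. inj_on f (vertices K) \<and> L = image f ` K)"


text \<open>
  The vertex \<open>v\<close> is realized as the unit vector \<open>e\<^sub>v\<close> of the real vector space of finitely
  supported functions on the vertex type.
\<close>

definition realize :: "'a set \<Rightarrow> ('a \<Rightarrow>\<^sub>0 real) set" where
  "realize \<sigma> = convex hull ((\<lambda>v. Poly_Mapping.single v 1) ` \<sigma>)"

definition geometric_complex :: "'v::real_vector set set \<Rightarrow> bool" where
  "geometric_complex G \<longleftrightarrow> fin_complex G \<and> (\<forall>\<sigma>\<in>G. \<not> affine_dependent \<sigma>) \<and>
     (\<forall>\<sigma>\<in>G. \<forall>\<rho>\<in>G. convex hull \<sigma> \<inter> convex hull \<rho> = convex hull (\<sigma> \<inter> \<rho>))"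

definition subdivision_of :: "('a \<Rightarrow>\<^sub>0 real) set set \<Rightarrow> 'a set set \<Rightarrow> bool" where
  "subdivision_of G K \<longleftrightarrow> geometric_complex G \<and>
     (\<Union>\<sigma>\<in>G. convex hull \<sigma>) = (\<Union>\<rho>\<in>K. realize \<rho>) \<and>
     (\<forall>\<sigma>\<in>G. \<exists>\<rho>\<in>K. convex hull \<sigma> \<subseteq> realize \<rho>)"

definition have_common_subdivision :: "'a set set \<Rightarrow> 'b set set \<Rightarrow> bool" where
  "have_common_subdivision K L \<longleftrightarrow>
     (\<exists>G H. subdivision_of G K \<and> subdivision_of H L \<and> complex_iso G H)"

definition combinatorial_ball :: "nat \<Rightarrow> 'a set set \<Rightarrow> bool" where
  "combinatorial_ball d L \<longleftrightarrow>
     fin_complex L \<and> have_common_subdivision L (Pow {0..d})"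

definition ball_boundary :: "nat \<Rightarrow> 'a set set \<Rightarrow> 'a set set" where
  "ball_boundary d L =
     {\<rho>. \<exists>\<sigma>\<in>L. card \<sigma> = d \<and> (\<exists>!\<tau>. \<tau> \<in> L \<and> card \<tau> = d + 1 \<and> \<sigma> \<subseteq> \<tau>) \<and> \<rho> \<subseteq> \<sigma>}"

text \<open>
  Uniqueness of the proper coface \<open>\<tau>\<close> of \<open>\<sigma>\<close> forces \<open>\<tau>\<close> to be principal of dimension one more
  than \<open>\<sigma>\<close>. The empty simplex is never a free face.
\<close>

definition elementary_collapse :: "'a set set \<Rightarrow> 'a set set \<Rightarrow> bool" where
  "elementary_collapse K L \<longleftrightarrow>
     (\<exists>\<sigma>\<in>K. \<exists>\<tau>\<in>K. \<sigma> \<noteq> {} \<and> \<sigma> \<subset> \<tau> \<and> (\<forall>\<rho>\<in>K. \<sigma> \<subset> \<rho> \<longrightarrow> \<rho> = \<tau>) \<and> L = K - {\<sigma>, \<tau>})"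

definition collapsible :: "'a set set \<Rightarrow> bool" where
  "collapsible K \<longleftrightarrow>
     (\<exists>G v. subdivision_of G K \<and> elementary_collapse\<^sup>*\<^sup>* G {{}, {v}})"


definition ball_gluing ::
    "nat \<Rightarrow> 'a set set \<Rightarrow> 'a set set \<Rightarrow> 'a set set \<Rightarrow> bool" where
  "ball_gluing k S B L \<longleftrightarrow>
     top_generated B S \<and> top_generated L S \<and> combinatorial_ball k L \<and>
     B \<union> L = S \<and> B \<inter> L = ball_boundary k L"

text \<open>
  \<open>NH_sphere d k S\<close>: \<open>S\<close> is an NH-sphere of dimension \<open>d\<close> and homotopy dimension \<open>k\<close>.
  For the spheres of dimension 0 and -1 the homotopy dimension is the dimension.
\<close>

inductive NH_manifold :: "int \<Rightarrow> 'a set set \<Rightarrow> bool"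
  and NH_ball :: "int \<Rightarrow> 'a set set \<Rightarrow> bool"
  and NH_sphere :: "int \<Rightarrow> int \<Rightarrow> 'a set set \<Rightarrow> bool"
where
  manifold_0: "fin_complex M \<Longrightarrow> cdim M = 0 \<Longrightarrow> NH_manifold 0 M"
| ball_0: "NH_ball 0 {{}, {v}}"
| sphere_minus1: "NH_sphere (-1) (-1) {{}}"
| sphere_0: "u \<noteq> v \<Longrightarrow> NH_sphere 0 0 {{}, {u}, {v}}"
| manifold: "1 \<le> d \<Longrightarrow> fin_complex M \<Longrightarrow> cdim M = d \<Longrightarrow>
    (\<forall>v \<in> vertices M.
       (\<exists>i\<in>{0..d-1}. NH_ball i (vlink v M)) \<or>
       (\<exists>i\<in>{-1..d-1}. \<exists>k. NH_sphere i k (vlink v M))) \<Longrightarrow>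
    NH_manifold d M"
| ball: "1 \<le> d \<Longrightarrow> NH_manifold d B \<Longrightarrow> collapsible B \<Longrightarrow> NH_ball d B"
| sphere: "1 \<le> d \<Longrightarrow> NH_manifold d S \<Longrightarrow> NH_ball d B \<Longrightarrow> ball_gluing k S B L \<Longrightarrow>
    NH_sphere d (int k) S"

definition minimal_NH_sphere :: "int \<Rightarrow> int \<Rightarrow> 'a set set \<Rightarrow> bool" where
  "minimal_NH_sphere d k S \<longleftrightarrow> NH_sphere d k S \<and> int (num_principal S) = k + 2"

text \<open>
  The sphere \<open>S\<close> may need vertices outside \<open>B\<close>, hence the infinite vertex type.
\<close>

definition minimal_NH_ball :: "'a::infinite set set \<Rightarrow> bool" where
  "minimal_NH_ball B \<longleftrightarrow>
     (\<exists>d k S L. NH_ball d B \<and> minimal_NH_sphere d (int k) S \<and> ball_gluing k S B L)"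


definition alexander_dual :: "'a set \<Rightarrow> 'a set set \<Rightarrow> 'a set set" where
  "alexander_dual V K = {\<sigma>. \<sigma> \<subseteq> V \<and> V - \<sigma> \<notin> K}"

definition dual_rel :: "'a set set \<Rightarrow> 'a set \<Rightarrow> 'a set set" where
  "dual_rel K \<tau> = alexander_dual (vertices K \<union> \<tau>) K"

end

theory Submission
  imports Defs
begin

text \<open>
  A complex is a minimal NH-ball exactly when its facets are the sets \<open>V - ({w} \<union> D w)\<close>, \<open>w \<in> W\<close>,
  where the sets \<open>D w\<close> form a chain, avoid \<open>W\<close>, and together with \<open>W\<close> do not cover \<open>V\<close>.
  This class is closed under Alexander duality, and duality is an involution, so the theorem follows.

  To see that a minimal NH-ball \<open>B\<close> has this form, let \<open>S = B + L\<close> have \<open>k + 2\<close> facets. The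
  top simplices of \<open>L\<close> and a chain filling the boundary of \<open>L\<close> in the acyclic complex \<open>B\<close> form a
  nonbounding \<open>k\<close>-cycle modulo two. By the Mayer-Vietoris argument, any \<open>k + 1\<close> facets of \<open>S\<close> then
  have a common vertex while all of them do not, so each facet \<open>F\<close> is the only one missing a certain
  vertex. The link of the intersection of two facets \<open>F\<close> and \<open>F'\<close> of \<open>B\<close> is therefore the disjoint
  union of the simplices \<open>F - F'\<close> and \<open>F' - F\<close>, one of which must be a vertex; this is
  the chain condition. Acyclicity passes from a subdivision to the complex, since subdividing a
  chain and then applying a simplicial approximation of the identity is the identity (Sperner).

  Conversely, links of complexes of this form are of this form, so induction on \<open>V\<close> shows that they
  are NH-balls if they are cones and NH-spheres otherwise.
\<close>

section \<open>Chains modulo two\<close>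

text \<open>Collapsibility and combinatorial balls are defined by geometric subdivisions, so the
  homological argument needs a bridge from linear geometry to combinatorics. The bridge is one
  incidence count: in a subdivided simplex, a simplex of codimension one has one full-dimensional
  coface if it lies in the boundary and two otherwise. It makes subdivision a chain map modulo two,
  and it bounds the number of \<open>k\<close>-simplices around a \<open>(k-1)\<close>-simplex of a
  combinatorial \<open>k\<close>-ball. In the normal form, \<open>w\<close> is a point missed by one
  facet alone, and \<open>D w\<close> is the rest of the complement of that facet. The ambient set
  \<open>V\<close> may contain points that are not vertices. This keeps links and duals in the
  class, and it lets the converse of the theorem be the forward direction applied to the dual over
  the same ambient set. The case excluded in the theorem is a nonempty simplex with empty
  \<open>\<tau>\<close>: a simplex is a minimal ball, but its dual is the void family, which is not
  a complex.\<close>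

text \<open>A chain with coefficients modulo two is a finite set of simplices, and \<open>lin M\<close> is the linear
  extension of a map \<open>M\<close> from simplices to chains. The empty simplex is a generator, so that
  cycles and boundaries compute reduced homology.\<close>

definition lin :: "('x \<Rightarrow> 'y set) \<Rightarrow> 'x set \<Rightarrow> 'y set" where
  "lin M c = {y. odd (card {x \<in> c. y \<in> M x})}"

lemma odd_card_sym_diff:
  assumes "finite a" "finite b"
  shows "odd (card (sym_diff a b)) \<longleftrightarrow> odd (card a) \<noteq> odd (card b)"
proof -
  have "card (sym_diff a b) = card (a - b) + card (b - a)"
    using assms by (subst card_Un_disjoint) auto
  moreover have "card a = card (a - b) + card (a \<inter> b)"
    using assms by (subst card_Un_disjoint[symmetric]) (auto intro: arg_cong[where f = card])
  moreover have "card b = card (b - a) + card (a \<inter> b)"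
    using assms by (subst card_Un_disjoint[symmetric]) (auto intro: arg_cong[where f = card])
  ultimately show ?thesis by presburger
qed

lemma lin_empty [simp]: "lin M {} = {}"
  by (simp add: lin_def)

lemma lin_singleton [simp]: "lin M {x} = M x"
proof -
  have "{u \<in> {x}. y \<in> M u} = (if y \<in> M x then {x} else {})" for y by auto
  then show ?thesis by (auto simp: lin_def split: if_splits)
qed

lemma lin_sym_diff:
  assumes "finite a" "finite b"
  shows "lin M (sym_diff a b) = sym_diff (lin M a) (lin M b)"
proof -
  have "{x \<in> sym_diff a b. y \<in> M x} = sym_diff {x \<in> a. y \<in> M x} {x \<in> b. y \<in> M x}" for y
    by auto
  then have "odd (card {x \<in> sym_diff a b. y \<in> M x}) \<longleftrightarrow>
      odd (card {x \<in> a. y \<in> M x}) \<noteq> odd (card {x \<in> b. y \<in> M x})" for y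
    using odd_card_sym_diff[of "{x \<in> a. y \<in> M x}" "{x \<in> b. y \<in> M x}"] assms by simp
  then show ?thesis unfolding lin_def by blast
qed

lemma lin_insert:
  assumes "finite c" "x \<notin> c"
  shows "lin M (insert x c) = sym_diff (M x) (lin M c)"
proof -
  have "insert x c = sym_diff {x} c" using assms by auto
  then show ?thesis using lin_sym_diff[of "{x}" c M] assms by simp
qed

lemma lin_subset: "lin M c \<subseteq> (\<Union>x\<in>c. M x)"
proof
  fix y assume "y \<in> lin M c"
  then have "{x \<in> c. y \<in> M x} \<noteq> {}" unfolding lin_def by force
  then show "y \<in> (\<Union>x\<in>c. M x)" by auto
qed

lemma finite_lin:
  assumes "finite c" "\<And>x. x \<in> c \<Longrightarrow> finite (M x)"
  shows "finite (lin M c)"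
  by (rule finite_subset[OF lin_subset]) (use assms in auto)

lemma lin_cong:
  assumes "\<And>x. x \<in> c \<Longrightarrow> M x = N x"
  shows "lin M c = lin N c"
proof -
  have "{x \<in> c. y \<in> M x} = {x \<in> c. y \<in> N x}" for y using assms by auto
  then show ?thesis by (simp add: lin_def)
qed

lemma lin_add:
  assumes "finite c"
  shows "lin (\<lambda>x. sym_diff (M x) (N x)) c = sym_diff (lin M c) (lin N c)"
  using assms by (induction c) (auto simp: lin_insert)

lemma lin_single: "finite c \<Longrightarrow> lin (\<lambda>x. {x}) c = c"
  by (induction c rule: finite_induct) (auto simp: lin_insert)

lemma lin_zero: "lin (\<lambda>x. {}) c = {}"
  by (simp add: lin_def)

text \<open>Reduces an identity between linear operators to single simplices; this is why facts
  about chains below come as a simplex version followed by a short linear extension.\<close>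

lemma lin_comp:
  assumes "finite c" "\<And>x. x \<in> c \<Longrightarrow> finite (N x)"
  shows "lin M (lin N c) = lin (\<lambda>x. lin M (N x)) c"
  using assms
proof (induction c)
  case (insert x c)
  then have "finite (lin N c)" by (intro finite_lin) auto
  then show ?case using insert by (simp add: lin_insert lin_sym_diff)
qed simp

definition faces :: "'a set \<Rightarrow> 'a set set" where
  "faces s = (\<lambda>v. s - {v}) ` s"

abbreviation bd :: "'a set set \<Rightarrow> 'a set set" where
  "bd \<equiv> lin faces"

lemma finite_faces [simp]: "finite s \<Longrightarrow> finite (faces s)"
  by (simp add: faces_def)

lemma mem_faces_iff: "r \<in> faces s \<longleftrightarrow> (\<exists>v. v \<notin> r \<and> s = insert v r)"
  by (auto simp: faces_def image_iff)

lemma mem_faces_card: "r \<in> faces s \<Longrightarrow> finite s \<Longrightarrow> card s = Suc (card r)"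
  by (auto simp: mem_faces_iff)

lemma mem_faces_subset: "r \<in> faces s \<Longrightarrow> r \<subseteq> s"
  by (auto simp: faces_def)

lemma card_Suc_imp_mem_faces:
  assumes "r \<subseteq> s" "finite s" "card s = Suc (card r)"
  shows "r \<in> faces s"
proof -
  have "card (s - r) = 1" using assms by (simp add: card_Diff_subset finite_subset)
  then obtain v where "s - r = {v}" by (auto simp: card_1_singleton_iff)
  then have "v \<notin> r" "s = insert v r" using assms by auto
  then show ?thesis by (auto simp: mem_faces_iff)
qed

text \<open>A face of codimension two lies in exactly two faces of codimension one, because its two
  missing points can be removed in either order; the two occurrences cancel modulo two.\<close>

lemma bd_faces:
  assumes "finite s"
  shows "bd (faces s) = {}"
proof -
  have "even (card {x \<in> faces s. r \<in> faces x})" for r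
  proof (cases "{x \<in> faces s. r \<in> faces x} = {}")
    case False
    then obtain v w where vw: "v \<in> s" "w \<in> s" "v \<noteq> w" "r = s - {v} - {w}"
      by (auto simp: faces_def)
    then have "{x \<in> faces s. r \<in> faces x} = {s - {v}, s - {w}}"
      by (auto simp: faces_def)
    moreover have "s - {v} \<noteq> s - {w}" using vw by auto
    ultimately show ?thesis by simp
  next
    case True
    show ?thesis unfolding True by simp
  qed
  then show ?thesis by (simp add: lin_def)
qed

lemma bd_bd:
  assumes "finite c" "\<And>s. s \<in> c \<Longrightarrow> finite s"
  shows "bd (bd c) = {}"
proof -
  have "bd (bd c) = lin (\<lambda>s. bd (faces s)) c" using assms by (intro lin_comp) auto
  also have "\<dots> = lin (\<lambda>s. {}) c" using assms by (intro lin_cong bd_faces)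
  finally show ?thesis by (simp add: lin_zero)
qed

text \<open>A simplex that already contains \<open>v\<close> has a degenerate cone, which counts as
  zero; \<open>push\<close> treats noninjective images in the same way.\<close>

definition cone_over :: "'a \<Rightarrow> 'a set \<Rightarrow> 'a set set" where
  "cone_over v s = (if v \<in> s then {} else {insert v s})"

lemma faces_insert:
  assumes "v \<notin> s"
  shows "faces (insert v s) = insert s (insert v ` faces s)"
proof -
  have "insert v s - {u} = insert v (s - {u})" if "u \<in> s" for u using that assms by auto
  then have "(\<lambda>u. insert v s - {u}) ` s = (\<lambda>u. insert v (s - {u})) ` s" by (intro image_cong) auto
  moreover have "insert v s - {v} = s" using assms by simp
  ultimately show ?thesis by (simp add: faces_def image_image)
qed

text \<open>The chain homotopy formula between the identity and zero. If \<open>v\<close> is in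
  \<open>s\<close>, only the face \<open>s - {v}\<close> has a nonzero cone, and that cone is
  \<open>s\<close>. Otherwise the cones over the faces of \<open>s\<close> cancel against the
  boundary of \<open>insert v s\<close> except for \<open>s\<close>.\<close>

lemma bd_cone_simplex:
  assumes "finite s"
  shows "sym_diff (bd (cone_over v s)) (lin (cone_over v) (faces s)) = {s}"
proof (cases "v \<in> s")
  case True
  have "{x \<in> faces s. r \<in> cone_over v x} = (if r = s then {s - {v}} else {})" for r
    using True by (auto simp: faces_def cone_over_def split: if_splits)
  then have "lin (cone_over v) (faces s) = {s}" by (auto simp: lin_def split: if_splits)
  then show ?thesis using True by (simp add: cone_over_def)
next
  case False
  have eq: "{x \<in> faces s. r \<in> cone_over v x} = (if r \<in> insert v ` faces s then {r - {v}} else {})" for r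
    using False by (auto simp: faces_def cone_over_def split: if_splits)
  have "lin (cone_over v) (faces s) = insert v ` faces s"
    unfolding lin_def by (subst eq) (auto split: if_splits)
  moreover have "bd (cone_over v s) = insert s (insert v ` faces s)"
    using False by (simp add: cone_over_def faces_insert)
  moreover have "s \<notin> insert v ` faces s" using False by auto
  ultimately show ?thesis by auto
qed

lemma bd_cone:
  assumes "finite z" "\<And>s. s \<in> z \<Longrightarrow> finite s" "bd z = {}"
  shows "bd (lin (cone_over v) z) = z"
proof -
  have fin: "finite (cone_over v s)" for s by (simp add: cone_over_def)
  have "lin (cone_over v) (bd z) = lin (\<lambda>s. lin (cone_over v) (faces s)) z"
    using assms by (intro lin_comp) auto
  then have 1: "lin (\<lambda>s. lin (cone_over v) (faces s)) z = {}" using assms by simp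
  have "bd (lin (cone_over v) z) = lin (\<lambda>s. bd (cone_over v s)) z"
    using assms fin by (intro lin_comp) auto
  also have "\<dots> = sym_diff (lin (\<lambda>s. bd (cone_over v s)) z) (lin (\<lambda>s. lin (cone_over v) (faces s)) z)"
    using 1 by simp
  also have "\<dots> = lin (\<lambda>s. sym_diff (bd (cone_over v s)) (lin (cone_over v) (faces s))) z"
    using assms by (simp add: lin_add)
  also have "\<dots> = lin (\<lambda>s. {s}) z"
    using assms by (intro lin_cong bd_cone_simplex)
  finally show ?thesis using assms by (simp add: lin_single)
qed

definition push :: "('a \<Rightarrow> 'b) \<Rightarrow> 'a set \<Rightarrow> 'b set set" where
  "push f s = (if inj_on f s then {f ` s} else {})"

lemma image_Diff_duplicate:
  assumes "w \<in> s" "v \<in> s" "v \<noteq> w" "f w = f v"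
  shows "f ` (s - {v}) = f ` s"
proof
  show "f ` s \<subseteq> f ` (s - {v})"
  proof (rule image_subsetI)
    fix x assume "x \<in> s"
    show "f x \<in> f ` (s - {v})"
    proof (cases "x = v")
      case True
      then have "f x = f w" using assms by simp
      moreover have "w \<in> s - {v}" using assms by simp
      ultimately show ?thesis by (rule image_eqI)
    qed (use \<open>x \<in> s\<close> in blast)
  qed
qed blast

text \<open>If \<open>f\<close> is not injective on \<open>s\<close>, a face with injective image
  exists only when exactly two vertices \<open>v\<close> and \<open>w\<close> are identified; the
  faces opposite \<open>v\<close> and \<open>w\<close> are then the only ones of this kind, have the
  same image and cancel.\<close>

lemma bd_push_simplex:
  assumes "finite s"
  shows "bd (push f s) = lin (push f) (faces s)"
proof (cases "inj_on f s")
  case True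
  have inj: "inj_on f x" if "x \<in> faces s" for x
    using that True by (auto simp: faces_def intro: inj_on_subset)
  have im: "f ` (s - {v}) = f ` s - {f v}" if "v \<in> s" for v
    using that True by (auto simp: inj_on_def)
  have "{x \<in> faces s. r \<in> push f x} = {x \<in> faces s. f ` x = r}" for r
    using inj by (auto simp: push_def)
  moreover have "card {x \<in> faces s. f ` x = r} = (if r \<in> faces (f ` s) then 1 else 0)" for r
  proof (cases "r \<in> faces (f ` s)")
    case r: True
    then obtain v where v: "v \<in> s" "r = f ` s - {f v}" by (auto simp: faces_def)
    have "u = v" if "u \<in> s" "f ` s - {f u} = f ` s - {f v}" for u
    proof -
      have "f u = f v" using that by blast
      then show ?thesis using True that v by (auto dest: inj_onD)
    qed
    note uv = this
    have "x = s - {v}" if x: "x \<in> faces s" "f ` x = r" for x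
    proof -
      obtain u where u: "u \<in> s" "x = s - {u}" using x(1) unfolding faces_def by blast
      then have "f ` s - {f u} = f ` s - {f v}" using x(2) v(2) im[OF u(1)] by simp
      from uv[OF u(1) this] show ?thesis using u by simp
    qed
    moreover have "s - {v} \<in> faces s" "f ` (s - {v}) = r"
      using v im[OF v(1)] by (simp_all add: faces_def)
    ultimately have "{x \<in> faces s. f ` x = r} = {s - {v}}" by blast
    then show ?thesis using r by simp
  next
    case False
    have "f ` x \<in> faces (f ` s)" if "x \<in> faces s" for x
      using that im unfolding faces_def by blast
    then have empty: "{x \<in> faces s. f ` x = r} = {}" using False by blast
    show ?thesis unfolding empty using False by simp
  qed
  ultimately have "lin (push f) (faces s) = faces (f ` s)" by (auto simp: lin_def split: if_splits)
  then show ?thesis using True by (simp add: push_def)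
next
  case False
  have "even (card {x \<in> faces s. r \<in> push f x})" for r
  proof (cases "{x \<in> faces s. r \<in> push f x} = {}")
    case ne: False
    then obtain v where v: "v \<in> s" "inj_on f (s - {v})" "r = f ` (s - {v})"
      by (auto simp: faces_def push_def split: if_splits)
    have "f v \<in> f ` (s - {v})"
      using False v(1,2) inj_on_insert[of f v "s - {v}"] by (simp add: insert_absorb)
    then obtain w where "f v = f w" and w1: "w \<in> s - {v}" by (rule imageE)
    then have w: "w \<in> s - {v}" "f w = f v" by simp_all
    have "inj_on f (s - {w})"
    proof (rule inj_onI)
      fix x y assume "x \<in> s - {w}" "y \<in> s - {w}" "f x = f y"
      then show "x = y"
        using inj_onD[OF v(2), of x w] inj_onD[OF v(2), of y w] inj_onD[OF v(2), of x y] w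
        by (cases "x = v"; cases "y = v") auto
    qed
    moreover have "f ` (s - {w}) = r"
      using image_Diff_duplicate[of w s v f] image_Diff_duplicate[of v s w f] v w by auto
    ultimately have w': "inj_on f (s - {w})" "f ` (s - {w}) = r" by auto
    have "x = v \<or> x = w" if "x \<in> s" "inj_on f (s - {x})" for x
      using inj_onD[OF that(2), of v w] that v w by auto
    then have "x = s - {v} \<or> x = s - {w}" if "x \<in> faces s" "r \<in> push f x" for x
      using that unfolding faces_def push_def by (auto split: if_splits)
    moreover have "s - {v} \<in> faces s" "s - {w} \<in> faces s" using v(1) w(1) by (auto simp: faces_def)
    moreover have "r \<in> push f (s - {v})" "r \<in> push f (s - {w})" using v w' by (auto simp: push_def)
    ultimately have "{x \<in> faces s. r \<in> push f x} = {s - {v}, s - {w}}" by blast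
    moreover have "s - {v} \<noteq> s - {w}" using v w by auto
    ultimately show ?thesis by simp
  next
    case True
    show ?thesis unfolding True by simp
  qed
  then have "lin (push f) (faces s) = {}" by (simp add: lin_def)
  then show ?thesis using False by (simp add: push_def)
qed

lemma bd_push:
  assumes "finite c" "\<And>s. s \<in> c \<Longrightarrow> finite s"
  shows "bd (lin (push f) c) = lin (push f) (bd c)"
proof -
  have "bd (lin (push f) c) = lin (\<lambda>s. bd (push f s)) c"
    using assms by (intro lin_comp) (auto simp: push_def)
  also have "\<dots> = lin (\<lambda>s. lin (push f) (faces s)) c"
    using assms by (intro lin_cong bd_push_simplex)
  also have "\<dots> = lin (push f) (bd c)"
    using assms by (intro lin_comp[symmetric]) auto
  finally show ?thesis .
qed

section \<open>Acyclic complexes\<close>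

definition acyclic_complex :: "'a set set \<Rightarrow> bool" where
  "acyclic_complex K \<longleftrightarrow> (\<forall>z. z \<subseteq> K \<and> bd z = {} \<longrightarrow> (\<exists>y. y \<subseteq> K \<and> bd y = z))"

text \<open>Degrees count vertices: this is the vanishing of reduced homology in dimension
  \<open>n - 1\<close>. In degree 0 the empty simplex has to bound, so \<open>{{}}\<close> is not
  acyclic there.\<close>

definition acyclic_in :: "nat \<Rightarrow> 'a set set \<Rightarrow> bool" where
  "acyclic_in n K \<longleftrightarrow> (\<forall>z. z \<subseteq> K \<and> (\<forall>s\<in>z. card s = n) \<and> bd z = {} \<longrightarrow>
     (\<exists>y. y \<subseteq> K \<and> (\<forall>s\<in>y. card s = Suc n) \<and> bd y = z))"

lemma acyclic_inE:
  assumes "acyclic_in n K" "z \<subseteq> K" "\<forall>s\<in>z. card s = n" "bd z = {}"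
  obtains y where "y \<subseteq> K" "\<forall>s\<in>y. card s = Suc n" "bd y = z"
proof -
  have "\<exists>y. y \<subseteq> K \<and> (\<forall>s\<in>y. card s = Suc n) \<and> bd y = z"
    using assms(1)[unfolded acyclic_in_def, THEN spec, of z, THEN mp] assms(2-4) by simp
  then show thesis by (elim exE conjE) (rule that)
qed

lemma acyclic_complexE:
  assumes "acyclic_complex K" "z \<subseteq> K" "bd z = {}"
  obtains y where "y \<subseteq> K" "bd y = z"
proof -
  have "\<exists>y. y \<subseteq> K \<and> bd y = z"
    using assms(1)[unfolded acyclic_complex_def, THEN spec, of z, THEN mp] assms(2,3) by simp
  then show thesis by (elim exE conjE) (rule that)
qed

lemma fin_complexD:
  assumes "fin_complex K"
  shows "finite K" "{} \<in> K" "s \<in> K \<Longrightarrow> finite s" "s \<in> K \<Longrightarrow> r \<subseteq> s \<Longrightarrow> r \<in> K"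
  using assms by (auto simp: fin_complex_def)

lemma fin_complex_faces:
  "fin_complex K \<Longrightarrow> s \<in> K \<Longrightarrow> faces s \<subseteq> K"
  by (metis fin_complexD(4) mem_faces_subset subsetI)

lemma bd_subset:
  assumes "c \<subseteq> K" "\<And>s. s \<in> K \<Longrightarrow> faces s \<subseteq> K"
  shows "bd c \<subseteq> K"
  using lin_subset[of faces c] assms by blast

text \<open>The boundary lowers the number of vertices by one, so from any filling of a cycle in
  degree \<open>n\<close> the simplices with \<open>Suc n\<close> vertices can be kept and the
  others dropped.\<close>

lemma acyclic_complex_imp_acyclic_in:
  assumes "fin_complex K" "acyclic_complex K"
  shows "acyclic_in n K"
  unfolding acyclic_in_def
proof (intro allI impI, elim conjE)
  fix z assume z: "z \<subseteq> K" "\<forall>s\<in>z. card s = n" "bd z = {}"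
  then obtain y where y: "y \<subseteq> K" "bd y = z" using assms unfolding acyclic_complex_def by blast
  let ?y = "{s \<in> y. card s = Suc n}"
  have fin: "finite s" if "s \<in> y" for s using that y fin_complexD(3)[OF assms(1)] by auto
  have "bd ?y = z"
  proof (rule set_eqI)
    fix r
    show "r \<in> bd ?y \<longleftrightarrow> r \<in> z"
    proof (cases "card r = n")
      case True
      then have "{x \<in> ?y. r \<in> faces x} = {x \<in> y. r \<in> faces x}"
        using mem_faces_card[of r] fin by auto
      then have "r \<in> bd ?y \<longleftrightarrow> r \<in> bd y" by (simp add: lin_def)
      then show ?thesis using y by simp
    next
      case False
      have empty: "{x \<in> ?y. r \<in> faces x} = {}"
        using False mem_faces_card[of r] fin by auto
      have "r \<notin> bd ?y" unfolding lin_def mem_Collect_eq[of r] empty by simp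
      then show ?thesis using False z by auto
    qed
  qed
  then show "\<exists>y\<subseteq>K. (\<forall>s\<in>y. card s = Suc n) \<and> bd y = z"
    using y by (intro exI[of _ ?y]) auto
qed

lemma acyclic_cone:
  assumes "fin_complex K" "\<And>s. s \<in> K \<Longrightarrow> insert v s \<in> K"
  shows "acyclic_complex K"
  unfolding acyclic_complex_def
proof (intro allI impI, elim conjE)
  fix z assume z: "z \<subseteq> K" "bd z = {}"
  have "finite z" "\<And>s. s \<in> z \<Longrightarrow> finite s"
    using z fin_complexD[OF assms(1)] by (auto intro: finite_subset)
  then have "bd (lin (cone_over v) z) = z" using z by (intro bd_cone)
  moreover have "lin (cone_over v) z \<subseteq> K"
    using lin_subset[of "cone_over v" z] z assms(2) by (fastforce simp: cone_over_def split: if_splits)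
  ultimately show "\<exists>y\<subseteq>K. bd y = z" by blast
qed

lemma fin_complex_Pow: "finite s \<Longrightarrow> fin_complex (Pow s)"
  by (auto simp: fin_complex_def intro: finite_subset)

section \<open>Elementary collapses and acyclicity\<close>

lemma elementary_collapseE:
  assumes "elementary_collapse K L"
  obtains s t where "s \<in> K" "t \<in> K" "s \<noteq> {}" "s \<subset> t" "\<forall>r\<in>K. s \<subset> r \<longrightarrow> r = t" "L = K - {s, t}"
  using assms unfolding elementary_collapse_def by (elim bexE conjE) (rule that)

lemma elementary_collapse_fin_complex:
  assumes "fin_complex K" "elementary_collapse K L"
  shows "fin_complex L"
proof -
  obtain s t where st: "s \<in> K" "t \<in> K" "s \<noteq> {}" "s \<subset> t" "\<forall>r\<in>K. s \<subset> r \<longrightarrow> r = t" "L = K - {s, t}"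
    using assms(2) by (rule elementary_collapseE)
  show ?thesis
    unfolding fin_complex_def
  proof (intro conjI ballI allI impI)
    show "finite L" using st(6) fin_complexD(1)[OF assms(1)] by simp
    show "{} \<in> L" using st(3,4,6) fin_complexD(2)[OF assms(1)] by auto
  next
    fix x assume "x \<in> L" then show "finite x" using st(6) fin_complexD(3)[OF assms(1)] by simp
  next
    fix x r assume x: "x \<in> L" "r \<subseteq> x"
    then have "x \<in> K" "r \<in> K" using st(6) fin_complexD(4)[OF assms(1), of x r] by auto
    moreover have "r \<noteq> s" "r \<noteq> t" using x st(4,5,6) \<open>x \<in> K\<close> by blast+
    ultimately show "r \<in> L" using st(6) by simp
  qed
qed

text \<open>The free face \<open>s\<close> has \<open>t\<close> as its only proper coface, so a
  chain containing \<open>t\<close> has \<open>s\<close> in its boundary and is no cycle. If a cycle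
  contains \<open>s\<close>, adding the boundary of \<open>t\<close> exchanges \<open>s\<close> for
  other faces of \<open>t\<close> and moves the cycle into \<open>L\<close>.\<close>

lemma acyclic_elementary_collapse:
  assumes K: "fin_complex K" and coll: "elementary_collapse K L" and L: "acyclic_complex L"
  shows "acyclic_complex K"
  unfolding acyclic_complex_def
proof (intro allI impI, elim conjE)
  fix z assume z: "z \<subseteq> K" "bd z = {}"
  obtain s t where st: "s \<in> K" "t \<in> K" "s \<noteq> {}" "s \<subset> t" "\<forall>r\<in>K. s \<subset> r \<longrightarrow> r = t" "L = K - {s, t}"
    using coll by (rule elementary_collapseE)
  obtain v where v: "v \<in> t" "v \<notin> s" using st(4) by blast
  have "insert v s \<in> K" using fin_complexD(4)[OF K st(2)] v st(4) by auto
  then have t: "t = insert v s" using st(5) v by blast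
  then have s: "s \<in> faces t" using v by (auto simp: mem_faces_iff)
  have fin: "finite z" "finite t" using finite_subset[OF z(1)] st(2) fin_complexD[OF K] by auto
  have "t \<notin> z"
  proof
    assume "t \<in> z"
    have "x = t" if "x \<in> z" "s \<in> faces x" for x
      using that st(5) z(1) mem_faces_iff[of s x] by blast
    then have "{x \<in> z. s \<in> faces x} = {t}" using \<open>t \<in> z\<close> s by blast
    then have "s \<in> bd z" by (simp add: lin_def)
    then show False using z by simp
  qed
  define z' where "z' = (if s \<in> z then sym_diff z (faces t) else z)"
  have "t \<notin> faces t" by (auto simp: faces_def)
  then have "z' \<subseteq> L"
    using z(1) st(6) s \<open>t \<notin> z\<close> fin_complex_faces[OF K st(2)] by (auto simp: z'_def)
  moreover have "bd z' = {}"
    using z fin by (simp add: z'_def lin_sym_diff bd_faces)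
  ultimately obtain y where y: "y \<subseteq> L" "bd y = z'" using L unfolding acyclic_complex_def by blast
  have "finite y" using finite_subset[OF y(1)] st(6) fin_complexD(1)[OF K] by simp
  then have "bd (insert t y) = sym_diff (faces t) z'" using y st(6) by (subst lin_insert) auto
  then have "bd (if s \<in> z then insert t y else y) = z" using y by (auto simp: z'_def)
  moreover have "(if s \<in> z then insert t y else y) \<subseteq> K" using y(1) st(2,6) by auto
  ultimately show "\<exists>y\<subseteq>K. bd y = z" by blast
qed

lemma acyclic_collapses:
  assumes "elementary_collapse\<^sup>*\<^sup>* K L" "fin_complex K" "acyclic_complex L"
  shows "acyclic_complex K"
  using assms
  by (induction rule: converse_rtranclp_induct)
     (auto intro: acyclic_elementary_collapse elementary_collapse_fin_complex)

section \<open>Homology of a union of few simplices\<close>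

text \<open>Degree 0 is left out because the complex of the empty simplex fails there, and
  intersections arising in the induction below can be empty.\<close>

lemma acyclic_in_Pow:
  assumes "finite s"
  shows "acyclic_in (Suc n) (Pow s)"
proof (cases "s = {}")
  case True
  show ?thesis unfolding acyclic_in_def
  proof (intro allI impI, elim conjE)
    fix z assume "z \<subseteq> Pow s" "\<forall>s\<in>z. card s = Suc n"
    then have "z = {}" using True by force
    then show "\<exists>y\<subseteq>Pow s. (\<forall>s\<in>y. card s = Suc (Suc n)) \<and> bd y = z" by (intro exI[of _ "{}"]) simp
  qed
next
  case False
  then obtain v where "v \<in> s" by blast
  then have "acyclic_complex (Pow s)" using assms by (intro acyclic_cone[of _ v] fin_complex_Pow) auto
  then show ?thesis using assms by (intro acyclic_complex_imp_acyclic_in fin_complex_Pow)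
qed

text \<open>One step of the Mayer-Vietoris sequence. A cycle is cut into a part in \<open>K\<close>
  and a rest in \<open>Pow t\<close>; their common boundary is filled inside the intersection, and
  this filling closes both parts to cycles that bound separately. \<open>K\<close> is only required
  to be closed under faces because the induction starts from the void family.\<close>

lemma acyclic_in_Un_Pow:
  assumes "finite K" "\<And>s. s \<in> K \<Longrightarrow> finite s" "\<And>s. s \<in> K \<Longrightarrow> faces s \<subseteq> K" "finite t"
    and K: "acyclic_in (Suc n) K" and Kt: "acyclic_in n (K \<inter> Pow t)"
  shows "acyclic_in (Suc n) (K \<union> Pow t)"
  unfolding acyclic_in_def
proof (intro allI impI, elim conjE)
  fix z assume z: "z \<subseteq> K \<union> Pow t" "\<forall>s\<in>z. card s = Suc n" "bd z = {}"
  have finz: "finite z" using finite_subset[OF z(1)] assms(1,4) by simp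
  have fins: "finite s" if "s \<in> z" for s using that z(1) assms(2,4) finite_subset[of s t] by auto
  define z1 z2 where "z1 = z \<inter> K" and "z2 = z - K"
  have fin12: "finite z1" "finite z2" using finz by (auto simp: z1_def z2_def)
  have "z = sym_diff z1 z2" by (auto simp: z1_def z2_def)
  then have "sym_diff (bd z1) (bd z2) = {}" using lin_sym_diff[OF fin12] z by metis
  then have eq: "bd z1 = bd z2" by blast
  have "bd z1 \<subseteq> K" using assms(3) by (intro bd_subset) (auto simp: z1_def)
  moreover have "bd z2 \<subseteq> Pow t"
    using z by (intro bd_subset) (auto simp: z2_def faces_def)
  ultimately have sub: "bd z1 \<subseteq> K \<inter> Pow t" using eq by blast
  have bdbd: "bd (bd z1) = {}" using fin12 fins by (intro bd_bd) (auto simp: z1_def)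
  have cards: "\<forall>s\<in>bd z1. card s = n"
  proof
    fix s assume "s \<in> bd z1"
    then obtain x where "x \<in> z1" "s \<in> faces x" using lin_subset[of faces z1] by blast
    then show "card s = n" using mem_faces_card[of s x] z fins by (auto simp: z1_def)
  qed
  obtain c where c: "c \<subseteq> K \<inter> Pow t" "\<forall>s\<in>c. card s = Suc n" "bd c = bd z1"
    using Kt sub cards bdbd by (rule acyclic_inE)
  have finc: "finite c" using finite_subset[OF c(1)] assms(1) by simp
  have "sym_diff z1 c \<subseteq> K" "\<forall>s\<in>sym_diff z1 c. card s = Suc n" "bd (sym_diff z1 c) = {}"
    using c z lin_sym_diff[OF fin12(1) finc, of faces] by (auto simp: z1_def)
  with K obtain y1 where y1: "y1 \<subseteq> K" "\<forall>s\<in>y1. card s = Suc (Suc n)" "bd y1 = sym_diff z1 c"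
    by (rule acyclic_inE)
  have "sym_diff z2 c \<subseteq> Pow t" "\<forall>s\<in>sym_diff z2 c. card s = Suc n" "bd (sym_diff z2 c) = {}"
    using c z eq lin_sym_diff[OF fin12(2) finc, of faces] by (auto simp: z2_def)
  with acyclic_in_Pow[OF assms(4)]
  obtain y2 where y2: "y2 \<subseteq> Pow t" "\<forall>s\<in>y2. card s = Suc (Suc n)" "bd y2 = sym_diff z2 c"
    by (rule acyclic_inE)
  have "finite y1" "finite y2" using finite_subset[OF y1(1)] finite_subset[OF y2(1)] assms(1,4) by auto
  then have "bd (sym_diff y1 y2) = sym_diff (sym_diff z1 c) (sym_diff z2 c)"
    using lin_sym_diff[of y1 y2 faces] y1 y2 by simp
  also have "\<dots> = z" by (auto simp: z1_def z2_def)
  finally show "\<exists>y\<subseteq>K \<union> Pow t. (\<forall>s\<in>y. card s = Suc (Suc n)) \<and> bd y = z"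
    using y1 y2 by (intro exI[of _ "sym_diff y1 y2"]) auto
qed

text \<open>An indexed family, since intersecting with a fixed simplex can make members equal or
  nested while the induction counts indices.\<close>

definition generated_by :: "'i set \<Rightarrow> ('i \<Rightarrow> 'a set) \<Rightarrow> 'a set set" where
  "generated_by I F = (\<Union>i\<in>I. Pow (F i))"

lemma acyclic_in_remove:
  assumes "finite I" "\<And>i. i \<in> I \<Longrightarrow> finite (F i)" "i \<in> I"
    and "acyclic_in (Suc n) (generated_by (I - {i}) F)"
    and "acyclic_in n (generated_by (I - {i}) (\<lambda>j. F j \<inter> F i))"
  shows "acyclic_in (Suc n) (generated_by I F)"
proof -
  have 1: "generated_by I F = generated_by (I - {i}) F \<union> Pow (F i)"
    using assms(3) by (auto simp: generated_by_def)
  have 2: "generated_by (I - {i}) (\<lambda>j. F j \<inter> F i) = generated_by (I - {i}) F \<inter> Pow (F i)"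
    by (auto simp: generated_by_def)
  show ?thesis
    unfolding 1
  proof (rule acyclic_in_Un_Pow)
    show "finite (generated_by (I - {i}) F)" using assms by (auto simp: generated_by_def)
    show "finite s" if "s \<in> generated_by (I - {i}) F" for s
      using that assms by (auto simp: generated_by_def intro: finite_subset)
    show "faces s \<subseteq> generated_by (I - {i}) F" if "s \<in> generated_by (I - {i}) F" for s
      using that by (auto simp: generated_by_def faces_def)
  qed (use assms 2 in auto)
qed

text \<open>In terms of the nerve: on \<open>m\<close> vertices there is no reduced homology in
  dimension \<open>m - 1\<close> or above. Splitting off one simplex leaves two families with one
  member less, the rest and its trace on that simplex.\<close>

lemma acyclic_in_few_simplices:
  assumes "finite I" "\<And>i. i \<in> I \<Longrightarrow> finite (F i)" "card I \<le> n"
  shows "acyclic_in n (generated_by I F)"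
  using assms
proof (induction "card I" arbitrary: I F n)
  case 0
  then have "generated_by I F = {}" by (simp add: generated_by_def)
  then show ?case by (auto simp: acyclic_in_def)
next
  case (Suc m)
  then obtain i where i: "i \<in> I" by fastforce
  obtain n' where n': "n = Suc n'" using Suc by (cases n) auto
  have c: "card (I - {i}) = m" using Suc i by simp
  have "acyclic_in (Suc n') (generated_by (I - {i}) F)"
    using Suc c n' by (intro Suc.hyps(1)) auto
  moreover have "acyclic_in n' (generated_by (I - {i}) (\<lambda>j. F j \<inter> F i))"
    using Suc c n' by (intro Suc.hyps(1)) auto
  ultimately show ?case using acyclic_in_remove[of I F i n'] Suc.prems i n' by simp
qed

text \<open>With \<open>Suc n\<close> simplices and homology in dimension \<open>n - 1\<close>, the
  nerve has to be the boundary of an \<open>n\<close>-simplex, so omitting any one member leaves a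
  common point. Splitting off \<open>F i\<close> transfers the nonvanishing class to the traces on
  \<open>F i\<close>, one degree lower.\<close>

lemma not_acyclic_in_imp_Int_nonempty:
  assumes "finite I" "\<And>i. i \<in> I \<Longrightarrow> finite (F i)" "card I = Suc n" "1 \<le> n"
    and "\<not> acyclic_in n (generated_by I F)" "j \<in> I"
  shows "\<exists>w. \<forall>i\<in>I - {j}. w \<in> F i"
  using assms
proof (induction n arbitrary: I F j)
  case (Suc m)
  have "card (I - {j}) = Suc m" using Suc by simp
  then have "I - {j} \<noteq> {}" by force
  \<comment> \<open>The index split off differs from the omitted \<open>j\<close>, so that a common
    point of the traces lies in \<open>F i\<close> automatically and the induction goes on omitting
    \<open>j\<close>.\<close>
  then obtain i where i: "i \<in> I" "i \<noteq> j" by blast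
  have ci: "card (I - {i}) = Suc m" using Suc i by simp
  have cij: "card (I - {i} - {j}) = m" using Suc i ci by simp
  have fin: "finite (I - {i})" "\<And>l. l \<in> I - {i} \<Longrightarrow> finite (F l)" using Suc by auto
  have ac: "acyclic_in (Suc m) (generated_by (I - {i}) F)"
    using Suc ci by (intro acyclic_in_few_simplices) auto
  show ?case
  \<comment> \<open>Two simplices are settled by hand, since the induction hypothesis says nothing
    in degree 0.\<close>
  proof (cases "m = 0")
    case True
    then have "I - {i} - {j} = {}" using cij Suc by simp
    then have I: "I = {i, j}" using i Suc by auto
    have "F i \<noteq> {}"
    proof
      assume "F i = {}"
      then have "generated_by I F = generated_by (I - {i}) F" using I i by (auto simp: generated_by_def)
      then show False using ac Suc by simp
    qed
    then show ?thesis using I i by auto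
  next
    case False
    have "\<not> acyclic_in m (generated_by (I - {i}) (\<lambda>l. F l \<inter> F i))"
      using acyclic_in_remove[of I F i m] ac Suc.prems i by blast
    then have "\<exists>w. \<forall>l\<in>I - {i} - {j}. w \<in> F l \<inter> F i"
      using Suc.prems i False ci by (intro Suc.IH) auto
    moreover have "I - {i} - {j} \<noteq> {}" using cij False by force
    ultimately show ?thesis by blast
  qed
qed simp

text \<open>A common vertex turns the union into a cone, which is acyclic.\<close>

lemma not_acyclic_in_imp_Int_empty:
  assumes "finite I" "\<And>i. i \<in> I \<Longrightarrow> finite (F i)" "I \<noteq> {}"
    and "\<not> acyclic_in n (generated_by I F)"
  shows "\<exists>i\<in>I. w \<notin> F i"
proof (rule ccontr)
  assume "\<not> (\<exists>i\<in>I. w \<notin> F i)"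
  then have w: "\<And>i. i \<in> I \<Longrightarrow> w \<in> F i" by blast
  have "fin_complex (generated_by I F)"
    using assms by (auto simp: fin_complex_def generated_by_def intro: finite_subset)
  moreover from this have "acyclic_complex (generated_by I F)"
    by (rule acyclic_cone[of _ w]) (use w in \<open>auto simp: generated_by_def\<close>)
  ultimately show False using acyclic_complex_imp_acyclic_in assms by blast
qed

section \<open>Geometric simplices\<close>

lemma lookup_scaleR [simp]:
  "Poly_Mapping.lookup (r *\<^sub>R x) v = r * (Poly_Mapping.lookup x v :: real)"
proof -
  have "{i. r * Poly_Mapping.lookup x i \<noteq> 0} \<subseteq> {i. Poly_Mapping.lookup x i \<noteq> 0}" by auto
  then have "finite {i. r * Poly_Mapping.lookup x i \<noteq> 0}"
    using finite_lookup finite_subset by blast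
  then show ?thesis by (simp add: scaleR_poly_mapping_def)
qed

abbreviation unit_vec :: "'a \<Rightarrow> ('a \<Rightarrow>\<^sub>0 real)" where
  "unit_vec v \<equiv> Poly_Mapping.single v 1"

abbreviation coord :: "'a \<Rightarrow> ('a \<Rightarrow>\<^sub>0 real) \<Rightarrow> real" where
  "coord v x \<equiv> Poly_Mapping.lookup x v"

lemma linear_coord: "linear (coord v)"
  by (rule linearI) (simp_all add: lookup_add)

lemma linear_coord_sum: "linear (\<lambda>x. \<Sum>v\<in>s. coord v x)"
  by (rule linearI) (simp_all add: lookup_add sum.distrib sum_distrib_left)

lemma coord_sum: "coord v (sum f A) = (\<Sum>i\<in>A. coord v (f i))"
  by (rule linear_sum[OF linear_coord])

lemma inj_unit_vec: "inj unit_vec"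
proof (rule injI)
  fix u v :: 'a assume "unit_vec u = (unit_vec v :: 'a \<Rightarrow>\<^sub>0 real)"
  then have "coord u (unit_vec u) = coord u (unit_vec v)" by simp
  then show "u = v" by (simp add: lookup_single when_def split: if_splits)
qed

lemma unit_vec_expansion:
  assumes "finite s" "\<And>v. v \<notin> s \<Longrightarrow> coord v x = 0"
  shows "x = (\<Sum>v\<in>s. coord v x *\<^sub>R unit_vec v)"
proof (rule poly_mapping_eqI)
  fix w
  have "coord w (\<Sum>v\<in>s. coord v x *\<^sub>R unit_vec v) = (\<Sum>v\<in>s. if v = w then coord v x else 0)"
    unfolding coord_sum by (intro sum.cong) (auto simp: lookup_single when_def)
  then show "coord w x = coord w (\<Sum>v\<in>s. coord v x *\<^sub>R unit_vec v)"
    using assms by (auto simp: sum.delta)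
qed

lemma mem_realize_iff:
  assumes "finite s"
  shows "x \<in> realize s \<longleftrightarrow>
    (\<forall>v. 0 \<le> coord v x) \<and> (\<forall>v. v \<notin> s \<longrightarrow> coord v x = 0) \<and> (\<Sum>v\<in>s. coord v x) = 1"
proof
  let ?P = "{x. (\<forall>v. 0 \<le> coord v x) \<and> (\<forall>v. v \<notin> s \<longrightarrow> coord v x = 0) \<and> (\<Sum>v\<in>s. coord v x) = 1}"
  have "convex ?P"
  proof (rule convexI)
    fix x y and u v :: real assume "x \<in> ?P" "y \<in> ?P" "0 \<le> u" "0 \<le> v" "u + v = 1"
    then show "u *\<^sub>R x + v *\<^sub>R y \<in> ?P"
      by (simp add: lookup_add sum.distrib sum_distrib_left[symmetric])
  qed
  moreover have "unit_vec ` s \<subseteq> ?P"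
  proof clarify
    fix v assume "v \<in> s"
    moreover have "(\<Sum>w\<in>s. coord w (unit_vec v)) = (\<Sum>w\<in>s. if w = v then 1 else 0)"
      by (intro sum.cong) (auto simp: lookup_single when_def)
    ultimately show "(\<forall>w. 0 \<le> coord w (unit_vec v)) \<and> (\<forall>w. w \<notin> s \<longrightarrow> coord w (unit_vec v) = 0) \<and>
        (\<Sum>w\<in>s. coord w (unit_vec v)) = 1"
      using assms by (auto simp: lookup_single when_def)
  qed
  ultimately have "realize s \<subseteq> ?P" unfolding realize_def by (rule hull_minimal[rotated])
  then show "x \<in> realize s \<Longrightarrow>
    (\<forall>v. 0 \<le> coord v x) \<and> (\<forall>v. v \<notin> s \<longrightarrow> coord v x = 0) \<and> (\<Sum>v\<in>s. coord v x) = 1" by blast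
next
  assume x: "(\<forall>v. 0 \<le> coord v x) \<and> (\<forall>v. v \<notin> s \<longrightarrow> coord v x = 0) \<and> (\<Sum>v\<in>s. coord v x) = 1"
  have "(\<Sum>v\<in>s. coord v x *\<^sub>R unit_vec v) \<in> convex hull (unit_vec ` s)"
    using assms x by (intro convex_sum) (auto intro: hull_inc)
  then show "x \<in> realize s"
    using unit_vec_expansion[of s x] assms x by (simp add: realize_def)
qed

lemma convex_realize: "convex (realize s)"
  by (simp add: realize_def)

lemma realize_mono: "s \<subseteq> t \<Longrightarrow> realize s \<subseteq> realize t"
  unfolding realize_def by (intro hull_mono image_mono)

lemma realize_Int:
  assumes "finite s" "finite t"
  shows "realize s \<inter> realize t = realize (s \<inter> t)"
proof
  show "realize s \<inter> realize t \<subseteq> realize (s \<inter> t)"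
  proof
    fix x assume x: "x \<in> realize s \<inter> realize t"
    then have "(\<Sum>v\<in>s. coord v x) = (\<Sum>v\<in>s \<inter> t. coord v x)"
      using assms by (intro sum.mono_neutral_right) (auto simp: mem_realize_iff)
    then show "x \<in> realize (s \<inter> t)" using x assms by (auto simp: mem_realize_iff)
  qed
qed (auto intro: realize_mono[THEN subsetD])

lemma unit_vec_in_realize: "v \<in> s \<Longrightarrow> unit_vec v \<in> realize s"
  unfolding realize_def by (auto intro: hull_inc)

lemma mem_span_unit_vecs_iff:
  assumes "finite s"
  shows "x \<in> span (unit_vec ` s) \<longleftrightarrow> (\<forall>v. v \<notin> s \<longrightarrow> coord v x = 0)"
proof
  assume "x \<in> span (unit_vec ` s)"
  then show "\<forall>v. v \<notin> s \<longrightarrow> coord v x = 0"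
  proof (induction rule: span_induct)
    case base
    show ?case by (auto simp: subspace_def lookup_add)
  qed (auto simp: lookup_single when_def)
next
  assume "\<forall>v. v \<notin> s \<longrightarrow> coord v x = 0"
  then have "x = (\<Sum>v\<in>s. coord v x *\<^sub>R unit_vec v)" using assms by (intro unit_vec_expansion) auto
  also have "\<dots> \<in> span (unit_vec ` s)" by (intro span_sum span_scale span_base) auto
  finally show "x \<in> span (unit_vec ` s)" .
qed

lemma realize_subset_span: "realize s \<subseteq> span (unit_vec ` s)"
  unfolding realize_def by (rule convex_hull_subset_span)

lemma card_unit_vecs: "card (unit_vec ` s) = card s"
  by (intro card_image inj_on_subset[OF inj_unit_vec]) auto

text \<open>On the hyperplane \<open>T = 1\<close> the coefficients of a linear relation sum to
  zero, so it is an affine relation. Realized simplices lie on such a hyperplane, their coordinates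
  having sum 1; this lets spans and dual bases replace affine geometry.\<close>

lemma independent_if_affine_independent:
  fixes T :: "'v::real_vector \<Rightarrow> real"
  assumes "linear T" "finite g" "\<And>x. x \<in> g \<Longrightarrow> T x = 1" "\<not> affine_dependent g"
  shows "independent g"
proof
  assume "dependent g"
  then obtain u where u: "\<exists>v\<in>g. u v \<noteq> 0" "(\<Sum>v\<in>g. u v *\<^sub>R v) = 0"
    using assms by (auto simp: dependent_finite)
  have "T (\<Sum>v\<in>g. u v *\<^sub>R v) = (\<Sum>v\<in>g. u v)"
    using assms by (simp add: linear_sum linear_scale)
  then have "sum u g = 0" using u linear_0[OF assms(1)] by simp
  then show False using assms(2,4) u by (auto simp: affine_dependent_explicit_finite)
qed

lemma independent_affine_independent_realize:
  assumes "finite s" "g \<subseteq> realize s" "finite g" "\<not> affine_dependent g"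
  shows "independent g"
  by (rule independent_if_affine_independent[OF linear_coord_sum[of s]])
     (use assms in \<open>auto simp: mem_realize_iff\<close>)

lemma independent_unit_vecs:
  assumes "finite s"
  shows "independent (unit_vec ` s)"
proof
  assume "dependent (unit_vec ` s)"
  then obtain v where v: "v \<in> s" "unit_vec v \<in> span (unit_vec ` s - {unit_vec v})"
    by (auto simp: dependent_def)
  have "unit_vec ` s - {unit_vec v} \<subseteq> unit_vec ` (s - {v})" by auto
  then have "unit_vec v \<in> span (unit_vec ` (s - {v}))" using v span_mono by blast
  then have "coord v (unit_vec v) = 0"
    using assms mem_span_unit_vecs_iff[of "s - {v}" "unit_vec v"] by blast
  then show False by simp
qed


section \<open>Barycentric coordinates and the simplices around a common face\<close>

lemma dual_functionals:
  fixes g :: "'v::real_vector set"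
  assumes "independent g"
  shows "\<exists>f :: 'v \<Rightarrow> 'v \<Rightarrow> real. \<forall>s. linear (f s) \<and> (\<forall>t\<in>g. f s t = (if t = s then 1 else 0))"
  by (rule choice) (intro allI linear_independent_extend[OF assms])

lemma dual_functionals_expansion:
  fixes g :: "'v::real_vector set"
  assumes "finite g" "\<And>s. linear (f s)" "\<And>s t. t \<in> g \<Longrightarrow> f s t = (if t = s then 1 else 0)"
    and "x \<in> span g"
  shows "x = (\<Sum>s\<in>g. f s x *\<^sub>R s)"
proof -
  obtain u where x: "x = (\<Sum>s\<in>g. u s *\<^sub>R s)" using assms(1,4) by (auto simp: span_finite)
  have "f t x = u t" if "t \<in> g" for t
  proof -
    have "f t x = (\<Sum>s\<in>g. u s * f t s)"
      unfolding x using assms(2) by (simp add: linear_sum linear_scale)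
    also have "\<dots> = (\<Sum>s\<in>g. if s = t then u s else 0)" using assms(3) by (intro sum.cong) auto
    finally show ?thesis using that assms(1) by simp
  qed
  then show ?thesis using x by (simp cong: sum.cong)
qed

lemma convex_hull_nonneg:
  fixes f :: "'v::real_vector \<Rightarrow> real"
  assumes "linear f" "\<And>s. s \<in> g \<Longrightarrow> 0 \<le> f s" "x \<in> convex hull g"
  shows "0 \<le> f x"
proof -
  have "convex {x. 0 \<le> f x}"
    using assms(1) by (auto simp: convex_def linear_add linear_scale)
  then have "convex hull g \<subseteq> {x. 0 \<le> f x}" using assms(2) by (intro hull_minimal) auto
  then show ?thesis using assms(3) by blast
qed

lemma convex_hull_const:
  fixes f :: "'v::real_vector \<Rightarrow> real"
  assumes "linear f" "\<And>s. s \<in> g \<Longrightarrow> f s = c" "x \<in> convex hull g"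
  shows "f x = c"
proof -
  have "convex {x. f x = c}"
    using assms(1) by (auto simp: convex_def linear_add linear_scale distrib_right[symmetric])
  then have "convex hull g \<subseteq> {x. f x = c}" using assms(2) by (intro hull_minimal) auto
  then show ?thesis using assms(3) by blast
qed

definition barycenter :: "'v::real_vector set \<Rightarrow> 'v" where
  "barycenter g = (\<Sum>s\<in>g. (1 / real (card g)) *\<^sub>R s)"

lemma barycenter_in_hull:
  assumes "finite g" "g \<noteq> {}"
  shows "barycenter g \<in> convex hull g"
  unfolding barycenter_def using assms by (intro convex_sum) (auto intro: hull_inc)

text \<open>Modulo the span of \<open>g\<close>, the points \<open>a\<close> and \<open>b\<close>
  are positive multiples of each other. If they differed, a point of the simplex
  \<open>insert b g\<close> close to the barycenter of \<open>g\<close> would therefore also lie in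
  \<open>insert a g\<close>; the intersection condition would put it into the hull of
  \<open>g\<close>, where \<open>f\<close> vanishes.\<close>

lemma same_side_unique:
  fixes f T :: "'v::real_vector \<Rightarrow> real"
  assumes f: "linear f" "\<And>s. s \<in> g \<Longrightarrow> f s = 0"
    and T: "linear T" "\<And>s. s \<in> insert a (insert b g) \<Longrightarrow> T s = 1"
    and g: "finite g" "g \<noteq> {}" "a \<notin> g" "b \<notin> g"
    and Int: "convex hull (insert a g) \<inter> convex hull (insert b g)
               = convex hull (insert a g \<inter> insert b g)"
    and pos: "0 < f a" "0 < f b"
    and span: "b - (f b / f a) *\<^sub>R a \<in> span g"
  shows "a = b"
proof (rule ccontr)
  assume "a \<noteq> b"
  define \<alpha> where "\<alpha> = f b / f a"
  have \<alpha>: "0 < \<alpha>" using pos by (simp add: \<alpha>_def)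
  obtain \<beta> where \<beta>: "b - \<alpha> *\<^sub>R a = (\<Sum>s\<in>g. \<beta> s *\<^sub>R s)"
    using span g by (auto simp: span_finite \<alpha>_def)
  have "T (b - \<alpha> *\<^sub>R a) = 1 - \<alpha>" using T by (simp add: linear_diff linear_scale)
  moreover have "T (\<Sum>s\<in>g. \<beta> s *\<^sub>R s) = sum \<beta> g" using T by (simp add: linear_sum linear_scale)
  ultimately have sum\<beta>: "sum \<beta> g = 1 - \<alpha>" using \<beta> by simp
  define n where "n = real (card g)"
  have n: "0 < n" using g by (simp add: n_def card_gt_0_iff)
  define M where "M = (\<Sum>s\<in>g. \<bar>\<beta> s\<bar>)"
  have M: "0 \<le> M" "\<And>s. s \<in> g \<Longrightarrow> \<bar>\<beta> s\<bar> \<le> M"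
    using g by (auto simp: M_def intro: sum_nonneg member_le_sum)
  \<comment> \<open>\<open>t\<close> solves \<open>(1 - t) / n = t * M\<close>: moving from the
    barycenter by \<open>t\<close> towards \<open>b\<close> keeps all coefficients at points of
    \<open>g\<close> nonnegative, as \<open>M\<close> bounds every
    \<open>\<bar>\<beta> s\<bar>\<close>.\<close>
  define t where "t = 1 / (1 + n * M)"
  have nM: "0 \<le> n * M" using n M by simp
  have t: "0 < t" "t \<le> 1" "t * (1 + n * M) = 1" using nM by (auto simp: t_def)
  define q where "q = (1 - t) *\<^sub>R barycenter g + t *\<^sub>R b"
  have bary: "barycenter g \<in> convex hull g" using g by (intro barycenter_in_hull)
  have "q \<in> convex hull (insert b g)"
    unfolding q_def
  proof (rule convexD)
    show "barycenter g \<in> convex hull (insert b g)" using bary hull_mono[of g "insert b g" convex] by blast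
  qed (use t in \<open>auto intro: hull_inc\<close>)
  moreover have "q \<in> convex hull (insert a g)"
  proof -
    let ?c = "\<lambda>s. if s = a then t * \<alpha> else (1 - t) / n + t * \<beta> s"
    have ne: "s \<noteq> a" if "s \<in> g" for s using that g by auto
    have b: "b = \<alpha> *\<^sub>R a + (\<Sum>s\<in>g. \<beta> s *\<^sub>R s)" using \<beta> by (simp add: algebra_simps)
    have "(\<Sum>s\<in>insert a g. ?c s *\<^sub>R s) = (t * \<alpha>) *\<^sub>R a + (\<Sum>s\<in>g. ?c s *\<^sub>R s)"
      using g by simp
    also have "(\<Sum>s\<in>g. ?c s *\<^sub>R s) = (\<Sum>s\<in>g. ((1 - t) / n) *\<^sub>R s + (t * \<beta> s) *\<^sub>R s)"
      using ne by (intro sum.cong) (auto simp: scaleR_add_left)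
    also have "\<dots> = (1 - t) *\<^sub>R barycenter g + t *\<^sub>R (\<Sum>s\<in>g. \<beta> s *\<^sub>R s)"
      by (simp add: sum.distrib barycenter_def scaleR_sum_right n_def)
    finally have q: "q = (\<Sum>s\<in>insert a g. ?c s *\<^sub>R s)"
      unfolding q_def by (subst b) (simp add: scaleR_add_right)
    have "(\<Sum>s\<in>insert a g. ?c s) = t * \<alpha> + (\<Sum>s\<in>g. ?c s)" using g by simp
    also have "(\<Sum>s\<in>g. ?c s) = (\<Sum>s\<in>g. (1 - t) / n + t * \<beta> s)"
      using ne by (intro sum.cong) auto
    also have "\<dots> = (1 - t) + t * (1 - \<alpha>)"
      using n sum\<beta> by (simp add: sum.distrib sum_distrib_left[symmetric] n_def)
    finally have sum1: "(\<Sum>s\<in>insert a g. ?c s) = 1" by (simp add: algebra_simps)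
    have "0 \<le> ?c s" if "s \<in> insert a g" for s
    proof (cases "s = a")
      case False
      then have "s \<in> g" using that by simp
      have "1 - t = t * (n * M)" using t(3) by (simp add: algebra_simps)
      then have "(1 - t) / n = t * M" using n by simp
      moreover have "t * (- \<beta> s) \<le> t * M"
        using M(2)[OF \<open>s \<in> g\<close>] t(1) by (intro mult_left_mono) auto
      ultimately show ?thesis using False by simp
    qed (use t \<alpha> in simp)
    then show ?thesis unfolding q using g sum1 by (intro convex_sum) (auto intro: hull_inc)
  qed
  moreover have "insert a g \<inter> insert b g = g" using \<open>a \<noteq> b\<close> g by auto
  ultimately have "q \<in> convex hull g" using Int by auto
  then have "f q = 0" using convex_hull_const[of f g 0] f by blast
  moreover have "f (barycenter g) = 0" using convex_hull_const[of f g 0] f bary by blast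
  ultimately have "t * f b = 0" using f(1) by (simp add: q_def linear_add linear_scale)
  then show False using t pos by simp
qed

text \<open>Walk from the barycenter \<open>p\<close> of \<open>g\<close> towards \<open>y\<close>.
  Finitely many simplices cover the points \<open>q m\<close>, which converge to \<open>p\<close>,
  so one simplex \<open>h\<close> contains infinitely many of them. It contains the limit
  \<open>p\<close>, hence all of \<open>g\<close>, and since \<open>f\<close> is positive on the
  \<open>q m\<close> it has a vertex with positive \<open>f\<close>.\<close>

lemma side_exists:
  fixes f T :: "'v::real_vector \<Rightarrow> real"
  assumes f: "linear f" "\<And>s. s \<in> g \<Longrightarrow> f s = 0" and T: "linear T"
    and G: "finite G" "\<And>h. h \<in> G \<Longrightarrow> finite h \<and> independent h \<and> (\<forall>x\<in>h. T x = 1)"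
    and g: "g \<in> G" "g \<noteq> {}"
    and Int: "\<And>h. h \<in> G \<Longrightarrow> convex hull h \<inter> convex hull g = convex hull (h \<inter> g)"
    and P: "convex P" "g \<subseteq> P" "\<And>x. x \<in> P \<Longrightarrow> \<exists>h\<in>G. x \<in> convex hull h"
    and y: "y \<in> P" "0 < f y"
  shows "\<exists>h\<in>G. g \<subseteq> h \<and> (\<exists>a\<in>h. 0 < f a)"
proof -
  have fing: "finite g" "independent g" using G g by auto
  define p where "p = barycenter g"
  have ph: "p \<in> convex hull g" unfolding p_def using fing g by (intro barycenter_in_hull)
  have pP: "p \<in> P" using ph hull_minimal[of g P convex] P by blast
  have fp: "f p = 0" using convex_hull_const[of f g 0] f ph by blast
  have Tp: "T p = 1" using convex_hull_const[of T g 1] T G g ph by blast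
  define q where "q m = p + (1 / real (Suc m)) *\<^sub>R (y - p)" for m
  have "q m \<in> P" for m
  proof -
    have "q m = (1 - 1 / real (Suc m)) *\<^sub>R p + (1 / real (Suc m)) *\<^sub>R y"
      by (simp add: q_def algebra_simps)
    also have "\<dots> \<in> P" using pP y P(1) by (intro convexD) (auto simp: field_simps)
    finally show ?thesis .
  qed
  then have "\<forall>m. \<exists>h. h \<in> G \<and> q m \<in> convex hull h" using P(3) by blast
  then obtain H where H: "\<And>m. H m \<in> G" "\<And>m. q m \<in> convex hull (H m)" by metis
  have "finite (range H)" using H G by (intro finite_subset[OF _ G(1)]) auto
  then obtain m0 where "infinite {m \<in> UNIV. H m = H m0}"
    using pigeonhole_infinite[of UNIV H] by auto
  then have inf: "infinite {m. H m = H m0}" by simp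
  define h where "h = H m0"
  have h: "h \<in> G" "finite h" "independent h" "\<forall>x\<in>h. T x = 1" using H G by (auto simp: h_def)
  have qh: "q m \<in> convex hull h" if "H m = H m0" for m using H(2)[of m] that by (simp add: h_def)
  have large: "\<exists>m>k. H m = H m0" for k using inf infinite_nat_iff_unbounded by auto
  \<comment> \<open>Two of these points already put the direction \<open>y - p\<close>, and with it
    \<open>p\<close>, into the span of \<open>h\<close>, so that \<open>p\<close> can be expanded in
    the points of \<open>h\<close>.\<close>
  obtain m1 where m1: "H m1 = H m0" using large by blast
  obtain m2 where m2: "m2 > m1" "H m2 = H m0" using large by blast
  have qspan: "q m1 \<in> span h" "q m2 \<in> span h" using qh m1 m2 convex_hull_subset_span by blast+
  define c1 c2 where "c1 = 1 / real (Suc m1)" and "c2 = 1 / real (Suc m2)"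
  have c: "c1 - c2 \<noteq> 0" using m2 by (simp add: c1_def c2_def)
  have "q m1 - q m2 = (c1 - c2) *\<^sub>R (y - p)" by (simp add: q_def c1_def c2_def scaleR_diff_left)
  then have "y - p = (1 / (c1 - c2)) *\<^sub>R (q m1 - q m2)" using c by simp
  then have yp: "y - p \<in> span h" using qspan by (auto intro: span_scale span_diff)
  have "p = q m1 - c1 *\<^sub>R (y - p)" by (simp add: q_def c1_def)
  then have pspan: "p \<in> span h" using qspan yp by (metis span_diff span_scale)
  obtain \<phi> :: "'v \<Rightarrow> 'v \<Rightarrow> real"
    where "\<forall>s. linear (\<phi> s) \<and> (\<forall>t\<in>h. \<phi> s t = (if t = s then 1 else 0))"
    using dual_functionals[OF h(3)] by (elim exE)
  then have \<phi>: "linear (\<phi> s)" "t \<in> h \<Longrightarrow> \<phi> s t = (if t = s then 1 else 0)" for s t by simp_all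
  \<comment> \<open>Closedness of the hull without topology: a negative coordinate at
    \<open>p\<close> would stay negative at \<open>q m\<close> for large \<open>m\<close>.\<close>
  have nonneg: "0 \<le> \<phi> s p" for s
  proof (rule ccontr)
    assume neg: "\<not> 0 \<le> \<phi> s p"
    obtain k where k: "\<bar>\<phi> s (y - p)\<bar> / (- \<phi> s p) < real k" using reals_Archimedean2 by blast
    obtain m where m: "m > k" "H m = H m0" using large by blast
    have "0 \<le> \<phi> s (q m)"
      using convex_hull_nonneg[of "\<phi> s" h "q m"] \<phi> qh[OF m(2)] by simp
    also have "\<phi> s (q m) = \<phi> s p + \<phi> s (y - p) / real (Suc m)"
      unfolding q_def using \<phi>(1)[of s] by (simp add: linear_add linear_scale)
    finally have "- \<phi> s p * real (Suc m) \<le> \<phi> s (y - p)" by (simp add: field_simps)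
    moreover have "\<bar>\<phi> s (y - p)\<bar> < real k * (- \<phi> s p)"
      using k neg pos_divide_less_eq[of "- \<phi> s p" "\<bar>\<phi> s (y - p)\<bar>" "real k"] by linarith
    moreover have "real k * (- \<phi> s p) \<le> real (Suc m) * (- \<phi> s p)"
      using m neg by (intro mult_right_mono) auto
    ultimately show False unfolding mult.commute[of "real (Suc m)"] by linarith
  qed
  have pexp: "p = (\<Sum>s\<in>h. \<phi> s p *\<^sub>R s)" by (rule dual_functionals_expansion[OF h(2) \<phi> pspan])
  have "T (\<Sum>s\<in>h. \<phi> s p *\<^sub>R s) = (\<Sum>s\<in>h. \<phi> s p)"
    using T h by (simp add: linear_sum linear_scale)
  then have "(\<Sum>s\<in>h. \<phi> s p) = 1" using Tp pexp by metis
  then have "(\<Sum>s\<in>h. \<phi> s p *\<^sub>R s) \<in> convex hull h"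
    using h nonneg by (intro convex_sum) (auto intro: hull_inc)
  then have "p \<in> convex hull (h \<inter> g)" using pexp ph Int[OF h(1)] by auto
  then have pspan': "p \<in> span (h \<inter> g)" using convex_hull_subset_span by blast
  \<comment> \<open>The barycenter has nonzero weight at each point of \<open>g\<close>, so it does
    not lie in the span of a proper subset.\<close>
  have "g \<subseteq> h"
  proof
    fix s assume s: "s \<in> g"
    show "s \<in> h"
    proof (rule ccontr)
      assume "s \<notin> h"
      then have "span (h \<inter> g) \<subseteq> span (g - {s})" by (intro span_mono) auto
      then have ps: "p \<in> span (g - {s})" using pspan' by blast
      let ?n = "1 / real (card g)"
      have n: "?n \<noteq> 0" using fing g by simp
      have "p = ?n *\<^sub>R s + (\<Sum>t\<in>g - {s}. ?n *\<^sub>R t)"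
        unfolding p_def barycenter_def using fing s by (simp add: sum.remove)
      then have "?n *\<^sub>R s = p - (\<Sum>t\<in>g - {s}. ?n *\<^sub>R t)" by (simp add: algebra_simps)
      also have "\<dots> \<in> span (g - {s})"
        by (intro span_diff ps span_sum span_scale span_base)
      finally have "real (card g) *\<^sub>R ?n *\<^sub>R s \<in> span (g - {s})" by (rule span_scale)
      then have "s \<in> span (g - {s})" using n by simp
      then show False using fing s by (auto simp: dependent_def)
    qed
  qed
  moreover have "\<exists>a\<in>h. 0 < f a"
  proof (rule ccontr)
    assume "\<not> (\<exists>a\<in>h. 0 < f a)"
    then have "\<And>s. s \<in> h \<Longrightarrow> 0 \<le> - f s" by (simp add: not_less)
    moreover have "linear (\<lambda>x. - f x)" using f(1) by (rule linear_compose_neg)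
    ultimately have "0 \<le> - f (q m0)" using convex_hull_nonneg[of "\<lambda>x. - f x" h "q m0"] qh by simp
    moreover have "f (q m0) = f y / real (Suc m0)"
      using f(1) fp by (simp add: q_def linear_add linear_scale linear_diff)
    ultimately show False using y(2) by (simp add: field_simps)
  qed
  ultimately show ?thesis using h(1) by blast
qed

section \<open>Subdivisions\<close>

lemma subdivisionD:
  assumes "subdivision_of G K"
  shows "fin_complex G" "g \<in> G \<Longrightarrow> \<not> affine_dependent g"
    "g \<in> G \<Longrightarrow> h \<in> G \<Longrightarrow> convex hull g \<inter> convex hull h = convex hull (g \<inter> h)"
    "g \<in> G \<Longrightarrow> \<exists>r\<in>K. g \<subseteq> realize r"
    "s \<in> K \<Longrightarrow> x \<in> realize s \<Longrightarrow> \<exists>g\<in>G. x \<in> convex hull g"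
proof -
  show "fin_complex G" "g \<in> G \<Longrightarrow> \<not> affine_dependent g"
    "g \<in> G \<Longrightarrow> h \<in> G \<Longrightarrow> convex hull g \<inter> convex hull h = convex hull (g \<inter> h)"
    using assms by (auto simp: subdivision_of_def geometric_complex_def)
  have 1: "\<forall>g\<in>G. \<exists>r\<in>K. convex hull g \<subseteq> realize r"
    and 2: "(\<Union>g\<in>G. convex hull g) = (\<Union>r\<in>K. realize r)"
    using assms by (simp_all add: subdivision_of_def)
  show "\<exists>r\<in>K. g \<subseteq> realize r" if "g \<in> G"
    using bspec[OF 1 that] hull_subset[of g convex] by (elim bexE) (rule bexI, rule subset_trans)
  show "\<exists>g\<in>G. x \<in> convex hull g" if "s \<in> K" "x \<in> realize s"
  proof -
    have "x \<in> (\<Union>g\<in>G. convex hull g)" unfolding 2 using that by (rule UN_I)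
    then show ?thesis by simp
  qed
qed

lemma independent_span_eqI:
  assumes "independent g" "finite g" "g \<subseteq> span T" "finite T" "card T \<le> card g" "x \<in> span T"
  shows "x \<in> span g"
proof (rule ccontr)
  assume x: "x \<notin> span g"
  then have "independent (insert x g)" using assms(1) by (rule independent_insertI)
  moreover have "insert x g \<subseteq> span T" using assms by simp
  ultimately have "card (insert x g) \<le> card T" using independent_span_bound[OF assms(4)] by blast
  moreover have "x \<notin> g" using x span_base by blast
  ultimately show False using assms by simp
qed

context
  fixes K :: "'a set set" and G
  assumes K: "fin_complex K" and G: "subdivision_of G K"
begin

lemma subdivision_finite: "g \<in> G \<Longrightarrow> finite g" "finite G"
  using fin_complexD[OF subdivisionD(1)[OF G]] by auto

lemma subdivision_independent:
  assumes "g \<in> G"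
  shows "independent g"
proof -
  obtain r where "r \<in> K" "g \<subseteq> realize r" using subdivisionD(4)[OF G assms] by blast
  then show ?thesis
    using independent_affine_independent_realize[of r g] subdivisionD(2)[OF G assms]
      subdivision_finite assms fin_complexD(3)[OF K] by blast
qed

lemma subdivision_card_le:
  assumes "g \<in> G" "g \<subseteq> realize s" "finite s"
  shows "card g \<le> card s"
proof -
  have "g \<subseteq> span (unit_vec ` s)" using assms realize_subset_span by blast
  then have "card g \<le> card (unit_vec ` s)"
    using independent_span_bound[OF _ subdivision_independent[OF assms(1)]] assms(3) by blast
  then show ?thesis by (simp add: card_unit_vecs)
qed

text \<open>The face of \<open>g\<close> whose relative interior contains \<open>x\<close> lies in every face of \<open>K\<close> that
  contains \<open>x\<close>, because all coordinates are nonnegative.\<close>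

lemma subdivision_covers:
  assumes "s \<in> K" "x \<in> realize s"
  shows "\<exists>g\<in>G. g \<subseteq> realize s \<and> x \<in> convex hull g"
proof -
  obtain g where g: "g \<in> G" "x \<in> convex hull g" using subdivisionD(5)[OF G assms] by blast
  obtain r where r: "r \<in> K" "g \<subseteq> realize r" using subdivisionD(4)[OF G g(1)] by blast
  have fin: "finite g" "finite r" "finite s"
    using subdivision_finite g r assms fin_complexD(3)[OF K] by auto
  obtain u where u: "\<forall>y\<in>g. 0 \<le> u y" "sum u g = 1" "(\<Sum>y\<in>g. u y *\<^sub>R y) = x"
    using g(2) fin(1) by (auto simp: convex_hull_finite)
  define g0 where "g0 = {y \<in> g. u y \<noteq> 0}"
  have g0: "g0 \<subseteq> g" "finite g0" using fin by (auto simp: g0_def)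
  have "sum u g0 = 1"
    using u fin by (subst sum.mono_neutral_left[of g]) (auto simp: g0_def)
  moreover have "(\<Sum>y\<in>g0. u y *\<^sub>R y) = x"
    unfolding u(3)[symmetric] using fin by (intro sum.mono_neutral_left) (auto simp: g0_def)
  ultimately have "x \<in> convex hull g0"
    using u(1) g0 unfolding convex_hull_finite[OF g0(2)] by auto
  moreover have "g0 \<subseteq> realize s"
  proof
    fix y assume y: "y \<in> g0"
    then have yr: "y \<in> realize r" using g0 r by blast
    have zero: "coord v y = 0" if "v \<notin> s" for v
    proof -
      have "(\<Sum>z\<in>g. u z * coord v z) = coord v x" unfolding u(3)[symmetric] coord_sum by simp
      also have "\<dots> = 0" using assms(2) fin that by (simp add: mem_realize_iff)
      finally have "\<forall>z\<in>g. u z * coord v z = 0"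
        using fin u(1) r(2) by (subst (asm) sum_nonneg_eq_0_iff) (auto simp: mem_realize_iff)
      then show ?thesis using y by (auto simp: g0_def)
    qed
    have "(\<Sum>v\<in>r. coord v y) = (\<Sum>v\<in>r \<inter> s. coord v y)"
      using fin zero by (intro sum.mono_neutral_right) auto
    also have "\<dots> = (\<Sum>v\<in>s. coord v y)"
      using fin yr by (intro sum.mono_neutral_left) (auto simp: mem_realize_iff)
    finally show "y \<in> realize s" using yr zero fin by (auto simp: mem_realize_iff)
  qed
  moreover have "g0 \<in> G" using fin_complexD(4)[OF subdivisionD(1)[OF G] g(1) g0(1)] .
  ultimately show ?thesis by blast
qed

text \<open>The third property of \<open>f\<close> says that inside the span of \<open>s\<close> it
  vanishes only on the span of \<open>g\<close>; subtracting a suitable multiple of \<open>a\<close>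
  therefore moves \<open>b\<close> into that span.\<close>

lemma coface_side_unique:
  fixes f :: "('a \<Rightarrow>\<^sub>0 real) \<Rightarrow> real"
  assumes s: "s \<in> K" "card s = Suc (card g)" and g: "g \<in> G" "g \<noteq> {}" "g \<subseteq> realize s"
    and f: "linear f" "\<And>x. x \<in> g \<Longrightarrow> f x = 0"
      "\<And>x. x \<in> span (unit_vec ` s) \<Longrightarrow> f x = 0 \<Longrightarrow> x \<in> span g"
    and a: "insert a g \<in> G" "a \<in> realize s" "0 < f a"
    and b: "insert b g \<in> G" "b \<in> realize s" "0 < f b"
  shows "a = b"
proof -
  have fin: "finite s" "finite g" using fin_complexD(3)[OF K] s subdivision_finite g by auto
  show ?thesis
  proof (rule same_side_unique[where f = f and g = g and T = "\<lambda>x. \<Sum>v\<in>s. coord v x"])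
    show "(\<Sum>v\<in>s. coord v x) = 1" if "x \<in> insert a (insert b g)" for x
    proof -
      have "x \<in> realize s" using that g a b by auto
      then show ?thesis using fin by (simp add: mem_realize_iff)
    qed
    show "a \<notin> g" "b \<notin> g" using f(2) a(3) b(3) by force+
    have ab: "a \<in> span (unit_vec ` s)" "b \<in> span (unit_vec ` s)"
      using a b realize_subset_span by blast+
    have "f (b - (f b / f a) *\<^sub>R a) = 0" using f(1) a(3) by (simp add: linear_diff linear_scale)
    then show "b - (f b / f a) *\<^sub>R a \<in> span g"
      using ab by (intro f(3) span_diff span_scale)
    show "convex hull insert a g \<inter> convex hull insert b g = convex hull (insert a g \<inter> insert b g)"
      by (rule subdivisionD(3)[OF G a(1) b(1)])
  qed (use f a b g fin linear_coord_sum in auto)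
qed

lemma coface_side_exists:
  fixes f :: "('a \<Rightarrow>\<^sub>0 real) \<Rightarrow> real"
  assumes s: "s \<in> K" and g: "g \<in> G" "g \<noteq> {}" "g \<subseteq> realize s"
    and f: "linear f" "\<And>x. x \<in> g \<Longrightarrow> f x = 0"
    and y: "y \<in> realize s" "0 < f y"
  shows "\<exists>a. insert a g \<in> G \<and> a \<in> realize s \<and> 0 < f a"
proof -
  have fin: "finite s" using fin_complexD(3)[OF K] s by auto
  have "\<exists>h\<in>{h \<in> G. h \<subseteq> realize s}. g \<subseteq> h \<and> (\<exists>a\<in>h. 0 < f a)"
  proof (rule side_exists[where T = "\<lambda>x. \<Sum>v\<in>s. coord v x" and P = "realize s" and y = y])
    show "finite h \<and> independent h \<and> (\<forall>x\<in>h. (\<Sum>v\<in>s. coord v x) = 1)"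
      if "h \<in> {h \<in> G. h \<subseteq> realize s}" for h
      using that subdivision_finite subdivision_independent fin by (auto simp: mem_realize_iff)
    show "\<exists>h\<in>{h \<in> G. h \<subseteq> realize s}. x \<in> convex hull h" if "x \<in> realize s" for x
      using subdivision_covers[OF s that] by blast
    show "convex hull h \<inter> convex hull g = convex hull (h \<inter> g)"
      if "h \<in> {h \<in> G. h \<subseteq> realize s}" for h
      using subdivisionD(3)[OF G, of h g] that g by simp
  qed (use f g y convex_realize linear_coord_sum subdivision_finite in auto)
  then obtain h a where h: "h \<in> G" "h \<subseteq> realize s" "g \<subseteq> h" "a \<in> h" "0 < f a" by blast
  then have "insert a g \<in> G" using fin_complexD(4)[OF subdivisionD(1)[OF G] h(1)] by blast
  then show ?thesis using h by blast
qed

text \<open>The full-dimensional simplices around \<open>g\<close> in the induced subdivision of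
  \<open>s\<close>. For \<open>g\<close> of codimension one their number expresses the
  pseudomanifold property: one if \<open>g\<close> lies in a proper face of \<open>s\<close>, two
  otherwise.\<close>

definition cofaces :: "'a set \<Rightarrow> ('a \<Rightarrow>\<^sub>0 real) set \<Rightarrow> ('a \<Rightarrow>\<^sub>0 real) set set" where
  "cofaces s g = {h \<in> G. card h = card s \<and> h \<subseteq> realize s \<and> g \<in> faces h}"

lemma cofacesE:
  assumes "h \<in> cofaces s g"
  obtains a where "a \<notin> g" "h = insert a g" "insert a g \<in> G" "a \<in> realize s" "g \<subseteq> realize s"
  using assms by (auto simp: cofaces_def mem_faces_iff)

lemma cofacesI:
  assumes "a \<notin> g" "insert a g \<in> G" "a \<in> realize s" "g \<subseteq> realize s" "card s = Suc (card g)"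
  shows "insert a g \<in> cofaces s g"
  using assms subdivision_finite(1)[of "insert a g"] by (auto simp: cofaces_def mem_faces_iff)

text \<open>The coordinate of \<open>v\<close> vanishes on \<open>g\<close> and is nonnegative on
  \<open>s\<close>, so there is only one side for a coface to lie on.\<close>

lemma cofaces_of_boundary_face:
  assumes s: "s \<in> K" "card s = Suc (card g)" and g: "g \<in> G" "v \<in> s" "g \<subseteq> realize (s - {v})"
  shows "\<exists>h. cofaces s g = {h}"
proof -
  have fin: "finite s" "finite g" using fin_complexD(3)[OF K] s subdivision_finite g by auto
  have gs: "g \<subseteq> realize s" using g realize_mono[of "s - {v}" s] by blast
  show ?thesis
  \<comment> \<open>Empty \<open>g\<close> has no barycenter to start from; in that case
    \<open>s\<close> is a single vertex.\<close>
  proof (cases "g = {}")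
    case True
    then have sv: "s = {v}" using s g by (auto simp: card_1_singleton_iff)
    have rs: "realize s = {unit_vec v}" by (simp add: sv realize_def)
    obtain h where h: "h \<in> G" "h \<subseteq> realize s" "unit_vec v \<in> convex hull h"
      using subdivision_covers[OF s(1) unit_vec_in_realize[OF g(2)]] by blast
    then have "h = {unit_vec v}" using rs by (auto simp: subset_singleton_iff)
    then have "cofaces s g = {{unit_vec v}}"
      using True h sv rs by (auto simp: cofaces_def faces_def subset_singleton_iff)
    then show ?thesis by blast
  next
    case False
    let ?f = "coord v"
    have f0: "?f x = 0" if "x \<in> g" for x using that g fin by (auto simp: mem_realize_iff)
    have fspan: "x \<in> span g" if x: "x \<in> span (unit_vec ` s)" "?f x = 0" for x
    proof (rule independent_span_eqI)
      show "independent g" by (rule subdivision_independent[OF g(1)])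
      show "g \<subseteq> span (unit_vec ` (s - {v}))" using g realize_subset_span by blast
      show "card (unit_vec ` (s - {v})) \<le> card g" using s g fin by (simp add: card_unit_vecs)
      show "x \<in> span (unit_vec ` (s - {v}))"
        using x fin by (auto simp: mem_span_unit_vecs_iff)
    qed (use fin in auto)
    obtain a where a: "insert a g \<in> G" "a \<in> realize s" "0 < ?f a"
      using coface_side_exists[OF s(1) g(1) False gs linear_coord f0 unit_vec_in_realize[OF g(2)]]
      by auto
    have "a \<notin> g" using f0 a by force
    then have 1: "insert a g \<in> cofaces s g" using a gs s by (intro cofacesI)
    have "h = insert a g" if "h \<in> cofaces s g" for h
      using that
    proof (rule cofacesE)
      fix b assume b: "b \<notin> g" "h = insert b g" "insert b g \<in> G" "b \<in> realize s"
      have "?f b \<noteq> 0"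
      proof
        assume "?f b = 0"
        then have "b \<in> span g" using b realize_subset_span by (intro fspan) auto
        moreover have "insert b g - {b} = g" using b by simp
        ultimately show False
          using subdivision_independent[OF b(3)] unfolding dependent_def by (metis insertI1)
      qed
      moreover have "0 \<le> ?f b" using b fin by (simp add: mem_realize_iff)
      ultimately have "0 < ?f b" by simp
      then have "b = a"
        using a b gs False s g(1) f0 fspan linear_coord[of v]
        by (intro coface_side_unique[where f = "coord v" and g = g and s = s])
      then show ?thesis using b by simp
    qed
    then show ?thesis using 1 by blast
  qed
qed

text \<open>No coordinate describes the hyperplane of \<open>g\<close>, so a functional
  \<open>f\<close> is built from a vertex of \<open>s\<close> outside the span of \<open>g\<close>.
  It is positive at that vertex. It is negative at a point of \<open>s\<close> obtained by pushing
  the barycenter of \<open>g\<close> away from the vertex, which is possible as \<open>g\<close>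
  lies in no facet of \<open>s\<close>.\<close>

lemma cofaces_of_interior_face:
  assumes s: "s \<in> K" "card s = Suc (card g)" and g: "g \<in> G" "g \<subseteq> realize s"
    and int: "\<And>v. v \<in> s \<Longrightarrow> \<not> g \<subseteq> realize (s - {v})"
  shows "card (cofaces s g) = 2"
proof -
  have fin: "finite s" "finite g" using fin_complexD(3)[OF K] s subdivision_finite g by auto
  have "s \<noteq> {}" using s by auto
  then have ne: "g \<noteq> {}" using int by auto
  have ig: "independent g" by (rule subdivision_independent[OF g(1)])
  have "\<not> unit_vec ` s \<subseteq> span g"
  proof
    assume "unit_vec ` s \<subseteq> span g"
    then have "card (unit_vec ` s) \<le> card g"
      using independent_span_bound[OF fin(2) independent_unit_vecs[OF fin(1)]] by blast
    then show False using s by (simp add: card_unit_vecs)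
  qed
  then obtain u where u: "u \<in> s" "unit_vec u \<notin> span g" by blast
  let ?e = "unit_vec u"
  have eg: "?e \<notin> g" using u span_base by blast
  have ie: "independent (insert ?e g)" using u(2) ig by (rule independent_insertI)
  have "\<exists>f. linear f \<and> (\<forall>x\<in>insert ?e g. f x = (if x = ?e then 1 else (0::real)))"
    by (rule linear_independent_extend[OF ie])
  then obtain f where f: "linear f" "\<forall>x\<in>insert ?e g. f x = (if x = ?e then 1 else (0::real))"
    by (elim exE conjE)
  have f0: "f x = 0" if "x \<in> g" for x
    using f(2) eg that by auto
  have fe: "f ?e = 1" using f(2) by simp
  have fspan: "x \<in> span g" if x: "x \<in> span (unit_vec ` s)" "f x = 0" for x
  proof -
    have "x \<in> span (insert ?e g)"
    proof (rule independent_span_eqI[OF ie])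
      have "g \<subseteq> span (unit_vec ` s)" using g realize_subset_span by blast
      moreover have "?e \<in> span (unit_vec ` s)" using u(1) by (intro span_base imageI)
      ultimately show "insert ?e g \<subseteq> span (unit_vec ` s)" by simp
      show "card (unit_vec ` s) \<le> card (insert ?e g)" using s fin eg by (simp add: card_unit_vecs)
    qed (use fin x in auto)
    then obtain k where k: "x - k *\<^sub>R ?e \<in> span g" unfolding span_breakdown_eq by (elim exE)
    have "f (x - k *\<^sub>R ?e) = 0" by (rule linear_eq_0_on_span[OF f(1) f0 k])
    then have "k = 0" using f(1) fe x by (simp add: linear_diff linear_scale)
    then show ?thesis using k by simp
  qed
  let ?f' = "\<lambda>x. - f x"
  have f': "linear ?f'" using f(1) by (rule linear_compose_neg)
  have f0': "?f' x = 0" if "x \<in> g" for x using f0 that by simp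
  have fspan': "x \<in> span g" if "x \<in> span (unit_vec ` s)" "?f' x = 0" for x using fspan that by simp
  obtain a where a: "insert a g \<in> G" "a \<in> realize s" "0 < f a"
    using coface_side_exists[OF s(1) g(1) ne g(2) f(1) f0 unit_vec_in_realize[OF u(1)]] fe by auto
  define p where "p = barycenter g"
  have ph: "p \<in> convex hull g" unfolding p_def using fin ne by (intro barycenter_in_hull)
  have pr: "p \<in> realize s" using ph hull_minimal[of g "realize s" convex] g(2) convex_realize by blast
  have fp: "f p = 0" using convex_hull_const[of f g 0] f(1) f0 ph by blast
  \<comment> \<open>With this choice the \<open>u\<close>-coordinate of the point \<open>y\<close>
    below is \<open>(1 + \<epsilon>) * \<epsilon> - \<epsilon> = \<epsilon> * \<epsilon>\<close>,
    and the other coordinates of \<open>p\<close> do not decrease.\<close>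
  define \<epsilon> where "\<epsilon> = coord u p"
  have "0 < \<epsilon>"
  proof -
    obtain x where x: "x \<in> g" "x \<notin> realize (s - {u})" using int[OF u(1)] by blast
    have xr: "x \<in> realize s" using x g by blast
    have "coord u x \<noteq> 0"
    proof
      assume zero: "coord u x = 0"
      have "(\<Sum>v\<in>s. coord v x) = (\<Sum>v\<in>s - {u}. coord v x)"
        using fin zero by (intro sum.mono_neutral_right) auto
      then have "x \<in> realize (s - {u})" using xr fin zero by (auto simp: mem_realize_iff)
      then show False using x by simp
    qed
    then have "0 < coord u x" using xr fin by (auto simp: mem_realize_iff order_less_le)
    then have "0 < (1 / real (card g)) * coord u x" using fin ne by (simp add: card_gt_0_iff)
    also have "\<dots> \<le> (\<Sum>y\<in>g. (1 / real (card g)) * coord u y)"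
      using x(1) fin g(2) by (intro member_le_sum[where f = "\<lambda>y. (1 / real (card g)) * coord u y"])
        (auto simp: mem_realize_iff subset_iff)
    also have "\<dots> = \<epsilon>" by (simp add: \<epsilon>_def p_def barycenter_def coord_sum)
    finally show ?thesis .
  qed
  define y where "y = (1 + \<epsilon>) *\<^sub>R p - \<epsilon> *\<^sub>R ?e"
  have "y \<in> realize s"
  proof -
    have c: "coord w y = (1 + \<epsilon>) * coord w p - (if w = u then \<epsilon> else 0)" for w
      by (simp add: y_def lookup_minus lookup_single when_def)
    have pc: "0 \<le> coord w p" "w \<notin> s \<Longrightarrow> coord w p = 0" "(\<Sum>v\<in>s. coord v p) = 1" for w
      using pr fin by (auto simp: mem_realize_iff)
    have "0 \<le> coord w y" for w
    proof (cases "w = u")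
      case True
      then have "coord w y = \<epsilon> * \<epsilon>" by (simp add: c \<epsilon>_def algebra_simps)
      then show ?thesis by simp
    next
      case False
      then show ?thesis using pc(1)[of w] \<open>0 < \<epsilon>\<close> by (simp add: c)
    qed
    moreover have "coord w y = 0" if "w \<notin> s" for w using that u pc(2) by (auto simp: c)
    moreover have "(\<Sum>w\<in>s. coord w y) = 1"
      using u(1) fin pc(3) by (simp add: c sum_subtractf sum_distrib_left[symmetric])
    ultimately show ?thesis using fin by (simp add: mem_realize_iff)
  qed
  moreover have "0 < ?f' y"
    using f(1) fp fe \<open>0 < \<epsilon>\<close> by (simp add: y_def linear_diff linear_scale)
  ultimately obtain b where b: "insert b g \<in> G" "b \<in> realize s" "0 < ?f' b"
    using coface_side_exists[OF s(1) g(1) ne g(2) f' f0'] by blast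
  have nab: "a \<notin> g" "b \<notin> g" using f0 a b by force+
  have "h = insert a g \<or> h = insert b g" if "h \<in> cofaces s g" for h
    using that
  proof (rule cofacesE)
    fix c assume c: "c \<notin> g" "h = insert c g" "insert c g \<in> G" "c \<in> realize s"
    have "f c \<noteq> 0"
    proof
      assume "f c = 0"
      then have "c \<in> span g" using c realize_subset_span by (intro fspan) auto
      moreover have "insert c g - {c} = g" using c by simp
      ultimately show False
        using subdivision_independent[OF c(3)] unfolding dependent_def by (metis insertI1)
    qed
    then consider "0 < f c" | "0 < ?f' c" by linarith
    then have "c = a \<or> c = b"
    proof cases
      case 1
      then show ?thesis
        using coface_side_unique[OF s g(1) ne g(2) f(1) f0 fspan c(3,4) _ a] by blast
    next
      case 2
      then show ?thesis
        using coface_side_unique[OF s g(1) ne g(2) f' f0' fspan' c(3,4) _ b] by blast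
    qed
    then show ?thesis using c by blast
  qed
  moreover have "insert a g \<in> cofaces s g" "insert b g \<in> cofaces s g"
    using a b nab g s by (auto intro: cofacesI)
  ultimately have "cofaces s g = {insert a g, insert b g}" by blast
  moreover have "insert a g \<noteq> insert b g" using nab a b by (metis insert_iff less_asym neg_0_less_iff_less)
  ultimately show ?thesis by simp
qed

end

section \<open>The subdivision chain map and its simplicial left inverse\<close>

definition subd :: "('a \<Rightarrow>\<^sub>0 real) set set \<Rightarrow> 'a set \<Rightarrow> ('a \<Rightarrow>\<^sub>0 real) set set" where
  "subd G s = {g \<in> G. card g = card s \<and> g \<subseteq> realize s}"

text \<open>Sends a point to a vertex of its carrier; on the vertices of a subdivision this is a
  simplicial approximation of the identity.\<close>

definition approx :: "('a \<Rightarrow>\<^sub>0 real) \<Rightarrow> 'a" where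
  "approx x = (SOME v. coord v x \<noteq> 0)"

lemma realize_empty [simp]: "realize {} = {}"
  by (simp add: realize_def)

lemma approx_mem:
  assumes "finite s" "x \<in> realize s"
  shows "approx x \<in> s"
proof -
  have "(\<Sum>v\<in>s. coord v x) \<noteq> 0" using assms by (simp add: mem_realize_iff)
  then obtain v where "coord v x \<noteq> 0" by (meson sum.neutral)
  then have "coord (approx x) x \<noteq> 0" unfolding approx_def by (rule someI)
  then show ?thesis using assms by (auto simp: mem_realize_iff)
qed

context
  fixes K :: "'a set set" and G
  assumes K: "fin_complex K" and G: "subdivision_of G K"
begin

lemma subd_subset: "subd G s \<subseteq> G"
  by (auto simp: subd_def)

lemma finite_subd: "finite (subd G s)"
  using subd_subset subdivision_finite(2)[OF K G] by (rule finite_subset)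

lemma subd_empty: "subd G {} = {{}}"
  using fin_complexD(2)[OF subdivisionD(1)[OF G]] by (auto simp: subd_def)

text \<open>A codimension-one simplex in the interior of \<open>s\<close> has two cofaces and
  cancels; one in the boundary of \<open>s\<close> has one coface and belongs to the subdivision of
  exactly one face of \<open>s\<close>.\<close>

lemma bd_subd_simplex:
  assumes s: "s \<in> K"
  shows "bd (subd G s) = lin (subd G) (faces s)"
proof (rule set_eqI)
  fix g
  have fin: "finite s" using fin_complexD(3)[OF K s] .
  let ?A = "{h \<in> subd G s. g \<in> faces h}" and ?B = "{r \<in> faces s. g \<in> subd G r}"
  have A: "?A = cofaces G s g" by (auto simp: subd_def cofaces_def[OF K G])
  have "odd (card ?A) \<longleftrightarrow> odd (card ?B)"
  proof (cases "g \<in> G \<and> g \<subseteq> realize s \<and> card s = Suc (card g)")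
    case False
    have "?A = {}"
    proof -
      have "g \<in> G \<and> g \<subseteq> realize s \<and> card s = Suc (card g)" if h: "h \<in> subd G s" "g \<in> faces h" for h
      proof -
        have hG: "h \<in> G" "h \<subseteq> realize s" "card h = card s" using h by (auto simp: subd_def)
        have "g \<subseteq> h" using mem_faces_subset[OF h(2)] .
        moreover from this have "g \<in> G" using fin_complexD(4)[OF subdivisionD(1)[OF G] hG(1)] by blast
        moreover have "card h = Suc (card g)"
          using mem_faces_card[OF h(2)] subdivision_finite(1)[OF K G hG(1)] by blast
        ultimately show ?thesis using hG by auto
      qed
      then show ?thesis using False by blast
    qed
    moreover have "?B = {}"
    proof -
      have "g \<in> G \<and> g \<subseteq> realize s \<and> card s = Suc (card g)" if r: "r \<in> faces s" "g \<in> subd G r" for r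
        using mem_faces_card[OF r(1) fin] realize_mono[OF mem_faces_subset[OF r(1)]] r(2)
        by (auto simp: subd_def)
      then show ?thesis using False by blast
    qed
    ultimately show ?thesis by (simp only: card.empty)
  next
    case True
    show ?thesis
    proof (cases "\<exists>v\<in>s. g \<subseteq> realize (s - {v})")
      case v: True
      then obtain v where v: "v \<in> s" "g \<subseteq> realize (s - {v})" by blast
      obtain h where "cofaces G s g = {h}"
        using cofaces_of_boundary_face[OF K G s _ _ v] True by auto
      then have 1: "card ?A = 1" unfolding A by simp
      \<comment> \<open>Lying in two faces of \<open>s\<close> would place \<open>g\<close> in a
        simplex with \<open>card s - 2\<close> vertices, fewer than \<open>g\<close> has.\<close>
      have uniq: "w = v" if w: "w \<in> s" "g \<subseteq> realize (s - {w})" for w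
      proof (rule ccontr)
        assume "w \<noteq> v"
        have "g \<subseteq> realize ((s - {v}) \<inter> (s - {w}))"
          using v w fin by (subst realize_Int[symmetric]) auto
        then have "card g \<le> card ((s - {v}) \<inter> (s - {w}))"
          using subdivision_card_le[OF K G] True fin by blast
        also have "(s - {v}) \<inter> (s - {w}) = s - {v, w}" by auto
        also have "card (s - {v, w}) = card s - 2"
          using v w \<open>w \<noteq> v\<close> fin by (subst card_Diff_subset) auto
        finally show False using True v w \<open>w \<noteq> v\<close> card_mono[OF fin, of "{v, w}"] by auto
      qed
      have "r = s - {v}" if r: "r \<in> faces s" "g \<in> subd G r" for r
      proof -
        obtain w where "w \<in> s" "r = s - {w}" using r(1) unfolding faces_def by blast
        moreover have "g \<subseteq> realize r" using r(2) by (simp add: subd_def)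
        ultimately show ?thesis using uniq[of w] by simp
      qed
      moreover have "s - {v} \<in> faces s" using v(1) by (simp add: faces_def)
      moreover have "g \<in> subd G (s - {v})" using v True fin by (simp add: subd_def)
      ultimately have "?B = {s - {v}}" by blast
      then have "card ?B = 1" by simp
      then show ?thesis using 1 by simp
    next
      case False
      then have "card ?A = 2" unfolding A using cofaces_of_interior_face[OF K G s] True by blast
      moreover have "?B = {}" using False by (auto simp: faces_def subd_def)
      ultimately show ?thesis by (simp only: card.empty) simp
    qed
  qed
  then show "g \<in> bd (subd G s) \<longleftrightarrow> g \<in> lin (subd G) (faces s)" by (simp add: lin_def)
qed

lemma push_approx_in_complex:
  assumes "g \<in> G"
  shows "push approx g \<subseteq> K"
proof -
  obtain r where r: "r \<in> K" "g \<subseteq> realize r" using subdivisionD(4)[OF G assms] by blast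
  have "approx ` g \<subseteq> r"
    using approx_mem[OF fin_complexD(3)[OF K r(1)]] r(2) by blast
  then have "approx ` g \<in> K" using fin_complexD(4)[OF K r(1)] by blast
  then show ?thesis by (simp add: push_def)
qed

text \<open>Sperner's lemma: both sides have the same boundary and the left one is supported on \<open>{s}\<close>.\<close>

lemma push_approx_subd:
  assumes "s \<in> K"
  shows "lin (push approx) (subd G s) = {s}"
  using assms
proof (induction "card s" arbitrary: s rule: less_induct)
  case less
  have fin: "finite s" using fin_complexD(3)[OF K less.prems] .
  show ?case
  proof (cases "s = {}")
    case True
    then show ?thesis by (simp add: subd_empty push_def)
  next
    case False
    have "push approx g \<subseteq> {s}" if "g \<in> subd G s" for g
    proof -
      have g: "g \<in> G" "card g = card s" "g \<subseteq> realize s" using that by (auto simp: subd_def)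
      have "approx ` g \<subseteq> s" using approx_mem[OF fin] g(3) by blast
      moreover have "card (approx ` g) = card s" if "inj_on approx g"
        using card_image[OF that] g by simp
      ultimately show ?thesis using card_subset_eq[OF fin] by (auto simp: push_def)
    qed
    then have sub: "lin (push approx) (subd G s) \<subseteq> {s}" using lin_subset[of "push approx" "subd G s"] by blast
    have "bd (lin (push approx) (subd G s)) = lin (push approx) (bd (subd G s))"
      using subdivision_finite(1)[OF K G] subd_subset by (intro bd_push finite_subd) blast
    also have "\<dots> = lin (push approx) (lin (subd G) (faces s))"
      by (simp add: bd_subd_simplex[OF less.prems])
    also have "\<dots> = lin (\<lambda>r. lin (push approx) (subd G r)) (faces s)"
      using fin by (intro lin_comp finite_subd) simp
    also have "\<dots> = lin (\<lambda>r. {r}) (faces s)"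
    proof (rule lin_cong)
      fix r assume r: "r \<in> faces s"
      show "lin (push approx) (subd G r) = {r}"
        using mem_faces_card[OF r fin] r fin_complex_faces[OF K less.prems] by (intro less.hyps) auto
    qed
    also have "\<dots> = faces s" using fin by (intro lin_single) simp
    finally have "bd (lin (push approx) (subd G s)) = faces s" .
    moreover have "faces s \<noteq> {}" using False by (simp add: faces_def)
    ultimately have "lin (push approx) (subd G s) \<noteq> {}" by auto
    then show ?thesis using sub by blast
  qed
qed

lemma subd_nonempty: "s \<in> K \<Longrightarrow> subd G s \<noteq> {}"
  using push_approx_subd by force

lemma acyclic_subdivision:
  assumes "acyclic_complex G"
  shows "acyclic_complex K"
  unfolding acyclic_complex_def
proof (intro allI impI, elim conjE)
  fix z assume z: "z \<subseteq> K" "bd z = {}"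
  have finz: "finite z" "\<And>s. s \<in> z \<Longrightarrow> finite s"
    using finite_subset[OF z(1) fin_complexD(1)[OF K]] z(1) fin_complexD(3)[OF K] by auto
  have "bd (lin (subd G) z) = lin (\<lambda>s. bd (subd G s)) z" by (intro lin_comp finz finite_subd)
  also have "\<dots> = lin (\<lambda>s. lin (subd G) (faces s)) z"
    using z(1) by (intro lin_cong bd_subd_simplex) blast
  also have "\<dots> = lin (subd G) (bd z)" using finz by (intro lin_comp[symmetric]) auto
  finally have "bd (lin (subd G) z) = {}" using z by simp
  moreover have "lin (subd G) z \<subseteq> G" using lin_subset[of "subd G" z] subd_subset by blast
  ultimately obtain y where y: "y \<subseteq> G" "bd y = lin (subd G) z"
    using acyclic_complexE[OF assms] by metis
  have finy: "finite y" "\<And>g. g \<in> y \<Longrightarrow> finite g"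
    using finite_subset[OF y(1) subdivision_finite(2)[OF K G]] y(1) subdivision_finite(1)[OF K G] by auto
  have "bd (lin (push approx) y) = lin (push approx) (lin (subd G) z)"
    using bd_push[OF finy] y(2) by simp
  also have "\<dots> = lin (\<lambda>s. lin (push approx) (subd G s)) z" by (intro lin_comp finz finite_subd)
  also have "\<dots> = lin (\<lambda>s. {s}) z" using z(1) by (intro lin_cong push_approx_subd) blast
  also have "\<dots> = z" by (rule lin_single[OF finz(1)])
  finally have "bd (lin (push approx) y) = z" .
  moreover have "lin (push approx) y \<subseteq> K"
    using lin_subset[of "push approx" y] push_approx_in_complex y(1) by blast
  ultimately show "\<exists>y\<subseteq>K. bd y = z" by blast
qed

end

lemma collapsible_imp_acyclic:
  assumes "fin_complex K" "collapsible K"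
  shows "acyclic_complex K"
proof -
  obtain G v where G: "subdivision_of G K" "elementary_collapse\<^sup>*\<^sup>* G {{}, {v}}"
    using assms(2) unfolding collapsible_def by (elim exE conjE)
  have "acyclic_complex {{}, {v}}"
    by (rule acyclic_cone[of _ v]) (auto simp: fin_complex_def)
  then have "acyclic_complex G"
    by (rule acyclic_collapses[OF G(2) subdivisionD(1)[OF G(1)]])
  then show ?thesis by (rule acyclic_subdivision[OF assms(1) G(1)])
qed

section \<open>Combinatorial balls\<close>

lemma card_cofaces_le_2:
  assumes K: "fin_complex K" and G: "subdivision_of G K" and "s \<in> K" "g \<in> G" "card s = Suc (card g)"
  shows "card (cofaces G s g) \<le> 2"
proof (cases "g \<subseteq> realize s")
  case True
  show ?thesis
  proof (cases "\<exists>v\<in>s. g \<subseteq> realize (s - {v})")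
    case True
    then obtain v where v: "v \<in> s" "g \<subseteq> realize (s - {v})" by blast
    obtain h where "cofaces G s g = {h}"
      using cofaces_of_boundary_face[OF K G assms(3,5,4) v] by (elim exE)
    then show ?thesis by simp
  next
    case False
    then have "card (cofaces G s g) = 2"
      using True by (intro cofaces_of_interior_face[OF K G assms(3,5,4)]) auto
    then show ?thesis by simp
  qed
next
  case False
  then have "cofaces G s g = {}"
    using mem_faces_subset by (auto simp: cofaces_def[OF K G])
  then show ?thesis by simp
qed

text \<open>All three facts are carried over from the standard simplex through the subdivisions. For
  the last one, fix a \<open>(k-1)\<close>-simplex \<open>g\<close> of the subdivision inside
  \<open>r\<close>: every \<open>k\<close>-simplex of \<open>L\<close> around \<open>r\<close>
  contains a coface of \<open>g\<close>, and the isomorphic copy of \<open>g\<close> in the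
  subdivided standard simplex has at most two.\<close>

lemma combinatorial_ball_structure:
  assumes "combinatorial_ball k L"
  shows "\<exists>s\<in>L. card s = Suc k"
    and "\<And>s. s \<in> L \<Longrightarrow> card s \<le> Suc k"
    and "\<And>r. r \<in> L \<Longrightarrow> card r = k \<Longrightarrow> card {s \<in> L. card s = Suc k \<and> r \<subseteq> s} \<le> 2"
proof -
  let ?D = "Pow {0..k}"
  have L: "fin_complex L" using assms by (simp add: combinatorial_ball_def)
  have D: "fin_complex ?D" by (simp add: fin_complex_Pow)
  obtain G H f where G: "subdivision_of G L" and H: "subdivision_of H ?D"
    and f: "inj_on f (\<Union>G)" "H = image f ` G"
    using assms unfolding combinatorial_ball_def have_common_subdivision_def complex_iso_def
    by (elim exE conjE)
  have injf: "inj_on f g" if "g \<in> G" for g using f(1) that by (auto intro: inj_on_subset)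
  have cardf: "card (f ` g) = card g" if "g \<in> G" for g using card_image[OF injf[OF that]] .
  have Hsub: "h \<subseteq> realize {0..k}" if "h \<in> H" for h
  proof -
    obtain r where "r \<subseteq> {0..k}" "h \<subseteq> realize r" using subdivisionD(4)[OF H \<open>h \<in> H\<close>] by blast
    then show ?thesis using realize_mono by blast
  qed
  have Hcard: "card h \<le> Suc k" if "h \<in> H" for h
    using subdivision_card_le[OF D H that Hsub[OF that]] by simp
  show "card s \<le> Suc k" if s: "s \<in> L" for s
  proof -
    obtain g where g: "g \<in> G" "card g = card s" using subd_nonempty[OF L G s] by (auto simp: subd_def)
    then show ?thesis using Hcard[of "f ` g"] cardf f(2) by auto
  qed
  note le = this
  show "\<exists>s\<in>L. card s = Suc k"
  proof -
    have "{0..k} \<in> ?D" by simp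
    then obtain h where h: "h \<in> H" "card h = Suc k"
      using subd_nonempty[OF D H] by (force simp: subd_def)
    then obtain g where g: "g \<in> G" "card g = Suc k" using f(2) cardf by auto
    obtain r where r: "r \<in> L" "g \<subseteq> realize r" using subdivisionD(4)[OF G g(1)] by blast
    then have "Suc k \<le> card r"
      using subdivision_card_le[OF L G g(1) r(2)] fin_complexD(3)[OF L] g(2) by simp
    then show ?thesis using le[OF r(1)] r(1) by (intro bexI[of _ r]) auto
  qed
  show "card {s \<in> L. card s = Suc k \<and> r \<subseteq> s} \<le> 2" if r: "r \<in> L" "card r = k" for r
  proof -
    let ?S = "{s \<in> L. card s = Suc k \<and> r \<subseteq> s}"
    obtain g where g: "g \<in> G" "card g = k" "g \<subseteq> realize r"
      using subd_nonempty[OF L G r(1)] r(2) by (auto simp: subd_def)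
    let ?C = "{h \<in> G. card h = Suc k \<and> g \<in> faces h}"
    have "\<exists>h. h \<in> ?C \<and> h \<subseteq> realize s" if s: "s \<in> ?S" for s
    proof -
      have fin: "finite s" using fin_complexD(3)[OF L] s by blast
      have "r \<in> faces s" using s r fin by (intro card_Suc_imp_mem_faces) auto
      then obtain v where v: "v \<in> s" "r = s - {v}" by (auto simp: faces_def)
      have "\<exists>h. cofaces G s g = {h}"
        by (rule cofaces_of_boundary_face[OF L G _ _ g(1) v(1)]) (use s g v in auto)
      then obtain h where "cofaces G s g = {h}" by (elim exE)
      then show ?thesis using s by (auto simp: cofaces_def[OF L G])
    qed
    then have "\<forall>s\<in>?S. \<exists>h. h \<in> ?C \<and> h \<subseteq> realize s" by (rule ballI)
    from bchoice[OF this] obtain c where cS: "\<forall>s\<in>?S. c s \<in> ?C \<and> c s \<subseteq> realize s" by (elim exE)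
    have c: "c s \<in> ?C" "c s \<subseteq> realize s" if "s \<in> ?S" for s using bspec[OF cS that] by simp_all
    \<comment> \<open>A common value at \<open>s\<close> and \<open>t\<close> would lie in
      \<open>s \<inter> t\<close>, which has too few vertices.\<close>
    have "inj_on c ?S"
    proof (rule inj_onI, rule ccontr)
      fix s t assume st: "s \<in> ?S" "t \<in> ?S" "c s = c t" "s \<noteq> t"
      have fin: "finite s" "finite t" using fin_complexD(3)[OF L] st by auto
      have "c s \<subseteq> realize (s \<inter> t)" using c[OF st(1)] c[OF st(2)] st(3) realize_Int[OF fin] by auto
      then have "card (c s) \<le> card (s \<inter> t)"
        using c[OF st(1)] fin by (intro subdivision_card_le[OF L G]) auto
      moreover have "card (s \<inter> t) < card s"
        using st fin card_subset_eq[of t s] by (intro psubset_card_mono) auto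
      ultimately show False using c[OF st(1)] st(1) by auto
    qed
    moreover have finC: "finite ?C" using subdivision_finite(2)[OF L G] by simp
    ultimately have "card ?S \<le> card ?C" using c(1) by (intro card_inj_on_le[of c] image_subsetI)
    also have "card ?C \<le> card (cofaces H {0..k} (f ` g))"
    proof (rule card_inj_on_le)
      show "inj_on (image f) ?C"
        using f(1) by (intro inj_on_subset[OF inj_on_image_Pow]) auto
      show "image f ` ?C \<subseteq> cofaces H {0..k} (f ` g)"
      proof (rule image_subsetI)
        fix h assume h: "h \<in> ?C"
        then obtain v where v: "v \<notin> g" "h = insert v g" by (auto simp: mem_faces_iff)
        then have "f v \<notin> f ` g" using injf[of h] h by (auto simp: inj_on_def)
        then have "f ` g \<in> faces (f ` h)" using v by (auto simp: mem_faces_iff)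
        moreover have "f ` h \<in> H" using f(2) h by blast
        ultimately show "f ` h \<in> cofaces H {0..k} (f ` g)"
          using Hsub cardf h by (auto simp: cofaces_def[OF D H])
      qed
      show "finite (cofaces H {0..k} (f ` g))"
        using subdivision_finite(2)[OF D H] by (auto simp: cofaces_def[OF D H])
    qed
    also have "\<dots> \<le> 2"
      using g f(2) cardf by (intro card_cofaces_le_2[OF D H]) auto
    finally show ?thesis .
  qed
qed

section \<open>Simplices are balls and cones are collapsible\<close>

lemma trivial_subdivision:
  assumes K: "fin_complex K"
  shows "subdivision_of (image unit_vec ` K) K"
proof -
  have Int: "unit_vec ` s \<inter> unit_vec ` t = unit_vec ` (s \<inter> t)" for s t :: "'a set"
    by (rule image_Int[OF inj_unit_vec, symmetric])
  have "fin_complex (image unit_vec ` K)"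
    unfolding fin_complex_def
  proof (intro conjI ballI allI impI)
    fix s r assume "s \<in> image unit_vec ` K" "r \<subseteq> s"
    then obtain t where t: "t \<in> K" "r \<subseteq> unit_vec ` t" by blast
    then obtain t' where "t' \<subseteq> t" "r = unit_vec ` t'" by (auto simp: subset_image_iff)
    then show "r \<in> image unit_vec ` K" using fin_complexD(4)[OF K t(1)] by blast
  qed (use fin_complexD[OF K] in auto)
  moreover have "\<not> affine_dependent (unit_vec ` s)" if "s \<in> K" for s
    using independent_unit_vecs[OF fin_complexD(3)[OF K that]] affine_dependent_imp_dependent by blast
  moreover have "convex hull (unit_vec ` s) \<inter> convex hull (unit_vec ` t)
      = convex hull (unit_vec ` s \<inter> unit_vec ` t)" if "s \<in> K" "t \<in> K" for s t
    unfolding Int realize_def[symmetric] using that fin_complexD(3)[OF K] by (intro realize_Int)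
  ultimately show ?thesis
    unfolding subdivision_of_def geometric_complex_def by (auto simp: realize_def)
qed

lemma combinatorial_ball_Pow:
  assumes "finite s" "card s = Suc k"
  shows "combinatorial_ball k (Pow s)"
proof -
  have "card s = card {0..k}" using assms by simp
  then obtain h where h: "bij_betw h s {0..k}" using assms finite_same_card_bij by blast
  define f where "f = (\<lambda>x. unit_vec (h (the_inv unit_vec x)) :: nat \<Rightarrow>\<^sub>0 real)"
  have f: "f (unit_vec v) = unit_vec (h v)" for v :: 'a
    by (simp add: f_def the_inv_f_f[OF inj_unit_vec])
  have "\<Union>(image unit_vec ` Pow s) = unit_vec ` s" by blast
  moreover have "inj_on f (unit_vec ` s)"
  proof (rule inj_onI, elim imageE)
    fix x y u v assume "f x = f y" "x = unit_vec u" "u \<in> s" "y = unit_vec v" "v \<in> s"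
    moreover from this have "h u = h v" using injD[OF inj_unit_vec] by (auto simp: f)
    ultimately show "x = y" using h by (auto simp: bij_betw_def inj_on_def)
  qed
  moreover have "image unit_vec ` Pow {0..k} = image f ` image unit_vec ` Pow s"
  proof -
    have "image h ` Pow s = Pow {0..k}" using h by (intro image_Pow_surj) (simp add: bij_betw_def)
    then have "image unit_vec ` Pow {0..k} = image unit_vec ` image h ` Pow s" by simp
    also have "\<dots> = image f ` image unit_vec ` Pow s" by (simp add: image_image f)
    finally show ?thesis .
  qed
  ultimately have "complex_iso (image unit_vec ` Pow s) (image unit_vec ` Pow {0..k})"
    unfolding complex_iso_def by (intro exI[of _ f]) simp
  moreover have "subdivision_of (image unit_vec ` Pow s) (Pow s)"
    "subdivision_of (image unit_vec ` Pow {0..k}) (Pow {0..k})"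
    using assms by (intro trivial_subdivision fin_complex_Pow; simp)+
  ultimately show ?thesis
    unfolding combinatorial_ball_def have_common_subdivision_def
    using fin_complex_Pow[OF assms(1)] by blast
qed

text \<open>A maximal nonempty simplex \<open>s\<close> without the apex is a free face of
  \<open>insert a s\<close>, and removing both leaves a smaller cone.\<close>

lemma cone_collapses:
  assumes "fin_complex K" "{a} \<in> K" "\<And>s. s \<in> K \<Longrightarrow> insert a s \<in> K"
  shows "elementary_collapse\<^sup>*\<^sup>* K {{}, {a}}"
  using assms
proof (induction "card K" arbitrary: K rule: less_induct)
  case less
  note K = less.prems(1) and aK = less.prems(2) and cone = less.prems(3)
  show ?case
  proof (cases "K = {{}, {a}}")
    case False
    let ?M = "{s \<in> K. a \<notin> s \<and> s \<noteq> {}}"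
    have "\<not> K \<subseteq> {{}, {a}}" using False aK fin_complexD(2)[OF K] by blast
    then obtain x where x: "x \<in> K" "x \<noteq> {}" "x \<noteq> {a}" by blast
    have "x - {a} \<in> K" using fin_complexD(4)[OF K x(1)] by blast
    then have "x - {a} \<in> ?M" using x by auto
    moreover have "finite ?M" using fin_complexD(1)[OF K] by simp
    ultimately have "\<exists>m\<in>?M. \<forall>b\<in>?M. m \<subseteq> b \<longrightarrow> m = b" by (intro finite_has_maximal) auto
    then obtain s where sM: "s \<in> ?M" and "\<forall>t\<in>?M. s \<subseteq> t \<longrightarrow> s = t" by (elim bexE)
    then have s: "s \<in> ?M" "t \<in> ?M \<Longrightarrow> s \<subseteq> t \<Longrightarrow> s = t" for t by simp_all
    let ?t = "insert a s"
    have t: "?t \<in> K" using cone s(1) by simp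
    have max: "r = ?t" if r: "r \<in> K" "s \<subset> r" for r
    proof -
      have "a \<in> r"
      proof (rule ccontr)
        assume "a \<notin> r"
        then have "r \<in> ?M" using r by auto
        then show False using s(2)[of r] r by blast
      qed
      have "r - {a} \<in> K" using fin_complexD(4)[OF K r(1)] by blast
      then have "r - {a} \<in> ?M" using s(1) r by auto
      moreover have "s \<subseteq> r - {a}" using s(1) r by auto
      ultimately have "s = r - {a}" using s(2) by blast
      then show ?thesis using \<open>a \<in> r\<close> by auto
    qed
    let ?L = "K - {s, ?t}"
    have st: "s \<in> K" "s \<noteq> {}" "s \<subset> ?t" using s(1) by auto
    have coll: "elementary_collapse K ?L"
      unfolding elementary_collapse_def
      by (rule bexI[OF _ st(1)], rule bexI[OF _ t]) (use st max in blast)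
    have "elementary_collapse\<^sup>*\<^sup>* ?L {{}, {a}}"
    proof (rule less.hyps)
      show "card ?L < card K"
        using st(1) fin_complexD(1)[OF K] by (intro psubset_card_mono) auto
      show "fin_complex ?L" by (rule elementary_collapse_fin_complex[OF K coll])
      show "{a} \<in> ?L" using aK s(1) by auto
      show "insert a r \<in> ?L" if "r \<in> ?L" for r
      proof -
        have "insert a r \<noteq> s" using s(1) by auto
        moreover have "insert a r \<noteq> ?t" using that s(1)
          by (metis (no_types, lifting) DiffE insertCI insert_absorb insert_ident mem_Collect_eq)
        ultimately show ?thesis using cone that by simp
      qed
    qed
    then show ?thesis by (rule converse_rtranclp_into_rtranclp[where r = elementary_collapse, OF coll])
  qed simp
qed

lemma cone_collapsible:
  assumes K: "fin_complex K" "{a} \<in> K" "\<And>s. s \<in> K \<Longrightarrow> insert a s \<in> K"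
  shows "collapsible K"
proof -
  let ?G = "image unit_vec ` K"
  have G: "subdivision_of ?G K" by (rule trivial_subdivision[OF K(1)])
  have "elementary_collapse\<^sup>*\<^sup>* ?G {{}, {unit_vec a}}"
  proof (rule cone_collapses)
    show "fin_complex ?G" by (rule subdivisionD(1)[OF G])
    show "{unit_vec a} \<in> ?G" using K(2) by (intro image_eqI[of _ _ "{a}"]) auto
    show "insert (unit_vec a) s \<in> ?G" if s: "s \<in> ?G" for s
    proof -
      obtain t where "t \<in> K" "s = unit_vec ` t" using s by blast
      then show ?thesis using K(3) by (intro image_eqI[of _ _ "insert a t"]) auto
    qed
  qed
  then show ?thesis using G unfolding collapsible_def by blast
qed

section \<open>Staircase complexes\<close>

text \<open>\<open>V\<close> is an ambient set rather than the vertex set: if \<open>W\<close> has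
  one element, that element lies in no facet. The values of \<open>D\<close> outside
  \<open>W\<close> are arbitrary, so passing to fewer indices, in a link or after removing a facet,
  keeps the same \<open>D\<close>.\<close>

definition staircase_data :: "'a set \<Rightarrow> 'a set \<Rightarrow> ('a \<Rightarrow> 'a set) \<Rightarrow> bool" where
  "staircase_data V W D \<longleftrightarrow> finite V \<and> W \<subseteq> V \<and> W \<noteq> {} \<and> (\<forall>w\<in>W. D w \<subseteq> V - W) \<and>
     (\<forall>w\<in>W. \<forall>w'\<in>W. D w \<subseteq> D w' \<or> D w' \<subseteq> D w)"

definition staircase :: "'a set \<Rightarrow> 'a set \<Rightarrow> ('a \<Rightarrow> 'a set) \<Rightarrow> 'a set set" where
  "staircase V W D = (\<Union>w\<in>W. Pow (V - insert w (D w)))"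

text \<open>A common point of all facets. By the chain condition none exists exactly when the
  largest \<open>D w\<close> is all of \<open>V - W\<close>; this separates spheres from
  balls.\<close>

definition apex :: "'a set \<Rightarrow> 'a set \<Rightarrow> ('a \<Rightarrow> 'a set) \<Rightarrow> 'a \<Rightarrow> bool" where
  "apex V W D a \<longleftrightarrow> a \<in> V \<and> a \<notin> W \<and> (\<forall>w\<in>W. a \<notin> D w)"

lemma staircase_dataD:
  assumes "staircase_data V W D"
  shows "finite V" "W \<subseteq> V" "W \<noteq> {}" "finite W"
    "w \<in> W \<Longrightarrow> D w \<subseteq> V - W" "w \<in> W \<Longrightarrow> w' \<in> W \<Longrightarrow> D w \<subseteq> D w' \<or> D w' \<subseteq> D w"
  using assms unfolding staircase_data_def by (auto intro: finite_subset)

lemma mem_staircase_iff: "r \<in> staircase V W D \<longleftrightarrow> (\<exists>w\<in>W. r \<subseteq> V - insert w (D w))"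
  by (simp add: staircase_def)

lemma staircase_fin_complex:
  assumes "staircase_data V W D"
  shows "fin_complex (staircase V W D)"
proof -
  note d = staircase_dataD[OF assms]
  show ?thesis
    unfolding fin_complex_def
  proof (intro conjI ballI allI impI)
    show "finite (staircase V W D)" unfolding staircase_def using d(1,4) by simp
    show "{} \<in> staircase V W D" using d(3) by (auto simp: mem_staircase_iff)
    show "finite s" if "s \<in> staircase V W D" for s
      using that finite_subset[of s V] d(1) by (auto simp: mem_staircase_iff)
    show "r \<in> staircase V W D" if "s \<in> staircase V W D" "r \<subseteq> s" for s r
      using that unfolding mem_staircase_iff by blast
  qed
qed

text \<open>A point of \<open>W\<close> is missed by its own facet only; the facets are therefore
  pairwise incomparable and counted by \<open>W\<close>.\<close>

lemma mem_staircase_facet_iff: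
  assumes "staircase_data V W D" "w \<in> W" "w' \<in> W"
  shows "w' \<in> V - insert w (D w) \<longleftrightarrow> w' \<noteq> w"
  using staircase_dataD(2,5)[OF assms(1)] assms(2,3) by blast

lemma staircase_facet_inj:
  assumes "staircase_data V W D" "w \<in> W" "w' \<in> W" "V - insert w (D w) \<subseteq> V - insert w' (D w')"
  shows "w = w'"
  using mem_staircase_facet_iff[OF assms(1-3)] mem_staircase_facet_iff[OF assms(1,3,3)] assms(4) by blast

lemma principal_simplices_staircase:
  assumes "staircase_data V W D"
  shows "principal_simplices (staircase V W D) = (\<lambda>w. V - insert w (D w)) ` W"
proof -
  let ?F = "\<lambda>w. V - insert w (D w)"
  have "s \<in> ?F ` W" if s: "s \<in> principal_simplices (staircase V W D)" for s
  proof -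
    obtain w where w: "w \<in> W" "s \<subseteq> ?F w"
      using s unfolding principal_simplices_def mem_Collect_eq mem_staircase_iff by (elim conjE bexE)
    have "?F w \<in> staircase V W D" using w by (auto simp: mem_staircase_iff)
    then have "s = ?F w" using s w(2) by (auto simp: principal_simplices_def)
    then show ?thesis using w(1) by (rule image_eqI)
  qed
  moreover have "?F w \<in> principal_simplices (staircase V W D)" if w: "w \<in> W" for w
  proof -
    have "?F w \<in> staircase V W D" using w by (auto simp: mem_staircase_iff)
    moreover have "\<not> ?F w \<subset> t" if t: "t \<in> staircase V W D" for t
    proof
      assume st: "?F w \<subset> t"
      obtain w' where w': "w' \<in> W" "t \<subseteq> ?F w'" using t unfolding mem_staircase_iff by (elim bexE)
      then have "w = w'" using st by (intro staircase_facet_inj[OF assms w]) auto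
      then show False using st w' by blast
    qed
    ultimately show ?thesis unfolding principal_simplices_def by simp
  qed
  ultimately show ?thesis by blast
qed

lemma num_principal_staircase:
  assumes "staircase_data V W D"
  shows "num_principal (staircase V W D) = card W"
  unfolding num_principal_def principal_simplices_staircase[OF assms]
  by (intro card_image inj_onI staircase_facet_inj[OF assms]) auto

text \<open>The facets through \<open>x\<close> survive and lose \<open>x\<close>; their sets
  \<open>D w\<close> do not contain \<open>x\<close> and stay as they are.\<close>

lemma vlink_staircase:
  assumes "x \<in> V"
  shows "vlink x (staircase V W D) = staircase (V - {x}) {w \<in> W. w \<noteq> x \<and> x \<notin> D w} D"
proof (rule set_eqI)
  fix r
  show "r \<in> vlink x (staircase V W D) \<longleftrightarrow> r \<in> staircase (V - {x}) {w \<in> W. w \<noteq> x \<and> x \<notin> D w} D"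
    unfolding vlink_def mem_Collect_eq mem_staircase_iff using assms by blast
qed

lemma staircase_data_link:
  assumes "staircase_data V W D" "x \<in> vertices (staircase V W D)"
  shows "x \<in> V" "staircase_data (V - {x}) {w \<in> W. w \<noteq> x \<and> x \<notin> D w} D"
proof -
  obtain w where w: "w \<in> W" "x \<in> V - insert w (D w)"
    using assms(2) unfolding staircase_def by blast
  then show "x \<in> V" by blast
  note d = staircase_dataD[OF assms(1)]
  show "staircase_data (V - {x}) {w \<in> W. w \<noteq> x \<and> x \<notin> D w} D"
    unfolding staircase_data_def
  proof (intro conjI ballI)
    show "{w \<in> W. w \<noteq> x \<and> x \<notin> D w} \<noteq> {}" using w by blast
    show "D v \<subseteq> V - {x} - {w \<in> W. w \<noteq> x \<and> x \<notin> D w}" if "v \<in> {w \<in> W. w \<noteq> x \<and> x \<notin> D w}" for v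
      using that d(5)[of v] by blast
    show "D v \<subseteq> D v' \<or> D v' \<subseteq> D v"
      if "v \<in> {w \<in> W. w \<noteq> x \<and> x \<notin> D w}" "v' \<in> {w \<in> W. w \<noteq> x \<and> x \<notin> D w}" for v v'
      using that d(6)[of v v'] by blast
  qed (use d in auto)
qed

lemma cdim_ge:
  assumes "fin_complex K" "s \<in> K"
  shows "int (card s) - 1 \<le> cdim K"
proof -
  have "card s \<le> Max (card ` K)" using assms(2) fin_complexD(1)[OF assms(1)] by (intro Max_ge) auto
  then show ?thesis by (simp add: cdim_def)
qed

lemma cdim_le:
  assumes "fin_complex K" "\<And>s. s \<in> K \<Longrightarrow> int (card s) - 1 \<le> d"
  shows "cdim K \<le> d"
proof -
  have "Max (card ` K) \<in> card ` K"
    using fin_complexD(1,2)[OF assms(1)] by (intro Max_in) auto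
  then obtain s where "s \<in> K" "Max (card ` K) = card s" by blast
  then show ?thesis using assms(2)[of s] by (simp add: cdim_def)
qed

lemma cdim_ge_minus_1: "- 1 \<le> cdim K"
  by (simp add: cdim_def)

lemma cdim_vlink_le:
  assumes "fin_complex K" "fin_complex (vlink v K)"
  shows "cdim (vlink v K) \<le> cdim K - 1"
proof (rule cdim_le[OF assms(2)])
  fix s assume "s \<in> vlink v K"
  then have s: "s \<in> K" "v \<notin> s" "insert v s \<in> K" by (auto simp: vlink_def)
  then show "int (card s) - 1 \<le> cdim K - 1"
    using cdim_ge[OF assms(1) s(3)] fin_complexD(3)[OF assms(1) s(1)] by simp
qed

lemma apex_insert:
  assumes "apex V W D a" "s \<in> staircase V W D"
  shows "insert a s \<in> staircase V W D"
  using assms unfolding apex_def mem_staircase_iff by (elim bexE conjE, intro bexI) auto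

lemma apex_mem:
  assumes "staircase_data V W D" "apex V W D a"
  shows "{a} \<in> staircase V W D"
  using apex_insert[OF assms(2) fin_complexD(2)[OF staircase_fin_complex[OF assms(1)]]] .

lemma ball_boundary_Pow:
  assumes "finite s" "card s = Suc k"
  shows "ball_boundary k (Pow s) = {r. r \<subset> s}"
proof
  have top: "t = s" if "t \<subseteq> s" "card t = k + 1" for t
    using card_subset_eq[OF assms(1) that(1)] assms(2) that(2) by simp
  show "ball_boundary k (Pow s) \<subseteq> {r. r \<subset> s}"
  proof
    fix r assume "r \<in> ball_boundary k (Pow s)"
    then obtain u where "u \<subseteq> s" "card u = k" "r \<subseteq> u" unfolding ball_boundary_def by blast
    moreover from this have "u \<noteq> s" using assms by auto
    ultimately show "r \<in> {r. r \<subset> s}" by blast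
  qed
  show "{r. r \<subset> s} \<subseteq> ball_boundary k (Pow s)"
  proof
    fix r assume "r \<in> {r. r \<subset> s}"
    then obtain v where v: "v \<in> s" "r \<subseteq> s - {v}" by blast
    have "\<exists>!t. t \<in> Pow s \<and> card t = k + 1 \<and> s - {v} \<subseteq> t"
      by (rule ex1I[of _ s]) (use assms top in auto)
    moreover have "card (s - {v}) = k" using assms v by simp
    ultimately show "r \<in> ball_boundary k (Pow s)"
      unfolding ball_boundary_def mem_Collect_eq using v(2) by (intro bexI[of _ "s - {v}"]) auto
  qed
qed

lemma principal_simplices_Pow: "principal_simplices (Pow s) = {s}"
  by (auto simp: principal_simplices_def)

lemma staircase_data_remove:
  assumes "staircase_data V W D" "W - {w} \<noteq> {}"
  shows "staircase_data V (W - {w}) D"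
  using assms unfolding staircase_data_def by blast

section \<open>Splitting a staircase without apex into a ball and a simplex\<close>

context
  fixes V W :: "'a set" and D w0
  assumes data: "staircase_data V W D" and w0: "w0 \<in> W"
    and V: "V = W \<union> D w0" and ne: "W - {w0} \<noteq> {}"
begin

lemma staircase_top_facet: "V - insert w0 (D w0) = W - {w0}"
  using V staircase_dataD(5)[OF data w0] by blast

lemma staircase_eq_Un: "staircase V W D = staircase V (W - {w0}) D \<union> Pow (W - {w0})"
proof -
  have "staircase V W D = staircase V (insert w0 (W - {w0})) D" using w0 by (simp add: insert_absorb)
  also have "\<dots> = Pow (V - insert w0 (D w0)) \<union> staircase V (W - {w0}) D" unfolding staircase_def by (rule UN_insert)
  finally show ?thesis unfolding staircase_top_facet by (simp only: Un_commute)
qed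

text \<open>The facet of \<open>w0\<close> is only \<open>W - {w0}\<close>, of dimension
  \<open>card W - 2\<close>, and serves as \<open>L\<close>. A proper subset of it misses some
  \<open>w\<close> in \<open>W - {w0}\<close> and, since \<open>D w\<close> avoids \<open>W\<close>,
  lies in the facet of \<open>w\<close>; so the remaining facets meet \<open>L\<close> in its whole
  boundary.\<close>

lemma staircase_ball_gluing:
  "ball_gluing (card W - 2) (staircase V W D) (staircase V (W - {w0}) D) (Pow (W - {w0}))"
proof -
  note d = staircase_dataD[OF data]
  note data' = staircase_data_remove[OF data ne]
  let ?S = "staircase V W D" and ?B = "staircase V (W - {w0}) D" and ?s = "W - {w0}"
  have card: "card ?s = Suc (card W - 2)"
  proof -
    have "card ?s = card W - 1" using w0 d(4) by simp
    moreover have "0 < card ?s" using ne d(4) by (simp add: card_gt_0_iff)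
    ultimately show ?thesis by simp
  qed
  have prin: "?s \<in> principal_simplices ?S"
    unfolding principal_simplices_staircase[OF data] using staircase_top_facet w0 by blast
  have "top_generated ?B ?S"
    unfolding top_generated_def
  proof (intro conjI)
    show "fin_complex ?B" by (rule staircase_fin_complex[OF data'])
    show "?B \<subseteq> ?S" unfolding staircase_eq_Un by blast
    show "principal_simplices ?B \<subseteq> principal_simplices ?S"
      unfolding principal_simplices_staircase[OF data] principal_simplices_staircase[OF data'] by blast
  qed
  moreover have "top_generated (Pow ?s) ?S"
    unfolding top_generated_def
  proof (intro conjI)
    show "fin_complex (Pow ?s)" using d(4) by (simp add: fin_complex_Pow)
    show "Pow ?s \<subseteq> ?S" unfolding staircase_eq_Un by blast
    show "principal_simplices (Pow ?s) \<subseteq> principal_simplices ?S"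
      using prin by (simp add: principal_simplices_Pow)
  qed
  moreover have "combinatorial_ball (card W - 2) (Pow ?s)"
    using d(4) card by (intro combinatorial_ball_Pow) auto
  moreover have "?B \<inter> Pow ?s = ball_boundary (card W - 2) (Pow ?s)"
  proof -
    have "r \<in> ?B \<longleftrightarrow> r \<noteq> ?s" if r: "r \<subseteq> ?s" for r
    proof
      show "r \<noteq> ?s" if "r \<in> ?B" using that unfolding mem_staircase_iff by blast
      assume "r \<noteq> ?s"
      then obtain w where w: "w \<in> ?s" "w \<notin> r" using r by blast
      then have "r \<inter> D w = {}" using d(5)[of w] r by blast
      then have "r \<subseteq> V - insert w (D w)" using w r d(2) by blast
      then show "r \<in> ?B" using w unfolding mem_staircase_iff by blast
    qed
    then have "?B \<inter> Pow ?s = {r. r \<subset> ?s}" by blast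
    then show ?thesis using ball_boundary_Pow[OF _ card] d(4) by simp
  qed
  ultimately show ?thesis
    unfolding ball_gluing_def using staircase_eq_Un by simp
qed

text \<open>The removed facet is as small as possible: each facet contains all of \<open>W\<close>
  but one point, so it has at least as many vertices.\<close>

lemma cdim_staircase_remove: "cdim (staircase V (W - {w0}) D) = cdim (staircase V W D)"
proof (rule antisym)
  note d = staircase_dataD[OF data]
  note data' = staircase_data_remove[OF data ne]
  note S = staircase_fin_complex[OF data] and B = staircase_fin_complex[OF data']
  show "cdim (staircase V (W - {w0}) D) \<le> cdim (staircase V W D)"
    using cdim_ge[OF S] staircase_eq_Un by (intro cdim_le[OF B]) auto
  obtain w where w: "w \<in> W" "w \<noteq> w0" using ne by blast
  let ?F = "V - insert w (D w)"
  have "W - {w} \<subseteq> ?F" using d(2) d(5)[OF w(1)] by blast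
  then have "card (W - {w}) \<le> card ?F" using d(1) by (intro card_mono) auto
  then have F: "card (W - {w0}) \<le> card ?F" using w(1) w0 d(4) by simp
  have FB: "?F \<in> staircase V (W - {w0}) D" using w by (auto simp: mem_staircase_iff)
  show "cdim (staircase V W D) \<le> cdim (staircase V (W - {w0}) D)"
  proof (rule cdim_le[OF S])
    fix s assume "s \<in> staircase V W D"
    then consider "s \<in> staircase V (W - {w0}) D" | "s \<subseteq> W - {w0}" using staircase_eq_Un by blast
    then show "int (card s) - 1 \<le> cdim (staircase V (W - {w0}) D)"
    proof cases
      case 1
      then show ?thesis by (rule cdim_ge[OF B])
    next
      case 2
      then have "card s \<le> card ?F" using F d(4) card_mono[of "W - {w0}" s] by simp
      then show ?thesis using cdim_ge[OF B FB] by simp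
    qed
  qed
qed

end

lemma staircase_max:
  assumes "staircase_data V W D"
  shows "\<exists>w0\<in>W. \<forall>w\<in>W. D w \<subseteq> D w0"
proof -
  note d = staircase_dataD[OF assms]
  have "\<exists>m\<in>D ` W. \<forall>b\<in>D ` W. m \<subseteq> b \<longrightarrow> m = b" using d(3,4) by (intro finite_has_maximal) auto
  then obtain w0 where "w0 \<in> W" "\<forall>w\<in>W. D w0 \<subseteq> D w \<longrightarrow> D w0 = D w" by auto
  then show ?thesis using d(6) by blast
qed

lemma staircase_NH_manifold:
  assumes data: "staircase_data V W D" and d: "1 \<le> cdim (staircase V W D)"
    and links: "\<And>x. x \<in> vertices (staircase V W D) \<Longrightarrow>
      (NH_ball (cdim (vlink x (staircase V W D))) (vlink x (staircase V W D)) \<and>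
        0 \<le> cdim (vlink x (staircase V W D))) \<or>
      (\<exists>k. NH_sphere (cdim (vlink x (staircase V W D))) k (vlink x (staircase V W D)))"
  shows "NH_manifold (cdim (staircase V W D)) (staircase V W D)"
proof (rule NH_manifold_NH_ball_NH_sphere.manifold[OF d])
  let ?S = "staircase V W D"
  show S: "fin_complex ?S" by (rule staircase_fin_complex[OF data])
  show "\<forall>x\<in>vertices ?S. (\<exists>i\<in>{0..cdim ?S - 1}. NH_ball i (vlink x ?S)) \<or>
      (\<exists>i\<in>{- 1..cdim ?S - 1}. \<exists>k. NH_sphere i k (vlink x ?S))"
  proof
    fix x assume x: "x \<in> vertices ?S"
    have "fin_complex (vlink x ?S)"
      unfolding vlink_staircase[OF staircase_data_link(1)[OF data x]]
      by (rule staircase_fin_complex[OF staircase_data_link(2)[OF data x]])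
    then have "cdim (vlink x ?S) \<le> cdim ?S - 1" by (rule cdim_vlink_le[OF S])
    then show "(\<exists>i\<in>{0..cdim ?S - 1}. NH_ball i (vlink x ?S)) \<or>
        (\<exists>i\<in>{- 1..cdim ?S - 1}. \<exists>k. NH_sphere i k (vlink x ?S))"
      using links[OF x] cdim_ge_minus_1[of "vlink x ?S"] by auto
  qed
qed simp

text \<open>Balls and spheres are treated together by induction on \<open>card V\<close>, since
  links have smaller \<open>V\<close>. With an apex the complex is a cone and collapses; without
  one, removing the facet with the largest \<open>D w0\<close> leaves a complex with apex
  \<open>w0\<close>.\<close>

lemma staircase_NH:
  assumes "staircase_data V W D"
  shows "apex V W D a \<Longrightarrow> NH_ball (cdim (staircase V W D)) (staircase V W D)"
    and "\<nexists>a. apex V W D a \<Longrightarrow>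
      NH_sphere (cdim (staircase V W D)) (int (card W) - 2) (staircase V W D)"
proof -
  have "(\<forall>a. apex V W D a \<longrightarrow> NH_ball (cdim (staircase V W D)) (staircase V W D)) \<and>
    ((\<nexists>a. apex V W D a) \<longrightarrow>
      NH_sphere (cdim (staircase V W D)) (int (card W) - 2) (staircase V W D))"
    using assms
  proof (induction "card V" arbitrary: V W rule: less_induct)
    case less
    have apex_cdim: "0 \<le> cdim (staircase U X D)" if "staircase_data U X D" "apex U X D a" for U X a
      using cdim_ge[OF staircase_fin_complex[OF that(1)] apex_mem[OF that]] by simp
    \<comment> \<open>Stated for every index set \<open>X\<close> over the same \<open>V\<close>:
      the sphere case uses the ball with index set \<open>W - {w0}\<close>, to which the induction
      hypothesis does not apply.\<close>
    have manifold: "NH_manifold (cdim (staircase V X D)) (staircase V X D)"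
      if X: "staircase_data V X D" "1 \<le> cdim (staircase V X D)" for X
    proof (rule staircase_NH_manifold[OF X])
      fix x assume x: "x \<in> vertices (staircase V X D)"
      note link = staircase_data_link[OF X(1) x]
      let ?X = "{w \<in> X. w \<noteq> x \<and> x \<notin> D w}"
      have "card (V - {x}) < card V"
        using link(1) staircase_dataD(1)[OF X(1)] by (intro psubset_card_mono) auto
      note IH = less.hyps[OF this link(2)]
      show "(NH_ball (cdim (vlink x (staircase V X D))) (vlink x (staircase V X D)) \<and>
          0 \<le> cdim (vlink x (staircase V X D))) \<or>
        (\<exists>k. NH_sphere (cdim (vlink x (staircase V X D))) k (vlink x (staircase V X D)))"
        unfolding vlink_staircase[OF link(1)]
      proof (cases "\<exists>a. apex (V - {x}) ?X D a")
        case True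
        then obtain a where a: "apex (V - {x}) ?X D a" by (elim exE)
        show "(NH_ball (cdim (staircase (V - {x}) ?X D)) (staircase (V - {x}) ?X D) \<and>
            0 \<le> cdim (staircase (V - {x}) ?X D)) \<or>
          (\<exists>k. NH_sphere (cdim (staircase (V - {x}) ?X D)) k (staircase (V - {x}) ?X D))"
          using IH a apex_cdim[OF link(2) a] by blast
      next
        case False
        then show "(NH_ball (cdim (staircase (V - {x}) ?X D)) (staircase (V - {x}) ?X D) \<and>
            0 \<le> cdim (staircase (V - {x}) ?X D)) \<or>
          (\<exists>k. NH_sphere (cdim (staircase (V - {x}) ?X D)) k (staircase (V - {x}) ?X D))"
          using IH by blast
      qed
    qed
    have ball: "NH_ball (cdim (staircase V X D)) (staircase V X D)"
      if X: "staircase_data V X D" and a: "apex V X D a" for X a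
    proof (cases "1 \<le> cdim (staircase V X D)")
      case True
      have "collapsible (staircase V X D)"
        by (rule cone_collapsible[OF staircase_fin_complex[OF X] apex_mem[OF X a] apex_insert[OF a]])
      then show ?thesis
        by (rule NH_manifold_NH_ball_NH_sphere.ball[OF True manifold[OF X True]])
    next
      case False
      then have 0: "cdim (staircase V X D) = 0" using apex_cdim[OF X a] by simp
      note S = staircase_fin_complex[OF X]
      have "s = {} \<or> s = {a}" if s: "s \<in> staircase V X D" for s
      proof -
        have "card (insert a s) \<le> 1" using cdim_ge[OF S apex_insert[OF a s]] 0 by simp
        moreover have "finite (insert a s)" using fin_complexD(3)[OF S s] by simp
        ultimately have "insert a s = {a}"
          using card_mono[of "insert a s" "{a}"] card_subset_eq[of "insert a s" "{a}"] by simp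
        then show ?thesis by auto
      qed
      then have "staircase V X D = {{}, {a}}"
        using apex_mem[OF X a] fin_complexD(2)[OF S] by blast
      moreover have "NH_ball 0 {{}, {a}}" by (rule NH_manifold_NH_ball_NH_sphere.ball_0)
      ultimately show ?thesis unfolding 0 by simp
    qed
    have sphere: "NH_sphere (cdim (staircase V W D)) (int (card W) - 2) (staircase V W D)"
      if no_apex: "\<nexists>a. apex V W D a"
    proof -
      note data = less.prems
      note d = staircase_dataD[OF data]
      note S = staircase_fin_complex[OF data]
      obtain w0 where w0: "w0 \<in> W" "\<forall>w\<in>W. D w \<subseteq> D w0" using staircase_max[OF data] by (elim bexE)
      then have max: "D w \<subseteq> D w0" if "w \<in> W" for w using that by blast
      have V: "V = W \<union> D w0"
      proof
        show "V \<subseteq> W \<union> D w0"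
        proof
          fix x assume "x \<in> V"
          then have "\<not> apex V W D x" using no_apex by blast
          then show "x \<in> W \<union> D w0" using \<open>x \<in> V\<close> max unfolding apex_def by blast
        qed
        show "W \<union> D w0 \<subseteq> V" using d(2) d(5)[OF w0(1)] by blast
      qed
      show ?thesis
      \<comment> \<open>A single index without apex gives the sphere of dimension -1.\<close>
      proof (cases "W - {w0} = {}")
        case True
        then have W: "W = {w0}" using w0 by blast
        then have eq: "staircase V W D = {{}}" using V unfolding staircase_def by simp
        have "cdim ({{}} :: 'a set set) = -1" by (simp add: cdim_def)
        then show ?thesis unfolding eq using W NH_manifold_NH_ball_NH_sphere.sphere_minus1 by simp
      next
        case False
        note glue = staircase_ball_gluing[OF data w0(1) V False]
        note dim = cdim_staircase_remove[OF data w0(1) V False]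
        note data' = staircase_data_remove[OF data False]
        have "apex V (W - {w0}) D w0"
          using w0(1) d(2) d(5) unfolding apex_def by blast
        note B = ball[OF data' this, unfolded dim]
        obtain w1 where w1: "w1 \<in> W" "w1 \<noteq> w0" using False by blast
        have "{w0, w1} \<subseteq> W" using w0 w1 by simp
        then have "card {w0, w1} \<le> card W" using d(4) by (intro card_mono)
        then have W2: "2 \<le> card W" using w1 by simp
        then have k: "int (card W - 2) = int (card W) - 2" by simp
        show ?thesis
        proof (cases "1 \<le> cdim (staircase V W D)")
          case True
          from NH_manifold_NH_ball_NH_sphere.sphere[OF True manifold[OF data True] B glue]
          show ?thesis by (simp only: k)
        next
          case dim0: False
          \<comment> \<open>Spheres of dimension 0 have their own rule, so here the complex has to
            be identified as two points.\<close>
          have F: "W - {w} \<in> staircase V W D" if "w \<in> W" for w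
          proof -
            have "W - {w} \<subseteq> V - insert w (D w)" using d(2) d(5)[OF that] by blast
            then show ?thesis using that unfolding mem_staircase_iff by blast
          qed
          have "int (card (W - {w0})) - 1 \<le> 0" using cdim_ge[OF S F[OF w0(1)]] dim0 by linarith
          then have "card W = 2" using W2 w0(1) d(4) by simp
          then have W: "W = {w0, w1}"
            using card_subset_eq[OF d(4) \<open>{w0, w1} \<subseteq> W\<close>] w1 by simp
          have "s = {} \<or> s = {w0} \<or> s = {w1}" if s: "s \<in> staircase V W D" for s
          proof -
            obtain w where w: "w \<in> W" "s \<subseteq> V - insert w (D w)"
              using s unfolding mem_staircase_iff by (elim bexE)
            have "V - insert w (D w) \<in> staircase V W D" using w(1) by (auto simp: mem_staircase_iff)
            then have "card (V - insert w (D w)) \<le> 1" using cdim_ge[OF S] dim0 by fastforce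
            moreover have sub: "W - {w} \<subseteq> V - insert w (D w)" using d(2) d(5)[OF w(1)] by blast
            moreover have "card (W - {w}) = 1" using \<open>card W = 2\<close> w(1) d(4) by simp
            ultimately have "W - {w} = V - insert w (D w)"
              using d(1) by (intro card_seteq) auto
            then have "s \<subseteq> W - {w}" using w by blast
            then show ?thesis using W w(1) w1(2) by blast
          qed
          moreover have "{w0} \<in> staircase V W D" "{w1} \<in> staircase V W D"
          proof -
            have "W - {w1} = {w0}" "W - {w0} = {w1}" using W w1(2) by auto
            then show "{w0} \<in> staircase V W D" "{w1} \<in> staircase V W D" using F[of w1] F[of w0] w0 w1 by auto
          qed
          ultimately have eq: "staircase V W D = {{}, {w0}, {w1}}"
            using fin_complexD(2)[OF S] by blast
          have "cdim (staircase V W D) = 0"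
            using cdim_ge[OF S \<open>{w0} \<in> staircase V W D\<close>] dim0 by simp
          then show ?thesis
            using NH_manifold_NH_ball_NH_sphere.sphere_0[of w0 w1] w1(2) \<open>card W = 2\<close> eq by simp
        qed
      qed
    qed
    show ?case using ball[OF less.prems] sphere by blast
  qed
  then show "apex V W D a \<Longrightarrow> NH_ball (cdim (staircase V W D)) (staircase V W D)"
    and "\<nexists>a. apex V W D a \<Longrightarrow>
      NH_sphere (cdim (staircase V W D)) (int (card W) - 2) (staircase V W D)" by blast+
qed

text \<open>The sphere arises by attaching the simplex on \<open>W\<close>: the apex
  \<open>a\<close> becomes a new index, and \<open>D' a\<close> takes all points of \<open>V\<close>
  outside \<open>insert a W\<close>. Then no apex is left, and removing the facet of
  \<open>a\<close>, which is \<open>W\<close>, gives back the ball.\<close>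

lemma staircase_minimal_NH_ball:
  assumes data: "staircase_data V W D" and a: "apex V W D a"
  shows "minimal_NH_ball (staircase V W D)"
proof -
  define D' where "D' = D(a := V - W - {a})"
  let ?W = "insert a W"
  note d = staircase_dataD[OF data]
  have aV: "a \<in> V" "a \<notin> W" "\<And>w. w \<in> W \<Longrightarrow> a \<notin> D w" using a by (auto simp: apex_def)
  have Da: "D' a = V - W - {a}" and Dw: "w \<in> W \<Longrightarrow> D' w = D w" for w using aV by (auto simp: D'_def)
  have le: "D' w \<subseteq> D' a" if "w \<in> ?W" for w
    using that Da Dw d(5) aV(3) by (cases "w = a") (auto, blast+)
  have data': "staircase_data V ?W D'"
    unfolding staircase_data_def
  proof (intro conjI ballI)
    show "finite V" "?W \<subseteq> V" "?W \<noteq> {}" using d aV by auto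
    show "D' w \<subseteq> V - ?W" if "w \<in> ?W" for w using le[OF that] Da by blast
    show "D' w \<subseteq> D' w' \<or> D' w' \<subseteq> D' w" if "w \<in> ?W" "w' \<in> ?W" for w w'
    proof (cases "w = a \<or> w' = a")
      case True
      then show ?thesis using le that by blast
    next
      case False
      then show ?thesis using that Dw d(6)[of w w'] by simp
    qed
  qed
  have V: "V = ?W \<union> D' a" using Da aV d(2) by blast
  have Wa: "?W - {a} = W" using aV by simp
  have ne: "?W - {a} \<noteq> {}" using Wa d(3) by simp
  have eq: "staircase V W D' = staircase V W D"
    unfolding staircase_def using Dw by simp
  have glue: "ball_gluing (card ?W - 2) (staircase V ?W D') (staircase V W D) (Pow W)"
    using staircase_ball_gluing[OF data' insertI1 V ne] unfolding Wa eq .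
  have dim: "cdim (staircase V ?W D') = cdim (staircase V W D)"
    using cdim_staircase_remove[OF data' insertI1 V ne] unfolding Wa eq by (rule sym)
  have "\<nexists>b. apex V ?W D' b"
  proof
    assume "\<exists>b. apex V ?W D' b"
    then obtain b where b: "b \<in> V" "b \<notin> ?W" "b \<notin> D' a" by (auto simp: apex_def)
    then show False using V by blast
  qed
  then have sph: "NH_sphere (cdim (staircase V W D)) (int (card ?W) - 2) (staircase V ?W D')"
    unfolding dim[symmetric] by (rule staircase_NH(2)[OF data'])
  have "card W > 0" using d(3,4) by (simp add: card_gt_0_iff)
  then have k: "int (card ?W) - 2 = int (card ?W - 2)" using aV(2) d(4) by simp
  have "minimal_NH_sphere (cdim (staircase V W D)) (int (card ?W - 2)) (staircase V ?W D')"
    unfolding minimal_NH_sphere_def num_principal_staircase[OF data']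
  proof
    show "NH_sphere (cdim (staircase V W D)) (int (card ?W - 2)) (staircase V ?W D')"
      by (subst k[symmetric]) (rule sph)
    show "int (card ?W) = int (card ?W - 2) + 2" using k by linarith
  qed
  then show ?thesis
    unfolding minimal_NH_ball_def using staircase_NH(1)[OF data a] glue by blast
qed

section \<open>Alexander duals of staircase complexes\<close>

definition conical_staircase :: "'a set set \<Rightarrow> bool" where
  "conical_staircase K \<longleftrightarrow>
     (\<exists>V W D a. staircase_data V W D \<and> apex V W D a \<and> K = staircase V W D)"

text \<open>The nonfaces of the dual are the sets containing some \<open>T \<union> {w} \<union> D w\<close>, so the complements of
  its facets are the minimal sets meeting all of these: the points of \<open>T\<close>, the sets
  \<open>{x} \<union> {w. x \<notin> D w}\<close> with \<open>x\<close> in some \<open>D w\<close>, and \<open>W\<close>.\<close>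

lemma alexander_dual_staircase:
  assumes data: "staircase_data V W D" and a: "apex V W D a" and T: "finite T" "T \<inter> V = {}"
  shows "conical_staircase (alexander_dual (V \<union> T) (staircase V W D))"
proof -
  note d = staircase_dataD[OF data]
  obtain m where m: "m \<in> W" "\<forall>w\<in>W. D w \<subseteq> D m" using staircase_max[OF data] by (elim bexE)
  \<comment> \<open>\<open>m\<close> is the index of the dual facet with complement
    \<open>W\<close>, and a point of \<open>T\<close> that of the facet missing only this point. The
    other indices come from \<open>D m\<close>, the union of all \<open>D w\<close>.\<close>
  define W' where "W' = insert m (D m \<union> T)"
  define D' where "D' x = (if x = m then W - {m} else if x \<in> T then {} else {w \<in> W. x \<notin> D w})" for x
  have Dm: "D m \<subseteq> V - W" by (rule d(5)[OF m(1)])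
  have mT: "m \<notin> T" using m(1) d(2) T by blast
  have D'm: "D' m = W - {m}" by (simp add: D'_def)
  have D'T: "D' x = {}" if "x \<in> T" for x using that mT by (auto simp: D'_def)
  have D'D: "D' x = {w \<in> W. x \<notin> D w}" if "x \<in> D m" for x
  proof -
    have "x \<noteq> m" "x \<notin> T" using that Dm m(1) T by blast+
    then show ?thesis by (simp add: D'_def)
  qed
  have D'le: "D' x \<subseteq> W - {m}" if x: "x \<in> W'" for x
  proof -
    consider "x = m" | "x \<in> T" | "x \<in> D m" using x by (auto simp: W'_def)
    then show ?thesis
    proof cases
      case 3
      then show ?thesis using D'D[OF 3] by blast
    qed (use D'm D'T in auto)
  qed
  have data': "staircase_data (V \<union> T) W' D'"
    unfolding staircase_data_def
  proof (intro conjI ballI)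
    show "finite (V \<union> T)" using d(1) T by simp
    show "W' \<subseteq> V \<union> T" unfolding W'_def using Dm m(1) d(2) by blast
    show "W' \<noteq> {}" by (simp add: W'_def)
    have "W' \<inter> (W - {m}) = {}" unfolding W'_def using Dm d(2) T by blast
    then show "D' x \<subseteq> V \<union> T - W'" if "x \<in> W'" for x using D'le[OF that] d(2) by blast
    show "D' x \<subseteq> D' y \<or> D' y \<subseteq> D' x" if xy: "x \<in> W'" "y \<in> W'" for x y
    proof (cases "x \<in> D m \<and> y \<in> D m")
      case True
      show ?thesis
      proof (rule ccontr)
        assume "\<not> ?thesis"
        \<comment> \<open>Incomparable \<open>D' x\<close> and \<open>D' y\<close> would give
          indices \<open>u\<close> and \<open>v\<close> with \<open>D u\<close> and
          \<open>D v\<close> incomparable.\<close>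
        then obtain u v where "u \<in> D' x" "u \<notin> D' y" "v \<in> D' y" "v \<notin> D' x" by blast
        then have "u \<in> W" "v \<in> W" "x \<notin> D u" "y \<in> D u" "y \<notin> D v" "x \<in> D v"
          using D'D[of x] D'D[of y] True by auto
        then show False using d(6)[of u v] by blast
      qed
    next
      case False
      then consider "x = m" | "x \<in> T" | "y = m" | "y \<in> T" using xy by (auto simp: W'_def)
      then show ?thesis using D'le[OF xy(1)] D'le[OF xy(2)] D'm D'T by cases auto
    qed
  qed
  have "apex (V \<union> T) W' D' a"
    unfolding apex_def
  proof (intro conjI ballI)
    have aV: "a \<in> V" "a \<notin> W" "a \<notin> D m" using a m(1) by (auto simp: apex_def)
    then show "a \<in> V \<union> T" "a \<notin> W'" using m(1) T by (auto simp: W'_def)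
    show "a \<notin> D' x" if "x \<in> W'" for x using D'le[OF that] aV by blast
  qed
  moreover have "alexander_dual (V \<union> T) (staircase V W D) = staircase (V \<union> T) W' D'"
  proof (rule set_eqI)
    fix s
    let ?c = "V \<union> T - s"
    show "s \<in> alexander_dual (V \<union> T) (staircase V W D) \<longleftrightarrow> s \<in> staircase (V \<union> T) W' D'"
    proof (cases "s \<subseteq> V \<union> T")
      case sub: True
      have hit: "s \<in> alexander_dual (V \<union> T) (staircase V W D) \<longleftrightarrow>
          (\<forall>w\<in>W. \<exists>x\<in>?c. x \<in> T \<or> x = w \<or> x \<in> D w)"
        unfolding alexander_dual_def mem_Collect_eq mem_staircase_iff using sub T by blast
      have facet: "s \<in> staircase (V \<union> T) W' D' \<longleftrightarrow> (\<exists>x\<in>W'. insert x (D' x) \<inter> s = {})"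
        unfolding mem_staircase_iff using sub by blast
      show ?thesis
        unfolding hit facet
      proof
        assume L: "\<forall>w\<in>W. \<exists>x\<in>?c. x \<in> T \<or> x = w \<or> x \<in> D w"
        show "\<exists>x\<in>W'. insert x (D' x) \<inter> s = {}"
        proof (cases "?c \<inter> T = {}")
          case False
          then obtain t where "t \<in> T" "t \<notin> s" by blast
          then show ?thesis using D'T by (intro bexI[of _ t]) (auto simp: W'_def)
        next
          case noT: True
          show ?thesis
          proof (cases "W \<inter> s = {}")
            case True
            then show ?thesis using D'm m(1) by (intro bexI[of _ m]) (auto simp: W'_def)
          next
            case False
            \<comment> \<open>For \<open>w\<close> with smallest \<open>D w\<close> among the points
              of \<open>W\<close> in \<open>s\<close>, a point \<open>x\<close> of
              \<open>D w\<close> outside \<open>s\<close> lies in \<open>D v\<close> for all these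
              \<open>v\<close>, so \<open>s\<close> misses \<open>D' x\<close>.\<close>
            have "\<exists>n\<in>D ` (W \<inter> s). \<forall>b\<in>D ` (W \<inter> s). b \<subseteq> n \<longrightarrow> n = b"
              using False d(4) by (intro finite_has_minimal) auto
            then obtain w where w: "w \<in> W \<inter> s" "\<forall>v\<in>W \<inter> s. D v \<subseteq> D w \<longrightarrow> D w = D v" by auto
            then obtain x where x: "x \<in> ?c" "x \<in> D w" using L noT by blast
            have "D' x \<inter> s = {}"
            proof (rule ccontr)
              assume "D' x \<inter> s \<noteq> {}"
              then obtain v where v: "v \<in> W" "x \<notin> D v" "v \<in> s" using D'D[of x] x m(2) w(1) by blast
              then have "D v \<subseteq> D w" using d(6)[of v w] w(1) x by blast
              then show False using w(2) v x by blast
            qed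
            moreover have "x \<in> W'" using x m(2) w(1) by (auto simp: W'_def)
            ultimately show ?thesis using x by (intro bexI[of _ x]) auto
          qed
        qed
      next
        assume "\<exists>x\<in>W'. insert x (D' x) \<inter> s = {}"
        then obtain x where x: "x \<in> W'" "insert x (D' x) \<inter> s = {}" by (elim bexE)
        have xc: "x \<in> ?c" using x staircase_dataD(2)[OF data'] by blast
        consider "x = m" | "x \<in> T" | "x \<in> D m" using x by (auto simp: W'_def)
        then show "\<forall>w\<in>W. \<exists>x\<in>?c. x \<in> T \<or> x = w \<or> x \<in> D w"
        proof cases
          case 1
          then have "W \<subseteq> ?c" using x D'm d(2) by blast
          then show ?thesis by blast
        next
          case 2
          then show ?thesis using xc by blast
        next
          case 3
          show ?thesis
          proof
            fix w assume w: "w \<in> W"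
            show "\<exists>x\<in>?c. x \<in> T \<or> x = w \<or> x \<in> D w"
            proof (cases "x \<in> D w")
              case True
              then show ?thesis using xc by blast
            next
              case False
              then have "w \<in> ?c" using w x(2) D'D[OF 3] d(2) by blast
              then show ?thesis by blast
            qed
          qed
        qed
      qed
    next
      case False
      then show ?thesis by (auto simp: alexander_dual_def mem_staircase_iff)
    qed
  qed
  ultimately show ?thesis using data' unfolding conical_staircase_def by blast
qed

text \<open>Relative duals are taken over the vertex set, which may be smaller than
  \<open>V\<close>. With two or more facets every point of \<open>W\<close> is a vertex, and the
  sets \<open>D w\<close> can be cut down to vertices. With one facet its index is no vertex and the
  complex is a simplex, which is kept as a separate case.\<close>

lemma conical_staircase_on_vertices:
  assumes "conical_staircase K"
  shows "(\<exists>W D a. staircase_data (\<Union>K) W D \<and> apex (\<Union>K) W D a \<and> K = staircase (\<Union>K) W D) \<or>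
    (\<exists>N. N \<noteq> {} \<and> finite N \<and> K = Pow N)"
proof -
  obtain V W D a where data: "staircase_data V W D" and a: "apex V W D a" and K: "K = staircase V W D"
    using assms unfolding conical_staircase_def by (elim exE conjE)
  note d = staircase_dataD[OF data]
  obtain w where w: "w \<in> W" using d(3) by blast
  show ?thesis
  proof (cases "W = {w}")
    case True
    then have "K = Pow (V - insert w (D w))" by (simp add: K staircase_def)
    moreover have "a \<in> V - insert w (D w)" using a w by (auto simp: apex_def)
    then have "V - insert w (D w) \<noteq> {}" by force
    ultimately show ?thesis using d(1) by (intro disjI2 exI[of _ "V - insert w (D w)"]) simp
  next
    case False
    then obtain w' where w': "w' \<in> W" "w' \<noteq> w" using w by blast
    let ?U = "\<Union>K"
    define D' where "D' v = D v \<inter> ?U" for v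
    have mem: "x \<in> ?U \<longleftrightarrow> (\<exists>v\<in>W. x \<in> V - insert v (D v))" for x
      unfolding K staircase_def by blast
    have UV: "?U \<subseteq> V" using mem by blast
    have WU: "W \<subseteq> ?U"
    proof
      fix v assume v: "v \<in> W"
      obtain v' where v': "v' \<in> W" "v' \<noteq> v" using w w' by blast
      then have "v \<in> V - insert v' (D v')" using mem_staircase_facet_iff[OF data v'(1) v] by blast
      then show "v \<in> ?U" using mem v'(1) by blast
    qed
    have "staircase_data ?U W D'"
      unfolding staircase_data_def
    proof (intro conjI ballI)
      show "finite ?U" by (rule finite_subset[OF UV d(1)])
      show "D' v \<subseteq> ?U - W" if "v \<in> W" for v using d(5)[OF that] unfolding D'_def by blast
      show "D' u \<subseteq> D' v \<or> D' v \<subseteq> D' u" if "u \<in> W" "v \<in> W" for u v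
        using d(6)[OF that] unfolding D'_def by blast
    qed (use WU d(3) in auto)
    moreover have "apex ?U W D' a"
    proof -
      have "{a} \<in> K" using apex_mem[OF data a] K by simp
      then show ?thesis using a unfolding apex_def D'_def by blast
    qed
    moreover have "K = staircase ?U W D'"
    proof (rule set_eqI)
      fix r
      show "r \<in> K \<longleftrightarrow> r \<in> staircase ?U W D'"
      proof
        assume r: "r \<in> K"
        then obtain v where v: "v \<in> W" "r \<subseteq> V - insert v (D v)"
          unfolding K mem_staircase_iff by (elim bexE)
        have "r \<subseteq> ?U" using r by blast
        then have "r \<subseteq> ?U - insert v (D' v)" using v unfolding D'_def by blast
        then show "r \<in> staircase ?U W D'" using v(1) unfolding mem_staircase_iff by (rule bexI)
      next
        assume "r \<in> staircase ?U W D'"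
        then obtain v where v: "v \<in> W" "r \<subseteq> ?U - insert v (D' v)"
          unfolding mem_staircase_iff by (elim bexE)
        then have "r \<subseteq> V - insert v (D v)" using UV unfolding D'_def by blast
        then show "r \<in> K" using v(1) unfolding K mem_staircase_iff by (rule bexI)
      qed
    qed
    ultimately show ?thesis by blast
  qed
qed

lemma conical_staircase_dual_rel:
  assumes K: "conical_staircase K" and T: "finite T" "T \<inter> \<Union>K = {}"
    and not_simplex: "\<not> (T = {} \<and> (\<exists>V. V \<noteq> {} \<and> K = Pow V))"
  shows "conical_staircase (dual_rel K T)"
  using conical_staircase_on_vertices[OF K]
proof (elim disjE exE conjE)
  fix W D a assume *: "staircase_data (\<Union>K) W D" "apex (\<Union>K) W D a" and "K = staircase (\<Union>K) W D"
  then show ?thesis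
    using alexander_dual_staircase[OF * T] unfolding dual_rel_def by simp
next
  fix N assume N: "N \<noteq> {}" "finite N" "K = Pow N"
  then have ne: "T \<noteq> {}" using not_simplex by blast
  have UK: "\<Union>K = N" using N by simp
  have TN: "T \<inter> N = {}" using T UK by simp
  obtain a where a: "a \<in> N" using N by blast
  \<comment> \<open>The dual of the simplex \<open>N\<close> is the join of \<open>N\<close> with
    the boundary of the simplex \<open>T\<close>: each facet leaves out one point of
    \<open>T\<close>.\<close>
  let ?D = "\<lambda>_::'a. {} :: 'a set"
  have "staircase_data (N \<union> T) T ?D" using N T ne by (auto simp: staircase_data_def)
  moreover have "apex (N \<union> T) T ?D a" using a TN by (auto simp: apex_def)
  moreover have "dual_rel K T = staircase (N \<union> T) T ?D"
  proof (rule set_eqI)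
    fix s
    show "s \<in> dual_rel K T \<longleftrightarrow> s \<in> staircase (N \<union> T) T ?D"
      unfolding dual_rel_def alexander_dual_def UK mem_Collect_eq mem_staircase_iff
      unfolding N(3) Pow_iff using TN by blast
  qed
  ultimately show ?thesis unfolding conical_staircase_def by blast
qed

section \<open>Minimal NH-balls are conical staircases\<close>

lemma NH_manifold_fin_complex: "NH_manifold d M \<Longrightarrow> fin_complex M"
  by (erule NH_manifold.cases) simp_all

lemma NH_ball_fin_complex: "NH_ball d B \<Longrightarrow> fin_complex B"
  by (erule NH_ball.cases) (auto simp: fin_complex_def dest: NH_manifold_fin_complex[unfolded fin_complex_def])

lemma NH_ball_acyclic:
  assumes "NH_ball d B"
  shows "acyclic_complex B"
  using assms
proof (cases rule: NH_ball.cases)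
  case (ball_0 v)
  show ?thesis unfolding ball_0 by (rule acyclic_cone[of _ v]) (auto simp: fin_complex_def)
next
  case ball
  then show ?thesis by (intro collapsible_imp_acyclic NH_ball_fin_complex[OF assms])
qed

text \<open>Links of balls can be spheres and links of spheres can be balls; the union of both
  classes, with dimensions forgotten, is closed under vertex links.\<close>

definition NH_ball_or_sphere :: "'a set set \<Rightarrow> bool" where
  "NH_ball_or_sphere X \<longleftrightarrow> (\<exists>d. NH_ball d X) \<or> (\<exists>d k. NH_sphere d k X)"

lemma ball_gluing_fin_complex:
  assumes "ball_gluing k S B L"
  shows "fin_complex S"
proof -
  have B: "fin_complex B" and L: "fin_complex L" and S: "S = B \<union> L"
    using assms by (auto simp: ball_gluing_def top_generated_def)
  show ?thesis
    unfolding S fin_complex_def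
    using fin_complexD(1-3)[OF B] fin_complexD(1,3)[OF L] fin_complexD(4)[OF B] fin_complexD(4)[OF L]
    by (intro conjI ballI allI impI) auto
qed

lemma NH_sphere_fin_complex: "NH_sphere d k S \<Longrightarrow> fin_complex S"
  by (erule NH_sphere.cases)
     (auto simp: fin_complex_def dest: NH_manifold_fin_complex[unfolded fin_complex_def])

lemma NH_ball_or_sphere_fin_complex: "NH_ball_or_sphere X \<Longrightarrow> fin_complex X"
  unfolding NH_ball_or_sphere_def using NH_ball_fin_complex NH_sphere_fin_complex by blast

lemma NH_manifold_link:
  assumes "NH_manifold d M" "1 \<le> d" "v \<in> vertices M"
  shows "NH_ball_or_sphere (vlink v M)"
  using assms(1)
proof (cases rule: NH_manifold.cases)
  case manifold_0
  then show ?thesis using assms(2) by simp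
next
  case manifold
  then show ?thesis using assms(3) unfolding NH_ball_or_sphere_def by blast
qed

lemma NH_ball_or_sphere_link:
  assumes "NH_ball_or_sphere X" "v \<in> vertices X"
  shows "NH_ball_or_sphere (vlink v X)"
proof -
  have pt: "NH_ball_or_sphere {{}}"
    unfolding NH_ball_or_sphere_def using NH_manifold_NH_ball_NH_sphere.sphere_minus1 by blast
  consider d where "NH_ball d X" | d k where "NH_sphere d k X"
    using assms(1) unfolding NH_ball_or_sphere_def by blast
  then show ?thesis
  proof cases
    case (1 d)
    then show ?thesis
    proof (cases rule: NH_ball.cases)
      case (ball_0 u)
      then have "vlink v X = {{}}" using assms(2) by (auto simp: vlink_def)
      then show ?thesis using pt by simp
    next
      case ball
      show ?thesis by (rule NH_manifold_link[OF ball(2) ball(1) assms(2)])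
    qed
  next
    case (2 d k)
    then show ?thesis
    proof (cases rule: NH_sphere.cases)
      case sphere_minus1
      then show ?thesis using assms(2) by simp
    next
      case (sphere_0 u w)
      then have "vlink v X = {{}}" using assms(2) by (auto simp: vlink_def)
      then show ?thesis using pt by simp
    next
      case (sphere B k' L)
      show ?thesis by (rule NH_manifold_link[OF sphere(3) sphere(2) assms(2)])
    qed
  qed
qed

section \<open>Facets and decompositions of spheres\<close>

lemma simplex_in_principal:
  assumes "fin_complex K" "s \<in> K"
  shows "\<exists>p\<in>principal_simplices K. s \<subseteq> p"
proof -
  have "\<exists>m\<in>K. s \<subseteq> m \<and> (\<forall>b\<in>K. m \<subseteq> b \<longrightarrow> m = b)"
    by (rule finite_has_maximal2[OF fin_complexD(1)[OF assms(1)] assms(2)])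
  then obtain m where "m \<in> K" "s \<subseteq> m" "\<forall>b\<in>K. m \<subseteq> b \<longrightarrow> m = b" by (elim bexE conjE)
  then show ?thesis by (intro bexI[of _ m]) (auto simp: principal_simplices_def)
qed

lemma principal_simplicesD:
  "p \<in> principal_simplices K \<Longrightarrow> p \<in> K"
  "p \<in> principal_simplices K \<Longrightarrow> t \<in> K \<Longrightarrow> p \<subseteq> t \<Longrightarrow> t = p"
  by (auto simp: principal_simplices_def)

lemma generated_by_principal:
  assumes "fin_complex K"
  shows "K = generated_by (principal_simplices K) (\<lambda>p. p)"
proof
  show "K \<subseteq> generated_by (principal_simplices K) (\<lambda>p. p)"
    using simplex_in_principal[OF assms] unfolding generated_by_def by blast
  show "generated_by (principal_simplices K) (\<lambda>p. p) \<subseteq> K"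
    unfolding generated_by_def
    using fin_complexD(4)[OF assms] principal_simplicesD(1) by (metis PowD UN_E subsetI)
qed

text \<open>Simplices in the boundary of \<open>L\<close> have at most \<open>k\<close> vertices, so
  a \<open>k\<close>-simplex of \<open>L\<close> is outside \<open>B\<close>; being of top dimension
  it is principal in \<open>L\<close>, hence in \<open>S\<close>. It detects the nonbounding cycle
  and supplies a facet of \<open>S\<close> outside \<open>B\<close>.\<close>

lemma ball_gluing_top_simplex:
  assumes "ball_gluing k S B L"
  obtains s where "s \<in> L" "card s = Suc k" "s \<notin> B" "s \<in> principal_simplices L" "s \<in> principal_simplices S"
proof -
  have gl: "top_generated L S" "combinatorial_ball k L" "B \<inter> L = ball_boundary k L"
    using assms by (auto simp: ball_gluing_def)
  have L: "fin_complex L" using gl(1) by (simp add: top_generated_def)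
  obtain s where s: "s \<in> L" "card s = Suc k" using combinatorial_ball_structure(1)[OF gl(2)] by blast
  have "s \<notin> B"
  proof
    assume "s \<in> B"
    then have "s \<in> ball_boundary k L" using s gl(3) by blast
    then obtain u where u: "u \<in> L" "card u = k" "s \<subseteq> u" unfolding ball_boundary_def by blast
    then have "card s \<le> k" using card_mono[OF fin_complexD(3)[OF L u(1)] u(3)] by simp
    then show False using s by simp
  qed
  moreover have sp: "s \<in> principal_simplices L"
    unfolding principal_simplices_def
  proof (intro CollectI conjI s(1) notI)
    assume "\<exists>t\<in>L. s \<subset> t"
    then obtain t where t: "t \<in> L" "s \<subset> t" by blast
    then have "card s < card t" using psubset_card_mono[OF fin_complexD(3)[OF L t(1)]] by blast
    then show False using combinatorial_ball_structure(2)[OF gl(2) t(1)] s(2) by simp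
  qed
  moreover have "s \<in> principal_simplices S" using sp gl(1) by (auto simp: top_generated_def)
  ultimately show thesis using that s by blast
qed

text \<open>The top-dimensional simplices of \<open>L\<close> lie in no larger simplex of \<open>S\<close>, so the cycle made of
  them and of a chain in \<open>B\<close> filling the boundary of \<open>L\<close> does not bound.\<close>

lemma ball_gluing_not_acyclic:
  assumes glue: "ball_gluing k S B L" and B: "fin_complex B" "acyclic_complex B"
  shows "\<not> acyclic_in (Suc k) S"
proof
  assume ac: "acyclic_in (Suc k) S"
  have gl: "top_generated L S" "combinatorial_ball k L" "B \<union> L = S" "B \<inter> L = ball_boundary k L"
    using glue by (auto simp: ball_gluing_def)
  have L: "fin_complex L" using gl(1) by (simp add: top_generated_def)
  define c where "c = {s \<in> L. card s = Suc k}"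
  have cL: "c \<subseteq> L" "finite c" "\<And>s. s \<in> c \<Longrightarrow> finite s" "\<forall>s\<in>c. card s = Suc k"
    using fin_complexD(1,3)[OF L] by (auto simp: c_def)
  have bdc: "r \<in> B \<and> card r = k" if r: "r \<in> bd c" for r
  proof -
    obtain x where x: "x \<in> c" "r \<in> faces x" using r lin_subset[of faces c] by blast
    have rL: "r \<in> L" using x cL(1) fin_complex_faces[OF L] by blast
    have rk: "card r = k" using mem_faces_card[OF x(2) cL(3)[OF x(1)]] x(1) by (simp add: c_def)
    let ?A = "{s \<in> L. card s = Suc k \<and> r \<subseteq> s}"
    have "{s \<in> c. r \<in> faces s} = ?A"
    proof
      show "{s \<in> c. r \<in> faces s} \<subseteq> ?A" using mem_faces_subset by (auto simp: c_def)
      show "?A \<subseteq> {s \<in> c. r \<in> faces s}"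
      proof
        fix s assume s: "s \<in> ?A"
        then have "s \<in> c" by (simp add: c_def)
        moreover have "r \<in> faces s"
          using s rk cL(3)[OF \<open>s \<in> c\<close>] by (intro card_Suc_imp_mem_faces) auto
        ultimately show "s \<in> {s \<in> c. r \<in> faces s}" by simp
      qed
    qed
    then have "odd (card ?A)" using r by (simp add: lin_def)
    moreover have "card ?A \<le> 2" by (rule combinatorial_ball_structure(3)[OF gl(2) rL rk])
    \<comment> \<open>An odd number of top simplices contain \<open>r\<close>, and at most two do;
      exactly one coface means that \<open>r\<close> is in \<open>ball_boundary k L\<close>, which
      lies in \<open>B\<close>.\<close>
    ultimately have "card ?A = 1" by presburger
    then obtain t where "?A = {t}" by (rule card_1_singletonE)
    then have t: "t \<in> ?A" "\<And>s. s \<in> ?A \<Longrightarrow> s = t" by blast+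
    have "\<exists>!t. t \<in> L \<and> card t = k + 1 \<and> r \<subseteq> t"
    proof (rule ex1I[of _ t])
      show "t \<in> L \<and> card t = k + 1 \<and> r \<subseteq> t" using t(1) by simp
      show "s = t" if "s \<in> L \<and> card s = k + 1 \<and> r \<subseteq> s" for s using t(2)[of s] that by simp
    qed
    then have "r \<in> ball_boundary k L"
      unfolding ball_boundary_def mem_Collect_eq using rL rk by (intro bexI[of _ r] conjI) auto
    then show ?thesis using gl(4) rk by blast
  qed
  have "bd c \<subseteq> B" "\<forall>r\<in>bd c. card r = k" using bdc by blast+
  moreover have "bd (bd c) = {}" by (rule bd_bd[OF cL(2,3)])
  ultimately obtain e where e: "e \<subseteq> B" "\<forall>s\<in>e. card s = Suc k" "bd e = bd c"
    by (rule acyclic_inE[OF acyclic_complex_imp_acyclic_in[OF B]])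
  have fine: "finite e" by (rule finite_subset[OF e(1) fin_complexD(1)[OF B(1)]])
  let ?z = "sym_diff c e"
  have "?z \<subseteq> S" using e(1) cL(1) gl(3) by blast
  moreover have "\<forall>s\<in>?z. card s = Suc k" using e(2) cL(4) by blast
  moreover have "bd ?z = {}" using lin_sym_diff[OF cL(2) fine, of faces] e(3) by simp
  ultimately obtain y where y: "y \<subseteq> S" "\<forall>s\<in>y. card s = Suc (Suc k)" "bd y = ?z"
    by (rule acyclic_inE[OF ac])
  obtain s where s: "s \<in> L" "card s = Suc k" "s \<notin> B" "s \<in> principal_simplices S"
    using glue by (rule ball_gluing_top_simplex)
  have "s \<in> bd y" unfolding y(3) using s e(1) by (auto simp: c_def)
  then obtain t where t: "t \<in> y" "s \<in> faces t" using lin_subset[of faces y] by blast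
  have "t = s" using principal_simplicesD(2)[OF s(4)] t y(1) mem_faces_subset by blast
  then show False using t y(2) s(2) by auto
qed

text \<open>Points \<open>x\<close> and \<open>y\<close> of the two simplices form a cycle. If it
  bounded, the edges inside \<open>F\<close> alone would have boundary \<open>{{x}}\<close>, whose
  own boundary is the empty simplex and not zero.\<close>

lemma acyclic_disjoint_simplices:
  assumes "finite F" "finite F'" "F \<inter> F' = {}" "F \<noteq> {}" "F' \<noteq> {}"
  shows "\<not> acyclic_in 1 (Pow F \<union> Pow F')"
proof
  assume ac: "acyclic_in 1 (Pow F \<union> Pow F')"
  obtain x y where xy: "x \<in> F" "y \<in> F'" using assms by blast
  then have "x \<noteq> y" using assms(3) by blast
  have fxy: "faces {x} = {{}}" "faces {y} = {{}}" by (auto simp: faces_def)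
  have "bd {{x}, {y}} = sym_diff (faces {x}) (bd {{y}})" using \<open>x \<noteq> y\<close> by (subst lin_insert) auto
  then have "bd {{x}, {y}} = {}" using fxy by simp
  moreover have "{{x}, {y}} \<subseteq> Pow F \<union> Pow F'" "\<forall>s\<in>{{x}, {y}}. card s = 1" using xy by auto
  ultimately obtain c where c: "c \<subseteq> Pow F \<union> Pow F'" "\<forall>s\<in>c. card s = Suc 1" "bd c = {{x}, {y}}"
    using acyclic_inE[OF ac] by metis
  define d where "d = {e \<in> c. e \<subseteq> F}"
  have find: "finite d" "\<And>s. s \<in> d \<Longrightarrow> finite s"
    using assms(1) finite_subset[of d "Pow F"] by (auto simp: d_def intro: finite_subset)
  have "r \<in> bd d \<longleftrightarrow> r = {x}" for r
  proof (cases "\<exists>v\<in>F. r = {v}")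
    case True
    then obtain v where v: "v \<in> F" "r = {v}" by blast
    have "{e \<in> d. r \<in> faces e} = {e \<in> c. r \<in> faces e}"
    proof -
      have "e \<subseteq> F" if "e \<in> c" "r \<in> faces e" for e
      proof -
        have "v \<in> e" using mem_faces_subset[OF that(2)] v by simp
        then show ?thesis using that(1) c(1) v(1) assms(3) by blast
      qed
      then show ?thesis by (auto simp: d_def)
    qed
    then have "r \<in> bd d \<longleftrightarrow> r \<in> bd c" by (simp add: lin_def)
    also have "\<dots> \<longleftrightarrow> r = {x}" using c(3) v assms(3) xy by auto
    finally show ?thesis .
  next
    case False
    have "r \<notin> bd d"
    proof
      assume "r \<in> bd d"
      then obtain e where e: "e \<in> d" "r \<in> faces e" using lin_subset[of faces d] by blast
      then have "card e = 2" "e \<subseteq> F" "finite e" using c(2) find by (auto simp: d_def)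
      then have "card r = 1" using mem_faces_card[OF e(2)] by simp
      then obtain v where "r = {v}" by (rule card_1_singletonE)
      then show False using False mem_faces_subset[OF e(2)] \<open>e \<subseteq> F\<close> by blast
    qed
    then show ?thesis using False xy by auto
  qed
  then have "bd d = {{x}}" by blast
  then have "bd (bd d) = {{}}" using fxy by simp
  moreover have "bd (bd d) = {}" using find by (rule bd_bd)
  ultimately show False by simp
qed

text \<open>Two disjoint simplices are not acyclic, so \<open>X\<close> is a sphere. In its
  decomposition \<open>B\<close> is one of the simplices and \<open>L\<close> the other; since they
  are disjoint, the boundary of \<open>L\<close> is \<open>{{}}\<close>, so \<open>L\<close> is a
  point.\<close>

lemma NH_disjoint_simplices:
  assumes X: "NH_ball_or_sphere X" and prin: "principal_simplices X = {F, F'}"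
    and ne: "F \<noteq> F'" and disj: "F \<inter> F' = {}"
  shows "card F = 1 \<or> card F' = 1"
proof -
  note finX = NH_ball_or_sphere_fin_complex[OF X]
  have P: "p \<in> principal_simplices X \<longleftrightarrow> p = F \<or> p = F'" for p using prin by simp
  have FX: "F \<in> X" "F' \<in> X" using principal_simplicesD(1) P by blast+
  have fin: "finite F" "finite F'" using fin_complexD(3)[OF finX] FX by blast+
  have nonempty: "F \<noteq> {}" "F' \<noteq> {}"
    using principal_simplicesD(2)[of F X F'] principal_simplicesD(2)[of F' X F] P FX ne by auto
  have Xeq: "X = Pow F \<union> Pow F'" using generated_by_principal[OF finX] unfolding prin generated_by_def by simp
  consider d where "NH_ball d X" | d k where "NH_sphere d k X"
    using X unfolding NH_ball_or_sphere_def by blast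
  then show ?thesis
  proof cases
    case (1 d)
    have "acyclic_in 1 X" by (rule acyclic_complex_imp_acyclic_in[OF finX NH_ball_acyclic[OF 1]])
    then show ?thesis using acyclic_disjoint_simplices[OF fin disj nonempty] Xeq by simp
  next
    case (2 d k)
    then show ?thesis
    proof (cases rule: NH_sphere.cases)
      case sphere_minus1
      then show ?thesis using FX nonempty by simp
    next
      case (sphere_0 u w)
      then show ?thesis using FX nonempty by auto
    next
      case (sphere B k' L)
      note glue = sphere(5)
      obtain s where s: "s \<in> L" "card s = Suc k'" "s \<notin> B" "s \<in> principal_simplices L" "s \<in> principal_simplices X"
        using glue by (rule ball_gluing_top_simplex)
      have gl: "top_generated B X" "top_generated L X" "B \<inter> L = ball_boundary k' L"
        using glue by (auto simp: ball_gluing_def)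
      have finB: "fin_complex B" and finL: "fin_complex L" and LX: "L \<subseteq> X"
        and pB: "principal_simplices B \<subseteq> {F, F'}" and pL: "principal_simplices L \<subseteq> {F, F'}"
        using gl(1,2) prin by (simp_all add: top_generated_def)
      obtain E where E: "{F, F'} = {s, E}" "E \<noteq> s" "E \<in> principal_simplices X"
        using s(5) P ne by blast
      obtain p where p: "p \<in> principal_simplices B"
        using simplex_in_principal[OF finB fin_complexD(2)[OF finB]] by blast
      have "s \<notin> principal_simplices B" using s(3) principal_simplicesD(1) by blast
      then have "principal_simplices B = {E}" using p pB unfolding E(1) by blast
      then have Beq: "B = Pow E" using generated_by_principal[OF finB] by (simp add: generated_by_def)
      \<comment> \<open>Otherwise \<open>E\<close> would lie in the boundary of \<open>L\<close>,
        hence strictly below a top simplex, although it is principal.\<close>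
      have "E \<notin> L"
      proof
        assume "E \<in> L"
        then have "E \<in> ball_boundary k' L" using Beq gl(3) by blast
        then obtain u t where u: "u \<in> L" "card u = k'" "E \<subseteq> u" and t: "t \<in> L" "card t = k' + 1" "u \<subseteq> t"
          unfolding ball_boundary_def by blast
        have "u = E" "t = E" using principal_simplicesD(2)[OF E(3)] LX u t by blast+
        then show False using u t by simp
      qed
      then have "principal_simplices L = {s}"
        using pL s(4) principal_simplicesD(1) unfolding E(1) by blast
      then have Leq: "L = Pow s" using generated_by_principal[OF finL] by (simp add: generated_by_def)
      have fins: "finite s" using fin_complexD(3)[OF finL s(1)] .
      have sE: "s \<inter> E = {}" using E(1,2) disj by (auto simp: doubleton_eq_iff)
      have "{r. r \<subset> s} = Pow (E \<inter> s)"
        using gl(3) ball_boundary_Pow[OF fins s(2)] unfolding Beq Leq by blast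
      then have sub: "r \<subset> s \<Longrightarrow> r = {}" for r using sE by blast
      have "s \<noteq> {}" using s(2) by auto
      then obtain x where "x \<in> s" by blast
      then have "s = {x}" using sub[of "{x}"] by blast
      then have "card s = 1" by simp
      moreover have "s = F \<or> s = F'" using s(5) P by blast
      ultimately show ?thesis by blast
    qed
  qed
qed

section \<open>Principal simplices of vertex links\<close>

lemma principal_vlink:
  assumes "fin_complex X" "F \<in> principal_simplices X" "v \<in> F"
  shows "F - {v} \<in> principal_simplices (vlink v X)"
proof -
  have F: "F \<in> X" by (rule principal_simplicesD(1)[OF assms(2)])
  have "F - {v} \<in> X" by (rule fin_complexD(4)[OF assms(1) F]) blast
  moreover have "insert v (F - {v}) = F" using assms(3) by blast
  ultimately have "F - {v} \<in> vlink v X" using F by (simp add: vlink_def)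
  moreover have "\<not> F - {v} \<subset> t" if t: "t \<in> vlink v X" for t
  proof
    assume st: "F - {v} \<subset> t"
    have "insert v t \<in> X" "v \<notin> t" using t by (auto simp: vlink_def)
    moreover have "F \<subseteq> insert v t" using st by blast
    ultimately have "insert v t = F" using principal_simplicesD(2)[OF assms(2)] by blast
    then show False using st \<open>v \<notin> t\<close> by blast
  qed
  ultimately show ?thesis by (simp add: principal_simplices_def)
qed

lemma principal_of_vlink:
  assumes "fin_complex X" "E \<in> principal_simplices (vlink v X)"
  shows "v \<notin> E" "insert v E \<in> principal_simplices X"
proof -
  have E: "E \<in> vlink v X" by (rule principal_simplicesD(1)[OF assms(2)])
  then show vE: "v \<notin> E" by (simp add: vlink_def)
  have "insert v E \<in> X" using E by (simp add: vlink_def)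
  moreover have "\<not> insert v E \<subset> t" if t: "t \<in> X" for t
  proof
    assume st: "insert v E \<subset> t"
    have "t - {v} \<in> X" by (rule fin_complexD(4)[OF assms(1) t]) blast
    moreover have "insert v (t - {v}) = t" using st by blast
    ultimately have "t - {v} \<in> vlink v X" using t by (simp add: vlink_def)
    moreover have "E \<subseteq> t - {v}" using st vE by blast
    ultimately have "t - {v} = E" by (rule principal_simplicesD(2)[OF assms(2)])
    then show False using st by blast
  qed
  ultimately show "insert v E \<in> principal_simplices X" by (simp add: principal_simplices_def)
qed

text \<open>The link of \<open>F \<inter> F'\<close> is the disjoint union of the simplices \<open>F - F'\<close> and \<open>F' - F\<close>.\<close>

lemma NH_pair_of_facets:
  assumes "NH_ball_or_sphere X" "F \<in> principal_simplices X" "F' \<in> principal_simplices X" "F \<noteq> F'"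
    and "\<And>E. E \<in> principal_simplices X \<Longrightarrow> F \<inter> F' \<subseteq> E \<Longrightarrow> E = F \<or> E = F'"
  shows "card (F - F') = 1 \<or> card (F' - F) = 1"
  using assms
proof (induction "card (F \<inter> F')" arbitrary: X F F')
  case 0
  note X = NH_ball_or_sphere_fin_complex[OF "0.prems"(1)]
  have "finite F" using fin_complexD(3)[OF X principal_simplicesD(1)[OF "0.prems"(2)]] .
  then have disj: "F \<inter> F' = {}" using "0.hyps" by simp
  then have "principal_simplices X = {F, F'}" using 0 by blast
  then have "card F = 1 \<or> card F' = 1" by (rule NH_disjoint_simplices[OF "0.prems"(1) _ "0.prems"(4) disj])
  moreover have "F - F' = F" "F' - F = F'" using disj by blast+
  ultimately show ?case by simp
next
  case (Suc n)
  note X = NH_ball_or_sphere_fin_complex[OF Suc.prems(1)]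
  obtain v where v: "v \<in> F" "v \<in> F'" using Suc.hyps(2) by (metis IntE card.empty ex_in_conv nat.distinct(1))
  have FX: "F \<in> X" by (rule principal_simplicesD(1)[OF Suc.prems(2)])
  have finF: "finite F" using fin_complexD(3)[OF X FX] .
  let ?F = "F - {v}" and ?F' = "F' - {v}"
  have "card (?F - ?F') = 1 \<or> card (?F' - ?F) = 1"
  proof (rule Suc.hyps(1))
    have "?F \<inter> ?F' = F \<inter> F' - {v}" by blast
    then show "n = card (?F \<inter> ?F')" using Suc.hyps(2) v finF by simp
    show "NH_ball_or_sphere (vlink v X)"
      using v FX by (intro NH_ball_or_sphere_link[OF Suc.prems(1)]) blast
    show "?F \<in> principal_simplices (vlink v X)" "?F' \<in> principal_simplices (vlink v X)"
      using principal_vlink[OF X] Suc.prems(2,3) v by blast+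
    show "?F \<noteq> ?F'" using Suc.prems(4) v by blast
    show "E = ?F \<or> E = ?F'" if E: "E \<in> principal_simplices (vlink v X)" "?F \<inter> ?F' \<subseteq> E" for E
    proof -
      have "F \<inter> F' \<subseteq> insert v E" using E(2) by blast
      then have "insert v E = F \<or> insert v E = F'"
        by (rule Suc.prems(5)[OF principal_of_vlink(2)[OF X E(1)]])
      then show ?thesis using principal_of_vlink(1)[OF X E(1)] by blast
    qed
  qed
  moreover have "?F - ?F' = F - F'" "?F' - ?F = F' - F" using v by blast+
  ultimately show ?case by simp
qed

lemma minimal_NH_ball_imp_conical_staircase:
  assumes "minimal_NH_ball B"
  shows "conical_staircase B"
proof -
  obtain d k S L where B: "NH_ball d B" and S: "minimal_NH_sphere d (int k) S"
    and glue: "ball_gluing k S B L"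
    using assms unfolding minimal_NH_ball_def by (elim exE conjE)
  note finB = NH_ball_fin_complex[OF B] and finS = ball_gluing_fin_complex[OF glue]
  let ?P = "principal_simplices S" and ?Q = "principal_simplices B" and ?V = "\<Union>S"
  have QP: "?Q \<subseteq> ?P" and BS: "B \<subseteq> S" using glue by (auto simp: ball_gluing_def top_generated_def)
  have cardP: "card ?P = Suc (Suc k)"
    using S by (simp add: minimal_NH_sphere_def num_principal_def)
  have finP: "finite ?P" using cardP card.infinite by force
  have finp: "finite p" if "p \<in> ?P" for p
    using fin_complexD(3)[OF finS principal_simplicesD(1)[OF that]] .
  have finV: "finite ?V" using fin_complexD(1,3)[OF finS] by blast
  have pV: "p \<subseteq> ?V" if "p \<in> ?P" for p using principal_simplicesD(1)[OF that] by blast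
  have "\<not> acyclic_in (Suc k) (generated_by ?P (\<lambda>p. p))"
    using ball_gluing_not_acyclic[OF glue finB NH_ball_acyclic[OF B]] generated_by_principal[OF finS]
    by simp
  note nonac = this
  \<comment> \<open>Minimality enters here: \<open>k + 2\<close> facets are just enough to carry
    homology in degree \<open>Suc k\<close>, so the nerve of the facets is the boundary of a
    simplex.\<close>
  have "\<forall>p\<in>?P. \<exists>w. w \<notin> p \<and> (\<forall>q\<in>?P - {p}. w \<in> q)"
  proof
    fix p assume p: "p \<in> ?P"
    obtain w where w: "\<forall>q\<in>?P - {p}. w \<in> q"
      using not_acyclic_in_imp_Int_nonempty[OF finP finp cardP _ nonac p] by auto
    have "\<exists>q\<in>?P. w \<notin> q"
      by (rule not_acyclic_in_imp_Int_empty[OF finP finp _ nonac]) (use p in auto)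
    then have "w \<notin> p" using w by blast
    then show "\<exists>w. w \<notin> p \<and> (\<forall>q\<in>?P - {p}. w \<in> q)" using w by blast
  qed
  from bchoice[OF this] obtain wt where wt: "\<forall>p\<in>?P. wt p \<notin> p \<and> (\<forall>q\<in>?P - {p}. wt p \<in> q)"
    by (elim exE)
  have wt1: "wt p \<notin> p" if "p \<in> ?P" for p using wt that by blast
  have wt2: "wt p \<in> q" if "p \<in> ?P" "q \<in> ?P" "p \<noteq> q" for p q using wt that by blast
  have wt_eq: "p = q" if "p \<in> ?P" "q \<in> ?P" "wt p = wt q" for p q
    using wt1[OF that(2)] wt2[OF that(1,2)] that(3) by auto
  have inj: "inj_on wt ?Q" using wt_eq QP by (intro inj_onI) blast
  \<comment> \<open>A facet of \<open>S\<close> outside \<open>B\<close> supplies the apex: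
    \<open>wt p0\<close> lies in every other facet, in particular in all facets of
    \<open>B\<close>.\<close>
  obtain p0 where p0: "p0 \<in> ?P" "p0 \<notin> B" using ball_gluing_top_simplex[OF glue] by metis
  have p0Q: "p0 \<notin> ?Q" using p0(2) principal_simplicesD(1) by blast
  obtain q0 where q0: "q0 \<in> ?Q" using simplex_in_principal[OF finB fin_complexD(2)[OF finB]] by blast
  define \<iota> where "\<iota> = the_inv_into ?Q wt"
  have \<iota>: "\<iota> (wt p) = p" if "p \<in> ?Q" for p unfolding \<iota>_def by (rule the_inv_into_f_f[OF inj that])
  define D where "D w = ?V - \<iota> w - {w}" for w
  have D: "D (wt p) = ?V - p - {wt p}" if "p \<in> ?Q" for p using \<iota>[OF that] by (simp add: D_def)
  let ?W = "wt ` ?Q"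
  have wtV: "wt p \<in> ?V" if p: "p \<in> ?P" for p
  proof -
    \<comment> \<open>Any facet other than \<open>p\<close> shows that \<open>wt p\<close> is a
      vertex; \<open>p0\<close> serves unless \<open>p\<close> is \<open>p0\<close> itself.\<close>
    define q where "q = (if p = p0 then q0 else p0)"
    have "q0 \<in> ?P" "q0 \<noteq> p0" using q0 p0Q QP by auto
    then have q: "q \<in> ?P" "p \<noteq> q" using p0(1) by (auto simp: q_def)
    show ?thesis using wt2[OF p q] pV[OF q(1)] by blast
  qed
  have pair: "D (wt q) \<subseteq> D (wt p)" if pq: "p \<in> ?Q" "q \<in> ?Q" "p \<noteq> q" "card (p - q) = 1" for p q
  proof -
    \<comment> \<open>The single point of \<open>p - q\<close> must be \<open>wt q\<close>, so apart
      from \<open>wt q\<close> the complement of \<open>q\<close> is contained in that of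
      \<open>p\<close>.\<close>
    obtain x where x: "p - q = {x}" using pq(4) by (rule card_1_singletonE)
    have "wt q \<in> p - q" using wt1[of q] wt2[of q p] pq QP by blast
    then have "p - q = {wt q}" using x by simp
    moreover have "wt p \<in> q" using wt2[of p q] pq QP by blast
    ultimately show ?thesis unfolding D[OF pq(1)] D[OF pq(2)] by blast
  qed
  have data: "staircase_data ?V ?W D"
    unfolding staircase_data_def
  proof (intro conjI ballI)
    show "finite ?V" by (rule finV)
    show "?W \<subseteq> ?V" using wtV QP by blast
    show "?W \<noteq> {}" using q0 by blast
    show "D w \<subseteq> ?V - ?W" if w: "w \<in> ?W" for w
    proof -
      obtain p where p: "p \<in> ?Q" "w = wt p" using w by blast
      have "wt q \<notin> D (wt p)" if q: "q \<in> ?Q" for q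
      proof (cases "q = p")
        case False
        then have "wt q \<in> p" using wt2[of q p] p(1) q QP by blast
        then show ?thesis using D[OF p(1)] by blast
      qed (simp add: D[OF p(1)])
      moreover have "D w \<subseteq> ?V" by (auto simp: D_def)
      ultimately show ?thesis using p(2) by blast
    qed
    show "D w \<subseteq> D w' \<or> D w' \<subseteq> D w" if w: "w \<in> ?W" "w' \<in> ?W" for w w'
    proof -
      obtain p q where pq: "p \<in> ?Q" "w = wt p" "q \<in> ?Q" "w' = wt q" using w by blast
      show ?thesis
      proof (cases "p = q")
        case False
        have "card (p - q) = 1 \<or> card (q - p) = 1"
        proof (rule NH_pair_of_facets[OF _ pq(1,3) False])
          show "NH_ball_or_sphere B" using B unfolding NH_ball_or_sphere_def by blast
          show "E = p \<or> E = q" if E: "E \<in> ?Q" "p \<inter> q \<subseteq> E" for E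
          \<comment> \<open>A third facet \<open>E\<close> cannot contain
            \<open>p \<inter> q\<close>, because \<open>wt E\<close> lies in \<open>p\<close> and
            \<open>q\<close> but not in \<open>E\<close>.\<close>
          proof (rule ccontr)
            assume "\<not> (E = p \<or> E = q)"
            then have "wt E \<in> p" "wt E \<in> q" using wt2[of E p] wt2[of E q] E(1) pq QP by blast+
            then show False using wt1[of E] E QP by blast
          qed
        qed
        then show ?thesis using pair[OF pq(1,3) False] pair[OF pq(3,1)] False pq(2,4) by blast
      qed (simp add: pq)
    qed
  qed
  moreover have "apex ?V ?W D (wt p0)"
    unfolding apex_def
  proof (intro conjI ballI)
    show "wt p0 \<in> ?V" by (rule wtV[OF p0(1)])
    show "wt p0 \<notin> ?W" using wt_eq[OF p0(1)] p0Q QP by blast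
    show "wt p0 \<notin> D w" if w: "w \<in> ?W" for w
    proof -
      obtain p where p: "p \<in> ?Q" "w = wt p" using w by blast
      then have "wt p0 \<in> p" using wt2[OF p0(1), of p] p0Q QP by blast
      then show ?thesis using p D by blast
    qed
  qed
  moreover have "B = staircase ?V ?W D"
  proof -
    have "?V - insert (wt p) (D (wt p)) = p" if p: "p \<in> ?Q" for p
      unfolding D[OF p] using pV[of p] wt1[of p] p QP by blast
    then have "staircase ?V ?W D = (\<Union>p\<in>?Q. Pow p)" unfolding staircase_def by simp
    then show ?thesis using generated_by_principal[OF finB] by (simp add: generated_by_def)
  qed
  ultimately show ?thesis unfolding conical_staircase_def by blast
qed

lemma minimal_NH_ball_iff_conical_staircase: "minimal_NH_ball B \<longleftrightarrow> conical_staircase B"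
proof
  assume "conical_staircase B"
  then obtain V W D a where "staircase_data V W D" "apex V W D a" "B = staircase V W D"
    unfolding conical_staircase_def by (elim exE conjE)
  then show "minimal_NH_ball B" using staircase_minimal_NH_ball by simp
qed (rule minimal_NH_ball_imp_conical_staircase)

lemma alexander_dual_involution:
  assumes "K \<subseteq> Pow V"
  shows "alexander_dual V (alexander_dual V K) = K"
proof (rule set_eqI)
  fix s
  have "V - (V - s) = s" if "s \<subseteq> V" using that by blast
  then show "s \<in> alexander_dual V (alexander_dual V K) \<longleftrightarrow> s \<in> K"
    using assms unfolding alexander_dual_def by auto
qed

theorem theorem4p6:
  fixes K :: "'a::infinite set set" and \<tau> :: "'a set"
  assumes "fin_complex K"
    and "finite \<tau>" and "\<tau> \<inter> vertices K = {}"
    and "\<not> (\<tau> = {} \<and> (\<exists>V. V \<noteq> {} \<and> K = Pow V))"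
  shows "minimal_NH_ball K \<longleftrightarrow> minimal_NH_ball (dual_rel K \<tau>)"
  unfolding minimal_NH_ball_iff_conical_staircase
proof
  assume "conical_staircase K"
  then show "conical_staircase (dual_rel K \<tau>)" by (rule conical_staircase_dual_rel[OF _ assms(2-4)])
next
  let ?U = "vertices K \<union> \<tau>" and ?M = "dual_rel K \<tau>"
  assume M: "conical_staircase ?M"
  \<comment> \<open>\<open>?T\<close> consists of the points of \<open>?U\<close> that are no
    vertices of the dual, so dualizing \<open>?M\<close> relative to \<open>?T\<close> is again
    duality over \<open>?U\<close> and returns \<open>K\<close>.\<close>
  let ?T = "?U - \<Union>?M"
  have "\<Union>?M \<subseteq> ?U" by (auto simp: dual_rel_def alexander_dual_def)
  then have U: "\<Union>?M \<union> ?T = ?U" by blast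
  have K: "alexander_dual ?U ?M = K"
    unfolding dual_rel_def by (rule alexander_dual_involution) blast
  have "finite (vertices K)" using fin_complexD(1,3)[OF assms(1)] by blast
  then have "finite ?T" using assms(2) by simp
  moreover have "?T \<inter> \<Union>?M = {}" by blast
  \<comment> \<open>If the dual were the full simplex on \<open>?U\<close>, dualizing back would
    give the void family, whereas \<open>K\<close> contains the empty simplex.\<close>
  moreover have "\<not> (?T = {} \<and> (\<exists>V. V \<noteq> {} \<and> ?M = Pow V))"
  proof
    assume *: "?T = {} \<and> (\<exists>V. V \<noteq> {} \<and> ?M = Pow V)"
    then obtain V where V: "?M = Pow V" by blast
    then have "V = ?U" using U * by auto
    then have "alexander_dual ?U ?M = {}" using V by (auto simp: alexander_dual_def)
    then show False using K fin_complexD(2)[OF assms(1)] by simp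
  qed
  ultimately have "conical_staircase (dual_rel ?M ?T)" by (rule conical_staircase_dual_rel[OF M])
  then show "conical_staircase K" unfolding dual_rel_def[of ?M] U K .
qed

end
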